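(* Let $a>b>0$ and $\lambda\ne0$, and let $p=\sqrt{a^2+b^2}$, $r=\sqrt{a^2-b^2}$. The bifurcation diagram of the momentum map $J=G\times K\times H:P^6\to\mathbb R^3$ of the Kowalevski gyrostat in two constant fields is included in the union of the following (intersecting) subsets of $\mathbb R^3(g,k,h)$: 1) the pair of straight lines $$\Gamma_+:\ \ k=(a+b)^2,\quad g=-ab\Big(h-\frac{\lambda^2}{2}\Big);\qquad \Gamma_-:\ \ k=(a-b)^2,\quad g=ab\Big(h-\frac{\lambda^2}{2}\Big);$$ 2) the surface (parametrized by $h$ and $s\in\mathbb R\setminus\{0\}$) $$\Gamma_1:\quad k=4\lambda^2s-2\lambda^2h+\frac{r^4}{4s^2},\qquad g=-\lambda^2s^2+\frac12p^2\Big(h+\frac{\lambda^2}{2}\Big)-\frac{r^4}{4s};$$ 3) the surface (parametrized by $h$ and $s\in\mathbb R\setminus\{0\}$) $$\Gamma_2:\quad k=3s^2-4\Big(h-\frac{\lambda^2}{2}\Big)s+p^2+\Big(h-\frac{\lambda^2}{2}\Big)^2-\frac{p^4-r^4}{4s^2},\qquad g=-s^3+\Big(h-\frac{\lambda^2}{2}\Big)s^2+\frac{p^4-r^4}{4s}.$$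
   Context: Phase space. Fix real $a>b>0$ and $\lambda\ne0$. $P^6=\{(\boldsymbol\omega,\boldsymbol\alpha,\boldsymbol\beta)\in\mathbb R^3\times\mathbb R^3\times\mathbb R^3:\ \boldsymbol\alpha\cdot\boldsymbol\alpha=a^2,\ \boldsymbol\beta\cdot\boldsymbol\beta=b^2,\ \boldsymbol\alpha\cdot\boldsymbol\beta=0\}$, a smooth 6-dimensional manifold. First integrals. With $\mathbf M=(2\omega_1,2\omega_2,\omega_3+\lambda)$, $M_\alpha=\mathbf M\cdot\boldsymbol\alpha$, $M_\beta=\mathbf M\cdot\boldsymbol\beta$, $M_\gamma=\mathbf M\cdot(\boldsymbol\alpha\times\boldsymbol\beta)$, put $$H=\omega_1^2+\omega_2^2+\tfrac12\omega_3^2-\alpha_1-\beta_2,$$ $$K=(\omega_1^2-\omega_2^2+\alpha_1-\beta_2)^2+(2\omega_1\omega_2+\alpha_2+\beta_1)^2+2\lambda[(\omega_3-\lambda)(\omega_1^2+\omega_2^2)+2\omega_1\alpha_3+2\omega_2\beta_3],$$ $$G=\tfrac14(M_\alpha^2+M_\beta^2)+\tfrac12(\omega_3-\lambda)M_\gamma-b^2\alpha_1-a^2\beta_2.$$ These are first integrals in involution of the gyrostat equations $2\dot\omega_1=\omega_2(\omega_3-\lambda)+\beta_3$, $2\dot\omega_2=-\omega_1(\omega_3-\lambda)-\alpha_3$, $\dot\omega_3=\alpha_2-\beta_1$, $\dot{\boldsymbol\alpha}=\boldsymbol\alpha\times\boldsymbol\omega$, $\dot{\boldsymbol\beta}=\boldsymbol\beta\times\boldsymbol\omega$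 on $P^6$. The momentum map is $J=(G,K,H):P^6\to\mathbb R^3$, with values denoted $(g,k,h)$. The bifurcation diagram of $J$ is the set $\Sigma\subset\mathbb R^3$ over which $J$ fails to be locally trivial (i.e. the points having no neighbourhood over which $J$ is a trivial smooth fibration). *)

theory Defs
  imports "HOL-Analysis.Analysis"
begin

section \<open>Smooth maps, submanifolds and bifurcation diagrams\<close>

text \<open>Intended for open \<open>S\<close>: all directional derivatives up to order \<open>n\<close> exist and are
  continuous, and those of order less than \<open>n\<close> are Frechet differentiable.\<close>

fun Ck_on :: "nat \<Rightarrow> ('a::euclidean_space \<Rightarrow> 'b::euclidean_space) \<Rightarrow> 'a set \<Rightarrow> bool" where
  "Ck_on 0 f S \<longleftrightarrow> continuous_on S f"
| "Ck_on (Suc n) f S \<longleftrightarrow>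
     (\<forall>x\<in>S. f differentiable (at x)) \<and>
     (\<forall>v. Ck_on n (\<lambda>x. frechet_derivative f (at x) v) S)"

text \<open>Smoothness on an arbitrary subset of a Euclidean space: local extendability to a
  \<open>C\<^sup>\<infinity>\<close> map on an open set of the ambient space.\<close>

definition smooth_map_on :: "'a::euclidean_space set \<Rightarrow> ('a \<Rightarrow> 'b::euclidean_space) \<Rightarrow> bool" where
  "smooth_map_on X f \<longleftrightarrow>
     (\<forall>x\<in>X. \<exists>U g. open U \<and> x \<in> U \<and> (\<forall>n. Ck_on n g U) \<and> (\<forall>y\<in>X \<inter> U. g y = f y))"

definition diffeomorphism ::
    "'a::euclidean_space set \<Rightarrow> 'b::euclidean_space set \<Rightarrow> ('a \<Rightarrow> 'b) \<Rightarrow> ('b \<Rightarrow> 'a) \<Rightarrow> bool" where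
  "diffeomorphism X Y f g \<longleftrightarrow>
     homeomorphism X Y f g \<and> smooth_map_on X f \<and> smooth_map_on Y g"

text \<open>Embedded \<open>d\<close>-dimensional submanifolds (without boundary) of a Euclidean space,
  via slice charts. The empty set is one for every \<open>d\<close>.\<close>

definition smooth_submanifold :: "nat \<Rightarrow> 'a::euclidean_space set \<Rightarrow> bool" where
  "smooth_submanifold d S \<longleftrightarrow>
     (\<forall>x\<in>S. \<exists>U V \<phi> \<psi> L. open U \<and> x \<in> U \<and> open (V :: 'a set) \<and> diffeomorphism U V \<phi> \<psi> \<and>
        subspace L \<and> dim L = d \<and> \<phi> ` (S \<inter> U) = L \<inter> V)"

text \<open>Looking for the typical fibre \<open>F\<close> inside the ambient space of \<open>P\<close> is no loss of
  generality: for \<open>c \<in> U\<close> a trivialization restricts to a diffeomorphism from the fibre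
  of \<open>J\<close> over \<open>c\<close> onto \<open>{c} \<times> F\<close>. The fibre may be empty, so a point outside the closure
  of the image \<open>J ` P\<close> does not belong to the bifurcation diagram.\<close>

definition trivial_fibration_over ::
    "'a::euclidean_space set \<Rightarrow> ('a \<Rightarrow> 'b::euclidean_space) \<Rightarrow> 'b set \<Rightarrow> bool" where
  "trivial_fibration_over P J U \<longleftrightarrow>
     (\<exists>(F :: 'a set) d \<Phi> \<Psi>. smooth_submanifold d F \<and>
        diffeomorphism (P \<inter> J -` U) (U \<times> F) \<Phi> \<Psi> \<and>
        (\<forall>x \<in> P \<inter> J -` U. fst (\<Phi> x) = J x))"

definition bifurcation_diagram ::
    "'a::euclidean_space set \<Rightarrow> ('a \<Rightarrow> 'b::euclidean_space) \<Rightarrow> 'b set" where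
  "bifurcation_diagram P J = {c. \<not> (\<exists>U. open U \<and> c \<in> U \<and> trivial_fibration_over P J U)}"


section \<open>The Kowalevski gyrostat in two constant fields\<close>

text \<open>Points are triples \<open>(\<omega>, \<alpha>, \<beta>)\<close> of the angular velocity and the two field vectors;
  \<open>l\<close> is the gyrostatic momentum \<open>\<lambda>\<close>.\<close>

type_synonym state = "(real^3) \<times> (real^3) \<times> (real^3)"

definition phase_space :: "real \<Rightarrow> real \<Rightarrow> state set" where
  "phase_space a b = {(\<omega>, \<alpha>, \<beta>). \<alpha> \<bullet> \<alpha> = a\<^sup>2 \<and> \<beta> \<bullet> \<beta> = b\<^sup>2 \<and> \<alpha> \<bullet> \<beta> = 0}"

definition ang_mom :: "real \<Rightarrow> real^3 \<Rightarrow> real^3" where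
  "ang_mom l \<omega> = vector [2 * \<omega>$1, 2 * \<omega>$2, \<omega>$3 + l]"

definition H_int :: "state \<Rightarrow> real" where
  "H_int = (\<lambda>(\<omega>, \<alpha>, \<beta>). (\<omega>$1)\<^sup>2 + (\<omega>$2)\<^sup>2 + (\<omega>$3)\<^sup>2 / 2 - \<alpha>$1 - \<beta>$2)"

definition K_int :: "real \<Rightarrow> state \<Rightarrow> real" where
  "K_int l = (\<lambda>(\<omega>, \<alpha>, \<beta>).
     ((\<omega>$1)\<^sup>2 - (\<omega>$2)\<^sup>2 + \<alpha>$1 - \<beta>$2)\<^sup>2 + (2 * \<omega>$1 * \<omega>$2 + \<alpha>$2 + \<beta>$1)\<^sup>2
     + 2 * l * ((\<omega>$3 - l) * ((\<omega>$1)\<^sup>2 + (\<omega>$2)\<^sup>2) + 2 * \<omega>$1 * \<alpha>$3 + 2 * \<omega>$2 * \<beta>$3))"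

definition G_int :: "real \<Rightarrow> real \<Rightarrow> real \<Rightarrow> state \<Rightarrow> real" where
  "G_int a b l = (\<lambda>(\<omega>, \<alpha>, \<beta>).
     let M = ang_mom l \<omega>; M\<^sub>\<alpha> = M \<bullet> \<alpha>; M\<^sub>\<beta> = M \<bullet> \<beta>; M\<^sub>\<gamma> = M \<bullet> cross3 \<alpha> \<beta>
     in (M\<^sub>\<alpha>\<^sup>2 + M\<^sub>\<beta>\<^sup>2) / 4 + (\<omega>$3 - l) * M\<^sub>\<gamma> / 2 - b\<^sup>2 * \<alpha>$1 - a\<^sup>2 * \<beta>$2)"

definition momentum_map :: "real \<Rightarrow> real \<Rightarrow> real \<Rightarrow> state \<Rightarrow> real \<times> real \<times> real" where
  "momentum_map a b l x = (G_int a b l x, K_int l x, H_int x)"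


section \<open>The bifurcation surfaces, in coordinates \<open>(g, k, h)\<close>\<close>

definition Gamma_plus :: "real \<Rightarrow> real \<Rightarrow> real \<Rightarrow> (real \<times> real \<times> real) set" where
  "Gamma_plus a b l = {(g, k, h). k = (a + b)\<^sup>2 \<and> g = - a * b * (h - l\<^sup>2 / 2)}"

definition Gamma_minus :: "real \<Rightarrow> real \<Rightarrow> real \<Rightarrow> (real \<times> real \<times> real) set" where
  "Gamma_minus a b l = {(g, k, h). k = (a - b)\<^sup>2 \<and> g = a * b * (h - l\<^sup>2 / 2)}"

definition Gamma_1 :: "real \<Rightarrow> real \<Rightarrow> real \<Rightarrow> (real \<times> real \<times> real) set" where
  "Gamma_1 p r l = {(g, k, h). \<exists>s. s \<noteq> 0 \<and>
     k = 4 * l\<^sup>2 * s - 2 * l\<^sup>2 * h + r ^ 4 / (4 * s\<^sup>2) \<and>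
     g = - l\<^sup>2 * s\<^sup>2 + p\<^sup>2 * (h + l\<^sup>2 / 2) / 2 - r ^ 4 / (4 * s)}"

definition Gamma_2 :: "real \<Rightarrow> real \<Rightarrow> real \<Rightarrow> (real \<times> real \<times> real) set" where
  "Gamma_2 p r l = {(g, k, h). \<exists>s. s \<noteq> 0 \<and>
     k = 3 * s\<^sup>2 - 4 * (h - l\<^sup>2 / 2) * s + p\<^sup>2 + (h - l\<^sup>2 / 2)\<^sup>2 - (p ^ 4 - r ^ 4) / (4 * s\<^sup>2) \<and>
     g = - (s ^ 3) + (h - l\<^sup>2 / 2) * s\<^sup>2 + (p ^ 4 - r ^ 4) / (4 * s)}"

end

theory Submission
  imports Defs "HOL-Computational_Algebra.Fundamental_Theorem_Algebra"
begin

text \<open>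
  The bifurcation diagram consists of critical values, and a critical value forces a double root
  of one of two explicit polynomials; the surfaces are the loci of these double roots.

  \<^bold>\<open>Regular values.\<close> The phase space is the zero set of three quadratic constraints \<open>q\<close> in
  \<open>\<real>\<^sup>9\<close>, and the momentum map \<open>J\<close> is proper on it, because \<open>\<alpha>\<close> and \<open>\<beta>\<close> are bounded and the energy
  bounds \<open>\<omega>\<close>. If \<open>(J, q)\<close> is a submersion along the fibre \<open>F\<close> over \<open>c\<close>, then \<open>J\<close> is trivial near \<open>c\<close>
  (Ehresmann). No flow is integrated: the normal coordinates \<open>e (y, w) = y + D(J, q)(y)\<^sup>T w\<close> yield
  both a smooth retraction of a neighbourhood of \<open>F\<close> onto \<open>F\<close> and, for \<open>y \<in> F\<close>, a point of the fibre
  over a nearby value \<open>u\<close>; these two maps trivialize \<open>J\<close>. Both come from the inverse function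
  theorem applied along the compact set \<open>F \<times> {0}\<close> (\<open>smooth_inverse_near_compact\<close>,
  \<open>submersion_trivial_near_compact_fibre\<close>). So over a value of the diagram there is a phase point
  where \<open>c\<^sub>G dG + c\<^sub>K dK + c\<^sub>H dH = 0\<close> on the tangent space, not all coefficients being zero
  (\<open>bifurcation_diagram_critical\<close>).

  \<^bold>\<open>Lax matrix.\<close> The system has a Lax matrix \<open>L(s)\<close> in \<open>sp(4, \<complex>)\<close>. It satisfies \<open>L\<^sup>2 = f + Q\<close> with
  a scalar \<open>f\<close> and \<open>Q\<^sup>2 = \<delta>\<close> scalar, and its invariants are the two polynomials
  \<open>chi2 = s\<^sup>2 \<delta>\<close> (a quartic) and \<open>chi1 = s\<^sup>2 (\<delta> - f\<^sup>2)\<close> (a cubic), whose coefficients are functions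
  of \<open>G, K, H\<close>. A critical point with \<open>(c\<^sub>G, c\<^sub>K) \<noteq> 0\<close> yields a truncation \<open>M(s)\<close> of
  \<open>(\<phi>0 + \<phi>1 s) L Q + \<psi> L\<close> that commutes with \<open>L(s)\<close> for every \<open>s\<close> (\<open>M_commute\<close>), where
  \<open>\<phi>1 = c\<^sub>G\<close> and \<open>\<phi>0 = 2 c\<^sub>K\<close>. Commuting with \<open>L\<close> means \<open>M L = A + R\<close> with \<open>A\<close> and \<open>R Q = B\<close> scalar;
  moreover \<open>B\<close> vanishes at the roots of \<open>chi2\<close>, and \<open>B = f A\<close> at the roots of \<open>chi1\<close>
  (\<open>commuting_invariants\<close>). Counting degrees, this is impossible if \<open>chi1\<close> and \<open>chi2\<close> both have only
  simple roots (\<open>critical_double_root\<close>).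

  \<^bold>\<open>Surfaces.\<close> A double root of the real cubic \<open>chi1\<close> is real, and the equations
  \<open>chi1 = chi1' = 0\<close>, solved for \<open>k\<close> and \<open>g\<close>, are the parametrization of \<open>\<Gamma>\<^sub>1\<close>. Likewise a real double
  root of \<open>chi2\<close> gives \<open>\<Gamma>\<^sub>2\<close>; a pair of conjugate double roots makes the quartic a square, which is
  \<open>\<Gamma>\<^sub>-\<close>. In the remaining case \<open>c\<^sub>G = c\<^sub>K = 0\<close> the point is an equilibrium with \<open>\<alpha>\<close> and \<open>\<beta>\<close> along the
  first two axes, and its value lies on \<open>\<Gamma>\<^sub>+\<close> or \<open>\<Gamma>\<^sub>-\<close>.
\<close>

section \<open>Calculus of \<open>C\<^sup>k\<close> maps\<close>

lemma frechet_derivative_eqI: "(f has_derivative f') (at x) \<Longrightarrow> frechet_derivative f (at x) = f'"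
  using frechet_derivative_at by metis

lemma Ck_on_cong:
  assumes "open S" "\<And>x. x \<in> S \<Longrightarrow> f x = g x" "Ck_on n f S"
  shows "Ck_on n g S"
  using assms(2,3)
proof (induction n arbitrary: f g)
  case 0
  then show ?case by (simp cong: continuous_on_cong)
next
  case (Suc n)
  have d: "(g has_derivative frechet_derivative f (at x)) (at x)" if "x \<in> S" for x
  proof (rule has_derivative_transform_within_open[OF _ \<open>open S\<close> that])
    show "(f has_derivative frechet_derivative f (at x)) (at x)"
      using Suc.prems(2) that by (simp add: frechet_derivative_works[symmetric])
  qed (rule Suc.prems(1))
  have "Ck_on n (\<lambda>x. frechet_derivative g (at x) v) S" for v
  proof (rule Suc.IH)
    show "Ck_on n (\<lambda>x. frechet_derivative f (at x) v) S" using Suc.prems(2) by simp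
  qed (simp only: frechet_derivative_eqI[OF d])
  moreover have "g differentiable (at x)" if "x \<in> S" for x
    using d[OF that] by (rule differentiableI)
  ultimately show ?case by simp
qed

lemma Ck_on_SucI:
  assumes "open S" and d: "\<And>x. x \<in> S \<Longrightarrow> (f has_derivative f' x) (at x)"
    and C: "\<And>v. Ck_on n (\<lambda>x. f' x v) S"
  shows "Ck_on (Suc n) f S"
proof -
  have "Ck_on n (\<lambda>x. frechet_derivative f (at x) v) S" for v
    by (rule Ck_on_cong[OF \<open>open S\<close> _ C[of v]]) (simp only: frechet_derivative_eqI[OF d])
  moreover have "f differentiable (at x)" if "x \<in> S" for x
    using d[OF that] by (rule differentiableI)
  ultimately show ?thesis by simp
qed

lemma Ck_on_subset: "Ck_on n f S \<Longrightarrow> T \<subseteq> S \<Longrightarrow> Ck_on n f T"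
  by (induction n arbitrary: f) (auto intro: continuous_on_subset)

lemma Ck_on_continuous: "Ck_on n f S \<Longrightarrow> continuous_on S f"
  by (cases n)
    (auto intro!: continuous_at_imp_continuous_on differentiable_imp_continuous_within)

lemma Ck_on_Suc_imp: "Ck_on (Suc n) f S \<Longrightarrow> Ck_on n f S"
proof (induction n arbitrary: f)
  case 0
  then show ?case using Ck_on_continuous[OF 0] by simp
next
  case (Suc n)
  then show ?case by auto
qed

lemma Ck_on_local:
  assumes "\<And>x. x \<in> S \<Longrightarrow> \<exists>U. open U \<and> x \<in> U \<and> Ck_on n f U"
  shows "Ck_on n f S"
  using assms
proof (induction n arbitrary: f)
  case 0
  have "isCont f x" if "x \<in> S" for x
    using 0[OF that] by (auto simp: continuous_on_eq_continuous_at)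
  then show ?case by (auto intro: continuous_at_imp_continuous_on)
next
  case (Suc n)
  have "f differentiable (at x)" if "x \<in> S" for x using Suc.prems[OF that] by auto
  moreover have "Ck_on n (\<lambda>x. frechet_derivative f (at x) v) S" for v
  proof (rule Suc.IH)
    fix x assume "x \<in> S"
    from Suc.prems[OF this] show "\<exists>U. open U \<and> x \<in> U \<and> Ck_on n (\<lambda>x. frechet_derivative f (at x) v) U"
      by auto
  qed
  ultimately show ?case by simp
qed

lemma Ck_on_const: "Ck_on n (\<lambda>x. c) S"
  by (induction n arbitrary: c) simp_all

lemma Ck_on_linear:
  assumes "bounded_linear f"
  shows "Ck_on n f S"
proof (cases n)
  case 0
  then show ?thesis using assms by (simp add: linear_continuous_on)
next
  case (Suc m)
  have d: "(f has_derivative f) (at x)" for x by (rule bounded_linear.has_derivative[OF assms has_derivative_ident])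
  then show ?thesis
    by (auto simp: Suc frechet_derivative_eqI[OF d] Ck_on_const differentiable_def)
qed

lemma Ck_on_add:
  assumes "open S" "Ck_on n f S" "Ck_on n g S"
  shows "Ck_on n (\<lambda>x. f x + g x) S"
  using assms(2,3)
proof (induction n arbitrary: f g)
  case 0
  then show ?case by (simp add: continuous_on_add)
next
  case (Suc n)
  show ?case
  proof (rule Ck_on_SucI[OF \<open>open S\<close>])
    fix x assume "x \<in> S"
    with Suc.prems show "((\<lambda>x. f x + g x) has_derivative
        (\<lambda>v. frechet_derivative f (at x) v + frechet_derivative g (at x) v)) (at x)"
      by (intro has_derivative_add) (simp_all add: frechet_derivative_works[symmetric])
  next
    fix v
    show "Ck_on n (\<lambda>x. frechet_derivative f (at x) v + frechet_derivative g (at x) v) S"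
      using Suc.prems by (intro Suc.IH) auto
  qed
qed

text \<open>The differential of a bilinear expression is again a sum of bilinear expressions in maps
  of one order less, so a single induction covers scalar multiples, products and inner products.\<close>

lemma Ck_on_bilinear:
  assumes "bounded_bilinear h" "open S" "Ck_on n f S" "Ck_on n g S"
  shows "Ck_on n (\<lambda>x. h (f x) (g x)) S"
  using assms(3,4)
proof (induction n arbitrary: f g)
  case 0
  then show ?case by (simp add: bounded_bilinear.continuous_on[OF assms(1)])
next
  case (Suc n)
  show ?case
  proof (rule Ck_on_SucI[OF \<open>open S\<close>])
    fix x assume "x \<in> S"
    with Suc.prems show "((\<lambda>x. h (f x) (g x)) has_derivative
        (\<lambda>v. h (f x) (frechet_derivative g (at x) v) + h (frechet_derivative f (at x) v) (g x))) (at x)"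
      by (intro bounded_bilinear.FDERIV[OF assms(1)]) (simp_all add: frechet_derivative_works[symmetric])
  next
    fix v
    show "Ck_on n (\<lambda>x. h (f x) (frechet_derivative g (at x) v) + h (frechet_derivative f (at x) v) (g x)) S"
      using Suc.prems Ck_on_Suc_imp[OF Suc.prems(1)] Ck_on_Suc_imp[OF Suc.prems(2)]
      by (intro Ck_on_add[OF \<open>open S\<close>] Suc.IH) auto
  qed
qed

lemmas Ck_on_scaleR = Ck_on_bilinear[OF bounded_bilinear_scaleR]
lemmas Ck_on_mult = Ck_on_bilinear[OF bounded_bilinear_mult]
lemmas Ck_on_inner = Ck_on_bilinear[OF bounded_bilinear_inner]

lemma Ck_on_minus:
  assumes "open S" "Ck_on n f S" 
  shows "Ck_on n (\<lambda>x. - f x) S"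
  using Ck_on_scaleR[OF assms(1) Ck_on_const[of n "-1"] assms(2)] by simp

lemma Ck_on_diff:
  assumes "open S" "Ck_on n f S" "Ck_on n g S"
  shows "Ck_on n (\<lambda>x. f x - g x) S"
  using Ck_on_add[OF assms(1,2) Ck_on_minus[OF assms(1,3)]] by simp

lemma Ck_on_sum:
  assumes "open S" "\<And>i. i \<in> I \<Longrightarrow> Ck_on n (f i) S"
  shows "Ck_on n (\<lambda>x. \<Sum>i\<in>I. f i x) S"
  using assms(2)
  by (induction I rule: infinite_finite_induct) (auto intro: Ck_on_const Ck_on_add[OF assms(1)])

lemma Ck_on_power:
  fixes f :: "'a::euclidean_space \<Rightarrow> real"
  assumes "open S" "Ck_on n f S"
  shows "Ck_on n (\<lambda>x. f x ^ k) S"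
  by (induction k) (auto intro: Ck_on_const Ck_on_mult assms)

lemma linear_expand_Basis:
  fixes l :: "'a::euclidean_space \<Rightarrow> 'b::real_vector"
  assumes "linear l"
  shows "l v = (\<Sum>i\<in>Basis. (v \<bullet> i) *\<^sub>R l i)"
proof -
  have "l (\<Sum>i\<in>Basis. (v \<bullet> i) *\<^sub>R i) = (\<Sum>i\<in>Basis. (v \<bullet> i) *\<^sub>R l i)"
    by (simp add: linear_sum[OF assms] linear_scale[OF assms])
  then show ?thesis by (simp add: euclidean_representation)
qed

text \<open>In the chain rule the outer differential is expanded over a basis. This keeps the inner map
  fixed in the induction: each summand is a product of a directional derivative of \<open>f\<close> with the
  composition of a directional derivative of \<open>g\<close> with \<open>f\<close>.\<close>

lemma Ck_on_compose:
  assumes "open S" "open T" "Ck_on n g T" "Ck_on n f S" "f ` S \<subseteq> T"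
  shows "Ck_on n (\<lambda>x. g (f x)) S"
  using assms(3,4)
proof (induction n arbitrary: g)
  case 0
  then show ?case using continuous_on_compose2[of T g S f] assms(5) by simp
next
  case (Suc n)
  define D where "D x v = (\<Sum>i\<in>Basis. (frechet_derivative f (at x) v \<bullet> i) *\<^sub>R frechet_derivative g (at (f x)) i)" for x v
  have "((\<lambda>x. g (f x)) has_derivative D x) (at x)" if "x \<in> S" for x
  proof -
    have f: "(f has_derivative frechet_derivative f (at x)) (at x)"
      using Suc.prems that by (auto simp: frechet_derivative_works)
    have g: "(g has_derivative frechet_derivative g (at (f x))) (at (f x))"
      using Suc.prems that assms(5) by (auto simp: frechet_derivative_works)
    have "frechet_derivative g (at (f x)) (frechet_derivative f (at x) v) = D x v" for v
    proof -
      have "linear (frechet_derivative g (at (f x)))"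
        using g has_derivative_linear by blast
      from linear_expand_Basis[OF this, of "frechet_derivative f (at x) v"] show ?thesis by (simp only: D_def)
    qed
    then have "D x = frechet_derivative g (at (f x)) \<circ> frechet_derivative f (at x)" by (auto simp: fun_eq_iff)
    with diff_chain_at[OF f g] show ?thesis by (simp add: o_def)
  qed
  moreover have "Ck_on n (\<lambda>x. D x v) S" for v
    unfolding D_def
    using Suc.prems(1) Suc.prems(2) Ck_on_Suc_imp[OF Suc.prems(2)]
    by (intro Ck_on_sum[OF assms(1)] Ck_on_scaleR[OF assms(1)] Ck_on_inner[OF assms(1)] Ck_on_const Suc.IH) auto
  ultimately show ?case using \<open>open S\<close> by (intro Ck_on_SucI) auto
qed

lemma Ck_on_Pair:
  assumes "open S" "Ck_on n f S" "Ck_on n g S"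
  shows "Ck_on n (\<lambda>x. (f x, g x)) S"
proof -
  have "Ck_on n (\<lambda>x. (f x, 0::'c) + (0::'b, g x)) S"
  proof (rule Ck_on_add[OF assms(1)])
    show "Ck_on n (\<lambda>x. (f x, 0::'c)) S"
      by (rule Ck_on_compose[OF assms(1) open_UNIV Ck_on_linear[of "\<lambda>y. (y, 0)"] assms(2)])
        (auto intro!: bounded_linear_Pair bounded_linear_ident bounded_linear_zero)
    show "Ck_on n (\<lambda>x. (0::'b, g x)) S"
      by (rule Ck_on_compose[OF assms(1) open_UNIV Ck_on_linear[of "\<lambda>y. (0, y)"] assms(3)])
        (auto intro!: bounded_linear_Pair bounded_linear_ident bounded_linear_zero)
  qed
  then show ?thesis by simp
qed

lemma Ck_on_linear_compose:
  assumes "open S" "bounded_linear l" "Ck_on n f S"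
  shows "Ck_on n (\<lambda>x. l (f x)) S"
  using Ck_on_compose[OF assms(1) open_UNIV Ck_on_linear[OF assms(2)] assms(3)] by simp

text \<open>A factor that vanishes at the point makes mere continuity of the other factor enough.\<close>

lemma has_derivative_scaleR_zero:
  fixes \<phi> :: "'a::real_normed_vector \<Rightarrow> real" and \<psi> :: "'a \<Rightarrow> 'b::real_normed_vector"
  assumes "(\<phi> has_derivative \<phi>') (at y)" "\<phi> y = 0" "isCont \<psi> y"
  shows "((\<lambda>z. \<phi> z *\<^sub>R \<psi> z) has_derivative (\<lambda>v. \<phi>' v *\<^sub>R \<psi> y)) (at y)"
proof -
  have 1: "((\<lambda>z. \<phi> z *\<^sub>R \<psi> y) has_derivative (\<lambda>v. \<phi>' v *\<^sub>R \<psi> y)) (at y)"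
    using assms(1) by (rule has_derivative_scaleR_left)
  have 2: "((\<lambda>z. \<phi> z *\<^sub>R (\<psi> z - \<psi> y)) has_derivative (\<lambda>v. 0)) (at y)"
  proof -
    obtain B where B: "B > 0" "\<forall>\<^sub>F z in at y. norm (\<phi> z) \<le> B * norm (z - y)"
    proof -
      obtain K where K: "K \<ge> 0" "\<And>v. norm (\<phi>' v) \<le> norm v * K"
        using bounded_linear.nonneg_bounded[OF has_derivative_bounded_linear[OF assms(1)]] by blast
      obtain d where d: "d > 0" "\<And>z. norm (z - y) < d \<Longrightarrow> norm (\<phi> z - \<phi> y - \<phi>' (z - y)) \<le> 1 * norm (z - y)"
        using assms(1)[unfolded has_derivative_at_alt, THEN conjunct2, rule_format, of 1] by auto
      have "norm (\<phi> z) \<le> (K + 1) * norm (z - y)" if "norm (z - y) < d" for z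
      proof -
        have "norm (\<phi> z) \<le> norm (\<phi> z - \<phi>' (z - y)) + norm (\<phi>' (z - y))"
          using norm_triangle_sub[of "\<phi> z" "\<phi>' (z - y)"] by simp
        also have "\<dots> \<le> 1 * norm (z - y) + norm (z - y) * K"
          using d(2)[OF that] K(2)[of "z - y"] assms(2) by simp
        finally show ?thesis by (simp add: algebra_simps)
      qed
      then have "\<forall>\<^sub>F z in at y. norm (\<phi> z) \<le> (K + 1) * norm (z - y)"
        using d(1) unfolding eventually_at dist_norm by blast
      with K(1) show ?thesis by (intro that[of "K + 1"]) auto
    qed
    have "((\<lambda>z. norm (B *\<^sub>R (\<psi> z - \<psi> y))) \<longlongrightarrow> 0) (at y)"
      using assms(3) by (auto intro!: tendsto_eq_intros simp: isCont_def)
    then have "((\<lambda>z. norm (\<phi> z *\<^sub>R (\<psi> z - \<psi> y)) / norm (z - y)) \<longlongrightarrow> 0) (at y)"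
    proof (rule Lim_null_comparison[rotated])
      show "\<forall>\<^sub>F z in at y. norm (norm (\<phi> z *\<^sub>R (\<psi> z - \<psi> y)) / norm (z - y)) \<le> norm (B *\<^sub>R (\<psi> z - \<psi> y))"
        using B(2) eventually_neq_at_within[of y]
      proof eventually_elim
        case (elim z)
        then have "norm (\<phi> z) / norm (z - y) \<le> B" by (simp add: divide_le_eq)
        then have "norm (\<phi> z) / norm (z - y) * norm (\<psi> z - \<psi> y) \<le> B * norm (\<psi> z - \<psi> y)"
          by (rule mult_right_mono) simp
        then show ?case using B(1) by simp
      qed
    qed
    then show ?thesis using assms(2) unfolding has_derivative_iff_norm by simp
  qed
  show ?thesis using has_derivative_add[OF 1 2] by (simp add: algebra_simps)
qed

text \<open>Near \<open>y\<close> the maps \<open>A z\<close> keep the lower bound of \<open>A y\<close> up to the factor one half, so their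
  inverses are uniformly bounded; apply them to \<open>A z (inv (A z) v - inv (A y) v) = v - A z (inv (A y) v)\<close>.\<close>

lemma isCont_linear_inverse:
  fixes A :: "'b::metric_space \<Rightarrow> 'a::euclidean_space \<Rightarrow> 'a"
  assumes "open V" "y \<in> V"
    and lin: "\<And>y. y \<in> V \<Longrightarrow> linear (A y)" and bij: "\<And>y. y \<in> V \<Longrightarrow> bij (A y)"
    and cont: "\<And>i. isCont (\<lambda>y. A y i) y"
  shows "isCont (\<lambda>y. inv (A y) v) y"
proof -
  obtain c where c: "c > 0" "\<And>u. c * norm u \<le> norm (A y u)"
    using linear_inj_bounded_below_pos[OF lin[OF assms(2)] bij_is_inj[OF bij[OF assms(2)]]] by metis
  \<comment> \<open>controls the operator norm of \<open>A z - A y\<close>\<close>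
  define e where "e z = (\<Sum>i\<in>Basis. norm (A z i - A y i))" for z
  have "e \<midarrow>y\<rightarrow> 0"
    unfolding e_def using cont unfolding isCont_def
    by (auto intro!: tendsto_eq_intros)
  then have ev: "\<forall>\<^sub>F z in at y. e z < c / 2"
    using c(1) by (intro order_tendstoD(2)) auto
  define u where "u = inv (A y) v"
  have Au: "A y u = v" unfolding u_def using bij[OF assms(2)] by (simp add: bij_is_surj surj_f_inv_f)
  have "\<forall>\<^sub>F z in at y. norm (inv (A z) v - inv (A y) v) \<le> (2 / c) * norm (v - A z u)"
    using ev eventually_at_in_open'[OF assms(1,2)]
  proof eventually_elim
    case (elim z)
    define w where "w = inv (A z) v - u"
    have "A z (inv (A z) v) = v" using bij[OF elim(2)] by (simp add: bij_is_surj surj_f_inv_f)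
    then have Aw: "A z w = v - A z u" unfolding w_def by (simp add: linear_diff[OF lin[OF elim(2)]])
    have "norm (A z w - A y w) \<le> e z * norm w"
    proof -
      have "A z w - A y w = (\<Sum>i\<in>Basis. (w \<bullet> i) *\<^sub>R (A z i - A y i))"
        unfolding linear_expand_Basis[OF lin[OF elim(2)], of w] linear_expand_Basis[OF lin[OF assms(2)], of w]
        by (simp add: scaleR_diff_right sum_subtractf)
      also have "norm \<dots> \<le> (\<Sum>i\<in>Basis. norm w * norm (A z i - A y i))"
        by (rule sum_norm_le) (auto intro!: mult_right_mono simp: Basis_le_norm)
      finally show ?thesis by (simp add: e_def sum_distrib_left mult.commute)
    qed
    also have "\<dots> \<le> c / 2 * norm w" using elim(1) by (intro mult_right_mono) auto
    finally have "c * norm w \<le> norm (A z w) + c / 2 * norm w"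
      using c(2)[of w] norm_triangle_ineq3[of "A y w" "A z w"] by (simp add: norm_minus_commute)
    then have "c * norm w \<le> 2 * norm (v - A z u)" by (simp add: Aw)
    then show ?case using c(1) by (simp add: w_def u_def field_simps)
  qed
  moreover have "(\<lambda>z. (2 / c) * norm (v - A z u)) \<midarrow>y\<rightarrow> 0"
  proof -
    have "(\<lambda>z. A z u) \<midarrow>y\<rightarrow> A y u"
    proof -
      have "(\<lambda>z. \<Sum>i\<in>Basis. (u \<bullet> i) *\<^sub>R A z i) \<midarrow>y\<rightarrow> (\<Sum>i\<in>Basis. (u \<bullet> i) *\<^sub>R A y i)"
        using cont unfolding isCont_def by (intro tendsto_intros) auto
      moreover have "\<forall>\<^sub>F z in at y. (\<Sum>i\<in>Basis. (u \<bullet> i) *\<^sub>R A z i) = A z u"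
        using eventually_at_in_open'[OF assms(1,2)]
        by eventually_elim (rule linear_expand_Basis[OF lin, symmetric])
      ultimately show ?thesis
        unfolding linear_expand_Basis[OF lin[OF assms(2)], of u] by (rule Lim_transform_eventually)
    qed
    then have "(\<lambda>z. norm (v - A z u)) \<midarrow>y\<rightarrow> norm (v - A y u)"
      by (intro tendsto_intros)
    then have "(\<lambda>z. norm (v - A z u)) \<midarrow>y\<rightarrow> 0" by (simp add: Au)
    then show ?thesis by (rule tendsto_mult_right_zero)
  qed
  ultimately have "(\<lambda>z. inv (A z) v - inv (A y) v) \<midarrow>y\<rightarrow> 0"
    by (rule Lim_null_comparison)
  then show ?thesis unfolding isCont_def by (simp add: LIM_zero_iff)
qed

text \<open>With \<open>u = inv (A y) v\<close> one has \<open>inv (A z) v = u - inv (A z) (A z u - v)\<close>, where \<open>A z u - v\<close> vanishes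
  at \<open>z = y\<close>. Hence continuity of the inverse already gives its differential, and that is an
  algebraic expression in inverses and derivatives of \<open>A\<close>: the order can be raised step by step.\<close>

lemma Ck_on_linear_inverse:
  fixes A :: "'b::euclidean_space \<Rightarrow> 'a::euclidean_space \<Rightarrow> 'a"
  assumes "open V"
    and lin: "\<And>y. y \<in> V \<Longrightarrow> linear (A y)" and bij: "\<And>y. y \<in> V \<Longrightarrow> bij (A y)"
    and "\<And>i. Ck_on n (\<lambda>y. A y i) V"
  shows "Ck_on n (\<lambda>y. inv (A y) v) V"
proof -
  have cont: "isCont (\<lambda>y. inv (A y) v) y" if "y \<in> V" "\<And>i. Ck_on n (\<lambda>y. A y i) V" for n y v
    using that(1) Ck_on_continuous[OF that(2)] \<open>open V\<close>
    by (intro isCont_linear_inverse[OF \<open>open V\<close> that(1) lin bij]) (auto simp: continuous_on_eq_continuous_at)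
  show ?thesis
    using assms(4)
  proof (induction n arbitrary: v)
    case 0
    then show ?case using cont[of _ 0] by (auto intro!: continuous_at_imp_continuous_on)
  next
    case (Suc n)
    define D where "D y h i = frechet_derivative (\<lambda>y. A y i) (at y) h" for y h i
    define I where "I y h = - (\<Sum>i\<in>Basis. (\<Sum>k\<in>Basis. (inv (A y) v \<bullet> k) * (D y h k \<bullet> i)) *\<^sub>R inv (A y) i)" for y h
    have linv: "linear (inv (A y))" if "y \<in> V" for y
      using inj_linear_imp_inv_linear lin bij bij_is_inj that by blast
    show ?case
    proof (rule Ck_on_SucI[OF \<open>open V\<close>])
      fix y assume y: "y \<in> V"
      define u where "u = inv (A y) v"
      have "((\<lambda>z. A z u) has_derivative (\<lambda>h. \<Sum>k\<in>Basis. (u \<bullet> k) *\<^sub>R D y h k)) (at y)"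
      proof (rule has_derivative_transform_within_open[OF _ \<open>open V\<close> y])
        show "((\<lambda>z. \<Sum>k\<in>Basis. (u \<bullet> k) *\<^sub>R A z k) has_derivative (\<lambda>h. \<Sum>k\<in>Basis. (u \<bullet> k) *\<^sub>R D y h k)) (at y)"
          using Suc.prems y unfolding D_def
          by (intro has_derivative_sum has_derivative_scaleR_right) (auto simp: frechet_derivative_works)
      qed (rule linear_expand_Basis[OF lin, symmetric])
      then have "((\<lambda>z. (A z u - v) \<bullet> i) has_derivative (\<lambda>h. (\<Sum>k\<in>Basis. (u \<bullet> k) *\<^sub>R D y h k) \<bullet> i)) (at y)" for i
        by (auto intro!: derivative_eq_intros)
      moreover have "A y u = v" unfolding u_def using bij[OF y] by (simp add: bij_is_surj surj_f_inv_f)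
      ultimately have "((\<lambda>z. ((A z u - v) \<bullet> i) *\<^sub>R inv (A z) i) has_derivative
          (\<lambda>h. ((\<Sum>k\<in>Basis. (u \<bullet> k) *\<^sub>R D y h k) \<bullet> i) *\<^sub>R inv (A y) i)) (at y)" for i
        using cont[OF y Suc.prems] by (intro has_derivative_scaleR_zero) auto
      then have d: "((\<lambda>z. u - (\<Sum>i\<in>Basis. ((A z u - v) \<bullet> i) *\<^sub>R inv (A z) i)) has_derivative
          (\<lambda>h. 0 - (\<Sum>i\<in>Basis. ((\<Sum>k\<in>Basis. (u \<bullet> k) *\<^sub>R D y h k) \<bullet> i) *\<^sub>R inv (A y) i))) (at y)"
        by (intro has_derivative_diff has_derivative_const has_derivative_sum)
      show "((\<lambda>y. inv (A y) v) has_derivative I y) (at y)"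
      proof (rule has_derivative_transform_within_open[OF _ \<open>open V\<close> y])
        show "((\<lambda>z. u - (\<Sum>i\<in>Basis. ((A z u - v) \<bullet> i) *\<^sub>R inv (A z) i)) has_derivative I y) (at y)"
          using d by (simp add: I_def[abs_def] u_def inner_sum_left)
        fix z assume z: "z \<in> V"
        have "(\<Sum>i\<in>Basis. ((A z u - v) \<bullet> i) *\<^sub>R inv (A z) i) = inv (A z) (A z u - v)"
          by (rule linear_expand_Basis[OF linv[OF z], symmetric])
        also have "\<dots> = u - inv (A z) v"
          using bij[OF z] by (simp add: linear_diff[OF linv[OF z]] bij_is_inj inv_f_f)
        finally show "u - (\<Sum>i\<in>Basis. ((A z u - v) \<bullet> i) *\<^sub>R inv (A z) i) = inv (A z) v" by simp
      qed
    next
      fix h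
      have "Ck_on n (\<lambda>y. D y h k) V" for k using Suc.prems by (simp add: D_def)
      moreover have "Ck_on n (\<lambda>y. inv (A y) w) V" for w
        using Suc.IH Ck_on_Suc_imp[OF Suc.prems] by blast
      ultimately show "Ck_on n (\<lambda>y. I y h) V"
        unfolding I_def
        by (intro Ck_on_minus Ck_on_sum Ck_on_scaleR Ck_on_mult Ck_on_inner Ck_on_const \<open>open V\<close>)
    qed
  qed
qed

lemma Ck_on_inverse:
  fixes h g :: "'a::euclidean_space \<Rightarrow> 'a"
  assumes "open U" "open V" and "\<And>n. Ck_on n h U"
    and gV: "g ` V \<subseteq> U"
    and bij: "\<And>x. x \<in> U \<Longrightarrow> bij (frechet_derivative h (at x))"
    and g: "\<And>y. y \<in> V \<Longrightarrow> (g has_derivative inv (frechet_derivative h (at (g y)))) (at y)"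
  shows "Ck_on n g V"
proof (induction n)
  case 0
  then show ?case using g
    by (auto intro!: continuous_at_imp_continuous_on has_derivative_continuous)
next
  case (Suc n)
  have d: "(h has_derivative frechet_derivative h (at x)) (at x)" if "x \<in> U" for x
    using assms(3)[of 1] that by (simp add: frechet_derivative_works)
  show ?case
  proof (rule Ck_on_SucI[OF \<open>open V\<close> g])
    fix v
    show "Ck_on n (\<lambda>y. inv (frechet_derivative h (at (g y))) v) V"
    proof (rule Ck_on_linear_inverse[OF \<open>open V\<close>])
      show "linear (frechet_derivative h (at (g y)))" if "y \<in> V" for y
        using d gV that has_derivative_linear by blast
      show "bij (frechet_derivative h (at (g y)))" if "y \<in> V" for y
        using bij gV that by blast
      show "Ck_on n (\<lambda>y. frechet_derivative h (at (g y)) i) V" for i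
        using assms(3)[of "Suc n"]
        by (intro Ck_on_compose[OF \<open>open V\<close> \<open>open U\<close> _ Suc gV]) simp
    qed
  qed
qed

section \<open>The smooth inverse function theorem along a compact set\<close>

lemma smooth_local_inverse:
  fixes h :: "'a::euclidean_space \<Rightarrow> 'a"
  assumes "open A" "x0 \<in> A" and smooth: "\<And>n. Ck_on n h A"
    and inj: "inj (frechet_derivative h (at x0))"
  obtains U V g where "open U" "x0 \<in> U" "U \<subseteq> A" "open V" "homeomorphism U V h g" "\<And>n. Ck_on n g V"
proof -
  define D where "D x = frechet_derivative h (at x)" for x
  define h' where "h' x = Blinfun (D x)" for x
  have d: "(h has_derivative D x) (at x)" if "x \<in> A" for x
    using smooth[of 1] that by (simp add: D_def frechet_derivative_works[symmetric])
  have h': "blinfun_apply (h' x) = D x" if "x \<in> A" for x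
    unfolding h'_def using d[OF that] has_derivative_bounded_linear bounded_linear_Blinfun_apply by blast
  have "isCont h' x" if "x \<in> A" for x
  proof (rule continuous_blinfun_componentwiseI1)
    fix i :: 'a
    have "isCont (\<lambda>x. D x i) x"
      using smooth[of 1] \<open>open A\<close> that by (simp add: D_def continuous_on_eq_continuous_at)
    then show "isCont (\<lambda>x. blinfun_apply (h' x) i) x"
      using eventually_nhds_in_open[OF \<open>open A\<close> that] h'
      by (subst isCont_cong[where g = "\<lambda>x. D x i"]) (auto elim: eventually_mono)
  qed
  then have cont: "continuous_on A h'" by (simp add: continuous_at_imp_continuous_on)
  obtain k where k: "linear k" "k \<circ> D x0 = id"
    using linear_injective_left_inverse[of "D x0"] inj d[OF \<open>x0 \<in> A\<close>] has_derivative_linear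
    unfolding D_def by blast
  have "Blinfun k o\<^sub>L h' x0 = id_blinfun"
  proof (rule blinfun_eqI)
    fix i
    have "k (D x0 i) = i" using k(2) by (metis comp_apply id_apply)
    then show "blinfun_apply (Blinfun k o\<^sub>L h' x0) i = blinfun_apply id_blinfun i"
      using k(1) by (simp add: h'[OF \<open>x0 \<in> A\<close>] bounded_linear_Blinfun_apply linear_conv_bounded_linear)
  qed
  then obtain U V g g' where U: "open U" "U \<subseteq> A" "x0 \<in> U" "open V" "homeomorphism U V h g"
    and g: "\<And>y. y \<in> V \<Longrightarrow> (g has_derivative (g' y)) (at y)"
      "\<And>y. y \<in> V \<Longrightarrow> g' y = inv (blinfun_apply (h' (g y)))"
      "\<And>y. y \<in> V \<Longrightarrow> bij (blinfun_apply (h' (g y)))"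
    using inverse_function_theorem[OF \<open>open A\<close> _ cont \<open>x0 \<in> A\<close>] d h' by metis
  have gV: "g ` V = U" using U(5) by (simp add: homeomorphism_def)
  have "Ck_on n g V" for n
  proof (rule Ck_on_inverse[OF U(1,4) Ck_on_subset[OF smooth U(2)]])
    show "g ` V \<subseteq> U" using gV by simp
    show "bij (frechet_derivative h (at x))" if "x \<in> U" for x
    proof -
      from that gV have "x \<in> g ` V" by simp
      then obtain y where y: "x = g y" "y \<in> V" by (rule imageE)
      have "blinfun_apply (h' x) = D x" using h' U(2) that by blast
      then show ?thesis using g(3)[OF y(2)] y(1) by (simp add: D_def)
    qed
    show "(g has_derivative inv (frechet_derivative h (at (g y)))) (at y)" if "y \<in> V" for y
    proof -
      have "blinfun_apply (h' (g y)) = D (g y)" using h' gV U(2) that by blast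
      then show ?thesis using g(1,2)[OF that] by (simp add: D_def)
    qed
  qed
  with U show ?thesis by (intro that)
qed

text \<open>The pairs of points that have neighbourhoods separated by \<open>h\<close>, or on whose common
  neighbourhood \<open>h\<close> is injective, form an open set containing \<open>K \<times> K\<close>; by compactness it
  contains the square of a neighbourhood of \<open>K\<close>.\<close>

lemma injective_near_compact:
  fixes h :: "'a::metric_space \<Rightarrow> 'b::t2_space"
  assumes "compact K" "open A" "K \<subseteq> A" "continuous_on A h" "inj_on h K"
    and loc: "\<And>x. x \<in> K \<Longrightarrow> \<exists>U. open U \<and> x \<in> U \<and> inj_on h U"
  obtains W where "open W" "K \<subseteq> W" "W \<subseteq> A" "inj_on h W"
proof -
  define N where "N = \<Union>{B \<times> C | B C. open B \<and> open C \<and> B \<subseteq> A \<and> C \<subseteq> A \<and>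
    (\<forall>x\<in>B. \<forall>y\<in>C. h x = h y \<longrightarrow> x = y)}"
  have "open N" unfolding N_def by (rule open_Union) (auto simp: open_Times)
  moreover have "K \<times> K \<subseteq> N"
  proof clarify
    fix x y assume xy: "x \<in> K" "y \<in> K"
    show "(x, y) \<in> N"
    proof (cases "h x = h y")
      case True
      then have "x = y" using xy assms(5) by (auto dest: inj_onD)
      obtain U where "open U" "x \<in> U" "inj_on h U" using loc[OF xy(1)] by blast
      then show ?thesis
        using xy \<open>x = y\<close> assms(2,3) unfolding N_def
        by (intro UnionI[of "(U \<inter> A) \<times> (U \<inter> A)"] CollectI
            exI[of _ "U \<inter> A"] exI[of _ "U \<inter> A"]) (auto simp: inj_on_def)
    next
      case False
      then obtain S T where ST: "open S" "open T" "h x \<in> S" "h y \<in> T" "S \<inter> T = {}"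
        using hausdorff[OF False] by blast
      have "open (A \<inter> h -` S)" "open (A \<inter> h -` T)"
        using continuous_open_preimage[OF assms(4,2)] ST by auto
      then show ?thesis
        using xy ST(3,4) assms(3) ST(5) unfolding N_def
        by (intro UnionI[of "(A \<inter> h -` S) \<times> (A \<inter> h -` T)"] CollectI
            exI[of _ "A \<inter> h -` S"] exI[of _ "A \<inter> h -` T"]) auto
    qed
  qed
  ultimately obtain e where e: "e > 0" "(\<Union>z\<in>K \<times> K. ball z e) \<subseteq> N"
    using compact_subset_open_imp_ball_epsilon_subset[OF compact_Times[OF assms(1,1)]] by blast
  define W where "W = (\<Union>x\<in>K. ball x (e / 2))"
  have WN: "(x, y) \<in> N" if xy: "x \<in> W" "y \<in> W" for x y
  proof -
    obtain u v where uv: "u \<in> K" "v \<in> K" "dist u x < e / 2" "dist v y < e / 2"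
      using xy unfolding W_def by auto
    have "dist (u, v) (x, y) \<le> dist u x + dist v y"
      unfolding dist_Pair_Pair by (rule sqrt_sum_squares_le_sum) auto
    also have "\<dots> < e" using uv by simp
    finally have "(x, y) \<in> ball (u, v) e" by simp
    moreover have "(u, v) \<in> K \<times> K" using uv(1,2) by simp
    ultimately show ?thesis using e(2) by blast
  qed
  show ?thesis
  proof
    show "open W" by (auto simp: W_def)
    show "K \<subseteq> W" using e(1) by (auto simp: W_def)
    show "W \<subseteq> A" using WN unfolding N_def by blast
    show "inj_on h W" using WN unfolding N_def inj_on_def by blast
  qed
qed

text \<open>The local inverses agree with the global one wherever \<open>h\<close> is injective, so injectivity near \<open>K\<close>
  glues them to one smooth inverse.\<close>

theorem smooth_inverse_near_compact:
  fixes h :: "'a::euclidean_space \<Rightarrow> 'a"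
  assumes "compact K" "open A" "K \<subseteq> A" and smooth: "\<And>n. Ck_on n h A" and "inj_on h K"
    and inj: "\<And>x. x \<in> K \<Longrightarrow> inj (frechet_derivative h (at x))"
  obtains W where "open W" "K \<subseteq> W" "W \<subseteq> A"
    "\<And>W'. open W' \<Longrightarrow> W' \<subseteq> W \<Longrightarrow> open (h ` W')"
    "inj_on h W" "\<And>n. Ck_on n (inv_into W h) (h ` W)"
proof -
  define local where "local x U V g \<longleftrightarrow> open U \<and> x \<in> U \<and> open V \<and> homeomorphism U V h g \<and> (\<forall>n. Ck_on n g V)"
    for x U V g
  have "\<exists>U V g. local x U V g" if "x \<in> K" for x
  proof -
    from assms(3) that have "x \<in> A" by blast
    show ?thesis
    proof (rule smooth_local_inverse[OF assms(2) \<open>x \<in> A\<close> smooth inj[OF that]])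
      fix U V g
      assume "open U" "x \<in> U" "U \<subseteq> A" "open V" "homeomorphism U V h g" "\<And>n. Ck_on n g V"
      then have "local x U V g" unfolding local_def by simp
      then show ?thesis by blast
    qed
  qed
  then obtain U V g where *: "\<And>x. x \<in> K \<Longrightarrow> local x (U x) (V x) (g x)" by metis
  have loc: "open (U x)" "x \<in> U x" "open (V x)" "homeomorphism (U x) (V x) h (g x)"
      "Ck_on n (g x) (V x)" if "x \<in> K" for x n
    using *[OF that] by (auto simp: local_def)
  have injU: "inj_on h (U x)" if "x \<in> K" for x
    using homeomorphism_apply1[OF loc(4)[OF that]] by (rule inj_on_inverseI)
  have "\<exists>U. open U \<and> x \<in> U \<and> inj_on h U" if "x \<in> K" for x
    using loc(1,2)[OF that] injU[OF that] by blast
  then obtain W0 where W0: "open W0" "K \<subseteq> W0" "W0 \<subseteq> A" "inj_on h W0"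
    using injective_near_compact[OF assms(1-3) Ck_on_continuous[OF smooth] assms(5)] by blast
  define W where "W = W0 \<inter> (\<Union>x\<in>K. U x)"
  have openim: "open (h ` X)" if X: "open X" "X \<subseteq> U x" "x \<in> K" for X x
  proof -
    note hom = loc(4)[OF X(3)]
    have "h ` X = V x \<inter> g x -` X"
    proof (intro equalityI subsetI)
      fix y assume "y \<in> h ` X"
      then show "y \<in> V x \<inter> g x -` X"
        using homeomorphism_apply1[OF hom] homeomorphism_image1[OF hom] X(2) by auto
    next
      fix y assume "y \<in> V x \<inter> g x -` X"
      then show "y \<in> h ` X"
        using homeomorphism_apply2[OF hom, of y] by (metis IntE image_eqI vimageE)
    qed
    moreover have "open (V x \<inter> g x -` X)"
      using loc(4)[OF X(3)] loc(3)[OF X(3)] X(1)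
      by (intro continuous_open_preimage) (auto simp: homeomorphism_def)
    ultimately show ?thesis by simp
  qed
  have im: "open (h ` W')" if W': "open W'" "W' \<subseteq> W" for W'
  proof -
    have "W' = (\<Union>x\<in>K. W' \<inter> U x)" using W' by (auto simp: W_def)
    then have "h ` W' = (\<Union>x\<in>K. h ` (W' \<inter> U x))" by blast
    moreover have "open (h ` (W' \<inter> U x))" if "x \<in> K" for x
      using W'(1) loc(1)[OF that] that by (intro openim) auto
    ultimately show ?thesis by auto
  qed
  have injW: "inj_on h W" using W0(4) unfolding W_def by (rule inj_on_subset) auto
  have "Ck_on n (inv_into W h) (h ` W)" for n
  proof (rule Ck_on_local)
    fix y assume "y \<in> h ` W"
    then obtain x z where z: "x \<in> K" "z \<in> W \<inter> U x" "y = h z" by (auto simp: W_def)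
    define B where "B = h ` (W \<inter> U x)"
    have B: "open B" unfolding B_def W_def
      using z loc(1)[OF z(1)] W0(1) loc(1) by (intro openim[of _ x]) auto
    have BV: "B \<subseteq> V x" using loc(4)[OF z(1)] by (auto simp: B_def homeomorphism_def)
    have "Ck_on n (inv_into W h) B"
    proof (rule Ck_on_cong[OF B _ Ck_on_subset[OF loc(5)[OF z(1)] BV]])
      fix u assume "u \<in> B"
      then obtain v where v: "v \<in> W \<inter> U x" "u = h v" by (auto simp: B_def)
      then show "g x u = inv_into W h u"
        using loc(4)[OF z(1)] inv_into_f_f[OF injW] by (auto simp: homeomorphism_def)
    qed
    with B z show "\<exists>U. open U \<and> y \<in> U \<and> Ck_on n (inv_into W h) U" unfolding B_def by blast
  qed
  moreover have "open W" using W0(1) loc(1) by (auto simp: W_def)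
  moreover have "K \<subseteq> W" using W0(2) loc(2) by (auto simp: W_def)
  ultimately show ?thesis using that[OF _ _ _ im injW] W0(3) by (auto simp: W_def)
qed

section \<open>Submersions with compact fibres\<close>

lemma smooth_map_onI:
  assumes "open U" "X \<subseteq> U" "\<And>n. Ck_on n g U" "\<And>x. x \<in> X \<Longrightarrow> g x = f x"
  shows "smooth_map_on X f"
  using assms unfolding smooth_map_on_def by blast

lemma smooth_map_on_continuous:
  assumes "smooth_map_on X f"
  shows "continuous_on X f"
  unfolding continuous_on_eq_continuous_within
proof
  fix x assume "x \<in> X"
  with assms have "\<exists>U g. open U \<and> x \<in> U \<and> (\<forall>n. Ck_on n g U) \<and> (\<forall>y\<in>X \<inter> U. g y = f y)"
    unfolding smooth_map_on_def by (rule bspec)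
  then obtain U g where U: "open U" "x \<in> U" "\<forall>n. Ck_on n g U" "\<forall>y\<in>X \<inter> U. g y = f y"
    by (elim exE conjE)
  have "continuous_on U g" using U(3) by (intro Ck_on_continuous) blast
  then have "isCont g x" using U(1,2) by (simp add: continuous_on_eq_continuous_at)
  then have cont: "continuous (at x within X) g" by (rule continuous_at_imp_continuous_at_within)
  from U(1,2) obtain e where e: "e > 0" "ball x e \<subseteq> U" unfolding open_contains_ball by blast
  show "continuous (at x within X) f"
  proof (rule continuous_transform_within[OF cont e(1) \<open>x \<in> X\<close>])
    fix x' assume "x' \<in> X" "dist x' x < e"
    with e(2) have "x' \<in> X \<inter> U" by (auto simp: dist_commute)
    then show "g x' = f x'" by (rule bspec[OF U(4)])
  qed
qed

lemma diffeomorphism_openI: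
  assumes "open U" "open V" "homeomorphism U V f g" "\<And>n. Ck_on n f U" "\<And>n. Ck_on n g V"
  shows "diffeomorphism U V f g"
  using assms unfolding diffeomorphism_def by (auto intro: smooth_map_onI)

lemma dim_kernel_of_surjective:
  fixes A :: "'a::euclidean_space \<Rightarrow> 'n::euclidean_space"
  assumes "linear A" "surj A"
  shows "dim {v. A v = 0} = DIM('a) - DIM('n)"
proof -
  obtain B where B: "linear B" "A \<circ> B = id"
    using linear_surjective_right_inverse[OF assms] by blast
  have AB: "A (B w) = w" for w using B(2) by (metis comp_apply id_apply)
  have injB: "inj B" by (rule inj_on_inverseI[of _ A]) (rule AB)
  have sK: "subspace {v. A v = 0}" by (rule linear_subspace_kernel[OF assms(1)])
  have sB: "subspace (range B)" by (rule linear_subspace_image[OF B(1) subspace_UNIV])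
  have "dim {x + y |x y. x \<in> {v. A v = 0} \<and> y \<in> range B} + dim ({v. A v = 0} \<inter> range B)
      = dim {v. A v = 0} + dim (range B)"
    by (rule dim_sums_Int[OF sK sB])
  moreover have "{x + y |x y. x \<in> {v. A v = 0} \<and> y \<in> range B} = UNIV"
  proof -
    have "x = (x - B (A x)) + B (A x) \<and> A (x - B (A x)) = 0" for x
      by (simp add: linear_diff[OF assms(1)] AB)
    then show ?thesis by blast
  qed
  moreover have "{v. A v = 0} \<inter> range B = {0}"
    using AB linear_0[OF assms(1)] linear_0[OF B(1)] by force
  moreover have "dim (range B) = DIM('n)"
    using dim_image_eq[OF B(1) inj_on_subset[OF injB subset_UNIV], of UNIV] by simp
  ultimately show ?thesis by simp
qed

text \<open>With \<open>A\<close> the differential at \<open>x0\<close> and \<open>B\<close> a right inverse of \<open>A\<close>, the map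
  \<open>\<phi> x = (x - x0) - B (A (x - x0)) + B (f x - z)\<close> has the identity as differential at \<open>x0\<close>, and
  \<open>A (\<phi> x) = f x - z\<close>. So it is a slice chart with the kernel of \<open>A\<close> as slice.\<close>

lemma smooth_submanifold_level_set:
  fixes f :: "'a::euclidean_space \<Rightarrow> 'n::euclidean_space"
  assumes smooth: "\<And>n. Ck_on n f UNIV"
    and surj: "\<And>x. f x = z \<Longrightarrow> surj (frechet_derivative f (at x))"
  shows "smooth_submanifold (DIM('a) - DIM('n)) {x. f x = z}"
  unfolding smooth_submanifold_def
proof
  fix x0 assume "x0 \<in> {x. f x = z}"
  then have x0: "f x0 = z" by simp
  define A where "A = frechet_derivative f (at x0)"
  have dA: "(f has_derivative A) (at x0)"
    using smooth[of 1] by (simp add: A_def frechet_derivative_works[symmetric])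
  have linA: "linear A" by (rule has_derivative_linear[OF dA])
  have surjA: "surj A" unfolding A_def by (rule surj[OF x0])
  obtain B where B: "linear B" "A \<circ> B = id"
    using linear_surjective_right_inverse[OF linA surjA] by blast
  have AB: "A (B w) = w" for w using B(2) by (metis comp_apply id_apply)
  have blA: "bounded_linear A" and blB: "bounded_linear B"
    using linA B(1) by (simp_all add: linear_conv_bounded_linear)
  define \<phi> where "\<phi> x = (x - x0) - B (A (x - x0)) + B (f x - z)" for x
  have A\<phi>: "A (\<phi> x) = f x - z" for x
    by (simp add: \<phi>_def linear_add[OF linA] linear_diff[OF linA] AB)
  have id: "Ck_on n (\<lambda>x. x - x0) UNIV" for n
    by (intro Ck_on_diff Ck_on_const Ck_on_linear bounded_linear_ident open_UNIV)
  have C\<phi>: "Ck_on n \<phi> UNIV" for n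
    unfolding \<phi>_def
    by (intro Ck_on_add[OF open_UNIV] Ck_on_diff[OF open_UNIV] id
        Ck_on_linear_compose[OF open_UNIV blB] Ck_on_linear_compose[OF open_UNIV blA] smooth Ck_on_const)
  have "(\<phi> has_derivative (\<lambda>h. (h - 0) - B (A (h - 0)) + B (A h - 0))) (at x0)"
    unfolding \<phi>_def
    by (intro has_derivative_add has_derivative_diff has_derivative_ident has_derivative_const
        bounded_linear.has_derivative[OF blB] bounded_linear.has_derivative[OF blA] dA)
  then have "frechet_derivative \<phi> (at x0) = id"
    by (intro frechet_derivative_eqI) (simp add: id_def)
  then have inj: "inj (frechet_derivative \<phi> (at x0))" by simp
  show "\<exists>U V \<phi> \<psi> L. open U \<and> x0 \<in> U \<and> open (V :: 'a set) \<and> diffeomorphism U V \<phi> \<psi> \<and>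
        subspace L \<and> dim L = DIM('a) - DIM('n) \<and> \<phi> ` ({x. f x = z} \<inter> U) = L \<inter> V"
  proof (rule smooth_local_inverse[OF open_UNIV UNIV_I C\<phi> inj])
    fix U V \<psi>
    assume *: "open U" "x0 \<in> U" "open V" "homeomorphism U V \<phi> \<psi>" "\<And>n. Ck_on n \<psi> V"
    have "\<phi> ` ({x. f x = z} \<inter> U) = {v. A v = 0} \<inter> V"
    proof (intro equalityI subsetI)
      fix v assume "v \<in> \<phi> ` ({x. f x = z} \<inter> U)"
      then show "v \<in> {v. A v = 0} \<inter> V" using A\<phi> homeomorphism_image1[OF *(4)] by auto
    next
      fix v assume v: "v \<in> {v. A v = 0} \<inter> V"
      then have "v = \<phi> (\<psi> v)" "\<psi> v \<in> U"
        using homeomorphism_apply2[OF *(4)] homeomorphism_image2[OF *(4)] by auto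
      moreover from this v A\<phi>[of "\<psi> v"] have "f (\<psi> v) = z" by simp
      ultimately show "v \<in> \<phi> ` ({x. f x = z} \<inter> U)" by blast
    qed
    moreover have "diffeomorphism U V \<phi> \<psi>"
      using * by (intro diffeomorphism_openI Ck_on_subset[OF C\<phi>]) auto
    ultimately show ?thesis
      using *(1-3) linear_subspace_kernel[OF linA] dim_kernel_of_surjective[OF linA surjA] by blast
  qed
qed

text \<open>Properness of \<open>J\<close> in the form used below: fibres over nearby values stay near the fibre over \<open>c\<close>.\<close>

lemma preimage_near_compact_fibre:
  fixes J :: "'a::euclidean_space \<Rightarrow> 'b::euclidean_space"
  assumes "compact {x \<in> P. J x \<in> cball c 1}" "continuous_on UNIV J"
    and "open N" "{x \<in> P. J x = c} \<subseteq> N"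
  obtains d where "d > 0" "\<And>x. x \<in> P \<Longrightarrow> dist (J x) c < d \<Longrightarrow> x \<in> N"
proof -
  define C where "C = J ` ({x \<in> P. J x \<in> cball c 1} - N)"
  have "compact C" unfolding C_def
    by (intro compact_continuous_image compact_diff assms continuous_on_subset[OF assms(2)]) auto
  then have "open (- C)" by (simp add: compact_imp_closed open_Compl)
  moreover have "c \<in> - C" using assms(4) by (auto simp: C_def)
  ultimately obtain e where e: "e > 0" "ball c e \<subseteq> - C"
    using open_contains_ball_eq by metis
  show ?thesis
  proof
    show "min e 1 > 0" using e by simp
    fix x assume "x \<in> P" "dist (J x) c < min e 1"
    then have "J x \<in> ball c e" "J x \<in> cball c 1" by (auto simp: dist_commute)
    with e(2) \<open>x \<in> P\<close> show "x \<in> N" unfolding C_def by blast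
  qed
qed

lemma uniform_slices_near_compact:
  fixes F :: "'a::metric_space set" and N :: "('a \<times> 'b::metric_space) set"
  assumes "compact F" "open N" "\<And>y. y \<in> F \<Longrightarrow> (y, z) \<in> N"
  obtains d where "d > 0" "\<And>y u. y \<in> F \<Longrightarrow> dist u z < d \<Longrightarrow> (y, u) \<in> N"
proof -
  have "F \<times> {z} \<subseteq> N" using assms(3) by auto
  then obtain e where e: "e > 0" "(\<Union>x\<in>F \<times> {z}. ball x e) \<subseteq> N"
    using compact_subset_open_imp_ball_epsilon_subset[OF compact_Times[OF assms(1) compact_sing] assms(2)]
    by blast
  have "(y, u) \<in> N" if "y \<in> F" "dist u z < e" for y u
  proof -
    have "(y, u) \<in> ball (y, z) e" using that by (simp add: dist_Pair_Pair dist_commute)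
    with e(2) that(1) show ?thesis by blast
  qed
  with e(1) that show ?thesis by blast
qed

text \<open>The point \<open>y\<close> displaced by the transpose of the differential of \<open>f\<close> at \<open>y\<close>, applied to \<open>w\<close>; at a
  regular point this is a displacement normal to the level set of \<open>f\<close> through \<open>y\<close>.\<close>

definition normal_map :: "('a::euclidean_space \<Rightarrow> 'n::euclidean_space) \<Rightarrow> 'a \<times> 'n \<Rightarrow> 'a" where
  "normal_map f = (\<lambda>(y, w). y + (\<Sum>i\<in>Basis. (w \<bullet> frechet_derivative f (at y) i) *\<^sub>R i))"

lemma normal_map_zero [simp]: "normal_map f (y, 0) = y"
  by (simp add: normal_map_def)

lemma Ck_on_normal_map:
  assumes "\<And>n. Ck_on n f UNIV"
  shows "Ck_on n (normal_map f) UNIV"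
proof -
  have "Ck_on n (\<lambda>z. frechet_derivative f (at z) i) UNIV" for i
    using assms[of "Suc n"] by simp
  then have *: "Ck_on n (\<lambda>z :: 'a \<times> 'b. frechet_derivative f (at (fst z)) i) UNIV" for i
    by (rule Ck_on_compose[OF open_UNIV open_UNIV _ Ck_on_linear[OF bounded_linear_fst] subset_UNIV])
  have "Ck_on n (\<lambda>z. fst z + (\<Sum>i\<in>Basis. (snd z \<bullet> frechet_derivative f (at (fst z)) i) *\<^sub>R i)) UNIV"
    by (intro Ck_on_add Ck_on_sum Ck_on_scaleR Ck_on_inner Ck_on_const open_UNIV * Ck_on_linear
        bounded_linear_fst bounded_linear_snd)
  then show ?thesis by (simp add: normal_map_def case_prod_unfold)
qed

lemma has_derivative_normal_map:
  assumes "Ck_on 2 f UNIV"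
  shows "(normal_map f has_derivative
    (\<lambda>(\<eta>, w). \<eta> + (\<Sum>i\<in>Basis. (w \<bullet> frechet_derivative f (at y) i) *\<^sub>R i))) (at (y, 0))"
proof -
  define D where "D i z = frechet_derivative f (at z) i" for i z
  have "D i differentiable (at y)" for i
    using assms by (simp add: D_def[abs_def] numeral_2_eq_2)
  then have D: "(D i has_derivative frechet_derivative (D i) (at y)) (at y)" for i
    by (simp add: frechet_derivative_works[symmetric])
  have dfst: "(fst has_derivative fst) (at (y, 0 :: 'b))"
    by (rule bounded_linear.has_derivative[OF bounded_linear_fst has_derivative_ident])
  have dsnd: "(snd has_derivative snd) (at (y, 0 :: 'b))"
    by (rule bounded_linear.has_derivative[OF bounded_linear_snd has_derivative_ident])
  have "((\<lambda>z :: 'a \<times> 'b. D i (fst z)) has_derivative (\<lambda>h. frechet_derivative (D i) (at y) (fst h))) (at (y, 0))" for i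
    by (rule has_derivative_compose[OF dfst]) (simp add: D)
  from has_derivative_inner[OF dsnd this]
  have "((\<lambda>z. snd z \<bullet> D i (fst z)) has_derivative (\<lambda>h. snd h \<bullet> D i y)) (at (y, 0))" for i
    by simp
  then have "((\<lambda>z. (snd z \<bullet> D i (fst z)) *\<^sub>R i) has_derivative (\<lambda>h. (snd h \<bullet> D i y) *\<^sub>R i)) (at (y, 0))" for i
    by (rule has_derivative_scaleR_left)
  then have "((\<lambda>z. fst z + (\<Sum>i\<in>Basis. (snd z \<bullet> D i (fst z)) *\<^sub>R i)) has_derivative
      (\<lambda>h. fst h + (\<Sum>i\<in>Basis. (snd h \<bullet> D i y) *\<^sub>R i))) (at (y, 0))"
    by (rule has_derivative_add[OF dfst has_derivative_sum])
  then show ?thesis by (simp only: normal_map_def D_def case_prod_unfold)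
qed

text \<open>For surjective \<open>A\<close> the operator \<open>A A\<^sup>T\<close> is injective, since \<open>w \<bullet> A A\<^sup>T w\<close> is the square norm of
  \<open>A\<^sup>T w\<close>.\<close>

lemma adjoint_eq_zero:
  fixes A :: "'a::euclidean_space \<Rightarrow> 'n::euclidean_space"
  assumes "linear A" "surj A" and "A (\<Sum>i\<in>Basis. (w \<bullet> A i) *\<^sub>R i) = 0"
  shows "w = 0"
proof -
  define v where "v = (\<Sum>i\<in>Basis. (w \<bullet> A i) *\<^sub>R i)"
  have adj: "v \<bullet> u = w \<bullet> A u" for u
  proof -
    have "w \<bullet> A u = (\<Sum>i\<in>Basis. (u \<bullet> i) * (w \<bullet> A i))"
      by (subst linear_expand_Basis[OF assms(1), of u]) (simp add: inner_sum_right)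
    moreover have "v \<bullet> u = (\<Sum>i\<in>Basis. (w \<bullet> A i) * (i \<bullet> u))"
      by (simp add: v_def inner_sum_left)
    ultimately show ?thesis by (simp add: inner_commute mult.commute)
  qed
  have "v \<bullet> v = 0" using adj[of v] assms(3) by (simp add: v_def)
  then have "w \<bullet> A u = 0" for u using adj[of u] by simp
  moreover obtain u where "w = A u" using assms(2) by (rule surjE)
  ultimately have "w \<bullet> w = 0" by simp
  then show "w = 0" by simp
qed

text \<open>Ehresmann's theorem for level sets. Put \<open>S (y, w) = (y, f (e (y, w)))\<close> and
  \<open>T (y, w) = (e (y, w), f y)\<close>, where \<open>e\<close> is the normal map of \<open>f = (J, q)\<close>. Both are injective on
  \<open>F \<times> {0}\<close> with injective differential there, so both are invertible on a common neighbourhood \<open>W\<close>.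
  Inverting \<open>T\<close> at \<open>(x, (c, 0))\<close> finds the foot point \<open>y \<in> F\<close> of \<open>x\<close>; inverting \<open>S\<close> at
  \<open>(y, (u, 0))\<close> finds the point over \<open>u\<close> with foot point \<open>y\<close>. These operations are inverse to each
  other because both are described by the same pair \<open>(y, w) \<in> W\<close>.\<close>

theorem submersion_trivial_near_compact_fibre:
  fixes J :: "'a::euclidean_space \<Rightarrow> 'b::euclidean_space" and q :: "'a \<Rightarrow> 'c::euclidean_space"
  defines "f \<equiv> \<lambda>x. (J x, q x)"
  assumes smooth: "\<And>n. Ck_on n J UNIV" "\<And>n. Ck_on n q UNIV"
    and proper: "compact {x. q x = 0 \<and> J x \<in> cball c 1}"
    and surj: "\<And>x. q x = 0 \<Longrightarrow> J x = c \<Longrightarrow> surj (frechet_derivative f (at x))"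
  shows "\<exists>U. open U \<and> c \<in> U \<and> trivial_fibration_over {x. q x = 0} J U"
proof -
  let ?e = "normal_map f"
  define F where "F = {x. f x = (c, 0)}"
  have Cf: "Ck_on n f UNIV" for n unfolding f_def by (intro Ck_on_Pair smooth open_UNIV)
  have Ce: "Ck_on n ?e UNIV" for n by (rule Ck_on_normal_map[OF Cf])
  have contJ: "continuous_on UNIV J" by (rule Ck_on_continuous[OF smooth(1)])
  have F: "F = {x \<in> {x. q x = 0}. J x = c}" by (auto simp: F_def f_def)
  have "compact F"
  proof -
    have "closed F" unfolding F_def
      using Ck_on_continuous[OF Cf] by (intro closed_Collect_eq continuous_on_const)
    moreover have "F \<inter> {x. q x = 0 \<and> J x \<in> cball c 1} = F" by (auto simp: F)
    ultimately show ?thesis using compact_Int_closed[OF proper, of F] by (simp add: Int_commute)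
  qed
  define K where "K = F \<times> {0 :: 'b \<times> 'c}"
  have "compact K" unfolding K_def using \<open>compact F\<close> by (intro compact_Times) auto
  define S where "S z = (fst z, f (?e z))" for z :: "'a \<times> 'b \<times> 'c"
  define T where "T z = (?e z, f (fst z))" for z :: "'a \<times> 'b \<times> 'c"
  have CS: "Ck_on n S UNIV" for n
    unfolding S_def
    by (intro Ck_on_Pair Ck_on_linear bounded_linear_fst open_UNIV Ck_on_compose[OF open_UNIV open_UNIV Cf Ce]) simp
  have CT: "Ck_on n T UNIV" for n
    unfolding T_def
    by (intro Ck_on_Pair Ce open_UNIV Ck_on_compose[OF open_UNIV open_UNIV Cf]
        Ck_on_linear bounded_linear_fst) simp
  have e_K: "?e z = fst z" and K_eq: "z = (fst z, 0)" if "z \<in> K" for z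
  proof -
    show *: "z = (fst z, 0)" using that by (simp add: K_def mem_Times_iff prod_eq_iff)
    show "?e z = fst z" by (subst *) (rule normal_map_zero)
  qed
  have injS: "inj_on S K"
  proof (rule inj_onI)
    fix z z' assume "z \<in> K" "z' \<in> K" "S z = S z'"
    then show "z = z'" using K_eq by (metis S_def fst_conv)
  qed
  have injT: "inj_on T K"
  proof (rule inj_onI)
    fix z z' assume "z \<in> K" "z' \<in> K" "T z = T z'"
    then show "z = z'" using K_eq e_K by (metis T_def fst_conv)
  qed
  have "inj (frechet_derivative S (at z)) \<and> inj (frechet_derivative T (at z))" if "z \<in> K" for z
  proof -
    define y where "y = fst z"
    have y: "y \<in> F" "z = (y, 0)"
      using that K_eq[OF that] by (simp_all add: K_def y_def mem_Times_iff)
    define A where "A = frechet_derivative f (at y)"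
    define At where "At w = (\<Sum>i\<in>Basis. (w \<bullet> A i) *\<^sub>R i)" for w
    have dA: "(f has_derivative A) (at y)"
      using Cf[of 1] by (simp add: A_def frechet_derivative_works[symmetric])
    have linA: "linear A" by (rule has_derivative_linear[OF dA])
    have "surj A" unfolding A_def using y(1) by (intro surj) (auto simp: F_def f_def)
    note adj0 = adjoint_eq_zero[OF linA this]
    have At0: "At 0 = 0" by (simp add: At_def)
    have de: "(?e has_derivative (\<lambda>h. fst h + At (snd h))) (at z)"
      using has_derivative_normal_map[OF Cf, of y] by (simp add: y(2) At_def A_def case_prod_unfold)
    have dfst: "(fst has_derivative fst) (at z)"
      by (rule bounded_linear.has_derivative[OF bounded_linear_fst has_derivative_ident])
    have dfe: "((\<lambda>z. f (?e z)) has_derivative (\<lambda>h. A (fst h + At (snd h)))) (at z)"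
      by (rule has_derivative_compose[OF de]) (simp add: y(2) dA)
    have dff: "((\<lambda>z. f (fst z)) has_derivative (\<lambda>h. A (fst h))) (at z)"
      by (rule has_derivative_compose[OF dfst]) (simp add: y(2) dA)
    have dS: "(S has_derivative (\<lambda>h. (fst h, A (fst h + At (snd h))))) (at z)"
      unfolding S_def by (rule has_derivative_Pair[OF dfst dfe])
    have dT: "(T has_derivative (\<lambda>h. (fst h + At (snd h), A (fst h)))) (at z)"
      unfolding T_def by (rule has_derivative_Pair[OF de dff])
    have "inj (\<lambda>h. (fst h, A (fst h + At (snd h))))"
    proof (subst linear_injective_0[OF has_derivative_linear[OF dS]], intro allI impI)
      fix h :: "'a \<times> 'b \<times> 'c" assume h: "(fst h, A (fst h + At (snd h))) = 0"
      have 1: "fst h = 0" "A (fst h + At (snd h)) = 0"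
        using arg_cong[OF h, of fst] arg_cong[OF h, of snd] by (simp_all only: fst_conv snd_conv fst_zero snd_zero)
      then have "A (At (snd h)) = 0" by simp
      then have "snd h = 0" unfolding At_def by (rule adj0)
      with 1(1) show "h = 0" by (metis prod.collapse zero_prod_def)
    qed
    moreover have "inj (\<lambda>h. (fst h + At (snd h), A (fst h)))"
    proof (subst linear_injective_0[OF has_derivative_linear[OF dT]], intro allI impI)
      fix h :: "'a \<times> 'b \<times> 'c" assume h: "(fst h + At (snd h), A (fst h)) = 0"
      have 1: "fst h + At (snd h) = 0" "A (fst h) = 0"
        using arg_cong[OF h, of fst] arg_cong[OF h, of snd] by (simp_all only: fst_conv snd_conv fst_zero snd_zero)
      then have 2: "fst h = - At (snd h)" by (simp only: eq_neg_iff_add_eq_0)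
      with 1(2) have "A (At (snd h)) = 0" by (simp add: linear_neg[OF linA])
      then have "snd h = 0" unfolding At_def by (rule adj0)
      with 2 At0 show "h = 0" by (metis prod.collapse zero_prod_def neg_0_equal_iff_equal)
    qed
    ultimately show ?thesis
      by (simp only: frechet_derivative_eqI[OF dS] frechet_derivative_eqI[OF dT] simp_thms)
  qed
  note inj = this
  obtain WS where WS: "open WS" "K \<subseteq> WS" "\<And>W'. open W' \<Longrightarrow> W' \<subseteq> WS \<Longrightarrow> open (S ` W')"
      "inj_on S WS" "\<And>n. Ck_on n (inv_into WS S) (S ` WS)"
    by (rule smooth_inverse_near_compact[OF \<open>compact K\<close> open_UNIV subset_UNIV CS injS]) (use inj in blast)+
  obtain WT where WT: "open WT" "K \<subseteq> WT" "\<And>W'. open W' \<Longrightarrow> W' \<subseteq> WT \<Longrightarrow> open (T ` W')"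
      "inj_on T WT" "\<And>n. Ck_on n (inv_into WT T) (T ` WT)"
    by (rule smooth_inverse_near_compact[OF \<open>compact K\<close> open_UNIV subset_UNIV CT injT]) (use inj in blast)+
  define W where "W = WS \<inter> WT"
  define gS where "gS = inv_into WS S"
  define gT where "gT = inv_into WT T"
  have oS: "open (S ` W)" and oT: "open (T ` W)"
    unfolding W_def by (rule WS(3) WT(3); use WS(1) WT(1) in auto)+
  have KW: "K \<subseteq> W" using WS(2) WT(2) by (simp add: W_def)
  have gS: "gS (S z) = z" and gT: "gT (T z) = z" if "z \<in> W" for z
    using that inv_into_f_f[OF WS(4)] inv_into_f_f[OF WT(4)] by (auto simp: gS_def gT_def W_def)
  have CgS: "Ck_on n gS (S ` W)" and CgT: "Ck_on n gT (T ` W)" for n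
    unfolding gS_def gT_def W_def
    by (rule Ck_on_subset[OF WS(5)], blast) (rule Ck_on_subset[OF WT(5)], blast)
  have K_ST: "(y, (c, 0)) \<in> S ` W \<and> (y, (c, 0)) \<in> T ` W" if "y \<in> F" for y
  proof -
    have "(y, 0) \<in> W" using KW that by (auto simp: K_def)
    moreover have "S (y, 0) = (y, (c, 0))" "T (y, 0) = (y, (c, 0))"
      using that by (simp_all add: S_def T_def F_def)
    ultimately show ?thesis by (metis image_eqI)
  qed
  obtain d1 where d1: "d1 > 0" "\<And>y u. y \<in> F \<Longrightarrow> dist u (c, 0) < d1 \<Longrightarrow> (y, u) \<in> S ` W"
    using uniform_slices_near_compact[OF \<open>compact F\<close> oS, of "(c, 0)"] K_ST by blast
  define N where "N = {x. (x, (c, 0)) \<in> T ` W}"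
  have "open N"
  proof -
    have "N = (\<lambda>x. (x, (c, 0))) -` (T ` W)" by (auto simp: N_def)
    then show ?thesis using oT by (auto intro!: open_vimage continuous_intros)
  qed
  obtain d2 where d2: "d2 > 0" "\<And>x. q x = 0 \<Longrightarrow> dist (J x) c < d2 \<Longrightarrow> x \<in> N"
  proof (rule preimage_near_compact_fibre[of "{x. q x = 0}" J c N])
    show "compact {x \<in> {x. q x = 0}. J x \<in> cball c 1}" using proper by simp
    show "{x \<in> {x. q x = 0}. J x = c} \<subseteq> N" unfolding F[symmetric] N_def using K_ST by blast
  qed (use contJ \<open>open N\<close> in auto)
  define U where "U = ball c (min d1 d2)"
  let ?P = "{x. q x = 0} \<inter> J -` U"
  define \<Phi> where "\<Phi> x = (J x, fst (gT (x, (c, 0))))" for x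
  define \<Psi> where "\<Psi> = (\<lambda>(u, y). ?e (gS (y, (u, 0))))"
  have \<Phi>: "\<exists>w. (y, w) \<in> W \<and> ?e (y, w) = x \<and> y \<in> F" if xP: "x \<in> ?P" and \<Phi>x: "\<Phi> x = (u, y)" for x u y
  proof -
    have "x \<in> N" using xP by (intro d2(2)) (auto simp: U_def dist_commute)
    then obtain z where z: "z \<in> W" "(x, (c, 0)) = T z" by (auto simp: N_def)
    then have "gT (x, (c, 0)) = z" using gT by simp
    then have "fst z = y" using \<Phi>x by (simp add: \<Phi>_def)
    then show ?thesis using z by (intro exI[of _ "snd z"]) (auto simp: T_def F_def)
  qed
  have \<Psi>: "\<exists>w. (y, w) \<in> W \<and> \<Psi> (u, y) = ?e (y, w) \<and> f (?e (y, w)) = (u, 0)" if uU: "u \<in> U" and yF: "y \<in> F" for u y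
  proof -
    have "dist (u, 0) (c, 0 :: 'c) < d1" using uU by (simp add: U_def dist_Pair_Pair dist_commute)
    then obtain z where z: "z \<in> W" "(y, (u, 0)) = S z" using d1(2)[OF yF] by blast
    then have "gS (y, (u, 0)) = z" using gS by simp
    then show ?thesis using z by (intro exI[of _ "snd z"]) (auto simp: S_def \<Psi>_def)
  qed
  have \<Phi>_eq: "\<Phi> (?e (y, w)) = (J (?e (y, w)), y)" if "(y, w) \<in> W" "y \<in> F" for y w
    using gT[OF that(1)] that(2) by (simp add: \<Phi>_def T_def F_def)
  have \<Psi>_eq: "\<Psi> (J (?e (y, w)), y) = ?e (y, w)" if "(y, w) \<in> W" "q (?e (y, w)) = 0" for y w
    using gS[OF that(1)] that(2) by (simp add: \<Psi>_def S_def f_def)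
  have \<Phi>_in: "\<Phi> x \<in> U \<times> F" if x: "x \<in> ?P" for x
    using \<Phi>[OF x, of "fst (\<Phi> x)" "snd (\<Phi> x)"] x by (auto simp: \<Phi>_def)
  have \<Psi>_in: "\<Psi> v \<in> ?P" if v: "v \<in> U \<times> F" for v
    using \<Psi>[of "fst v" "snd v"] v by (auto simp: f_def)
  have \<Psi>\<Phi>: "\<Psi> (\<Phi> x) = x" if x: "x \<in> ?P" for x
  proof -
    obtain y where y: "\<Phi> x = (J x, y)" by (simp add: \<Phi>_def)
    from \<Phi>[OF x y] obtain w where "(y, w) \<in> W" "?e (y, w) = x" by blast
    with \<Psi>_eq[of y w] x show ?thesis by (simp add: y)
  qed
  have \<Phi>\<Psi>: "\<Phi> (\<Psi> v) = v" if v: "v \<in> U \<times> F" for v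
  proof -
    obtain u y where uy: "v = (u, y)" "u \<in> U" "y \<in> F" using v by auto
    from \<Psi>[OF uy(2,3)] obtain w where w: "(y, w) \<in> W" "\<Psi> (u, y) = ?e (y, w)" "f (?e (y, w)) = (u, 0)"
      by blast
    then show ?thesis using \<Phi>_eq[OF w(1) uy(3)] by (simp add: uy(1) f_def)
  qed
  have s\<Phi>: "smooth_map_on ?P \<Phi>"
  proof (rule smooth_map_onI[OF \<open>open N\<close>])
    show "?P \<subseteq> N" using d2(2) by (auto simp: U_def dist_commute)
    have pair: "Ck_on n (\<lambda>x. (x, (c, 0 :: 'c))) N" for n
      by (intro Ck_on_Pair Ck_on_linear bounded_linear_ident Ck_on_const \<open>open N\<close>)
    have "Ck_on n (\<lambda>x. gT (x, (c, 0))) N" for n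
      by (rule Ck_on_compose[OF \<open>open N\<close> oT CgT pair]) (auto simp: N_def)
    then show "Ck_on n \<Phi> N" for n
      unfolding \<Phi>_def
      by (intro Ck_on_Pair Ck_on_subset[OF smooth(1)] Ck_on_linear_compose[OF _ bounded_linear_fst] \<open>open N\<close>) auto
  qed simp
  define M where "M = {v. (snd v, (fst v, 0 :: 'c)) \<in> S ` W}"
  have "open M"
  proof -
    have "M = (\<lambda>v. (snd v, (fst v, 0))) -` (S ` W)" by (auto simp: M_def)
    then show ?thesis using oS by (auto intro!: open_vimage continuous_intros)
  qed
  have s\<Psi>: "smooth_map_on (U \<times> F) \<Psi>"
  proof (rule smooth_map_onI[OF \<open>open M\<close>])
    show "U \<times> F \<subseteq> M" using d1(2) by (auto simp: M_def U_def dist_Pair_Pair dist_commute)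
    have pair: "Ck_on n (\<lambda>v. (snd v, (fst v, 0 :: 'c))) M" for n
      by (intro Ck_on_Pair Ck_on_linear bounded_linear_fst bounded_linear_snd Ck_on_const \<open>open M\<close>)
    have "Ck_on n (\<lambda>v. gS (snd v, (fst v, 0))) M" for n
      by (rule Ck_on_compose[OF \<open>open M\<close> oS CgS pair]) (auto simp: M_def)
    then have "Ck_on n (\<lambda>v. ?e (gS (snd v, (fst v, 0)))) M" for n
      by (rule Ck_on_compose[OF \<open>open M\<close> open_UNIV Ce]) simp
    then show "Ck_on n \<Psi> M" for n unfolding \<Psi>_def by (simp add: case_prod_unfold)
  qed simp
  have "homeomorphism ?P (U \<times> F) \<Phi> \<Psi>"
  proof (rule homeomorphismI)
    show "\<Phi> ` ?P \<subseteq> U \<times> F" using \<Phi>_in by (rule image_subsetI)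
    show "\<Psi> ` (U \<times> F) \<subseteq> ?P" using \<Psi>_in by (rule image_subsetI)
  qed (fact smooth_map_on_continuous[OF s\<Phi>] smooth_map_on_continuous[OF s\<Psi>] \<Psi>\<Phi> \<Phi>\<Psi>)+
  with s\<Phi> s\<Psi> have "diffeomorphism ?P (U \<times> F) \<Phi> \<Psi>" by (simp add: diffeomorphism_def)
  moreover have "smooth_submanifold (DIM('a) - DIM('b \<times> 'c)) F"
    unfolding F_def 
  proof (rule smooth_submanifold_level_set[OF Cf])
    fix x assume "f x = (c, 0)"
    then have "q x = 0" "J x = c" by (simp_all add: f_def)
    then show "surj (frechet_derivative f (at x))" by (rule surj)
  qed
  moreover have "\<forall>x\<in>?P. fst (\<Phi> x) = J x" by (simp add: \<Phi>_def)
  ultimately have "trivial_fibration_over {x. q x = 0} J U"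
    unfolding trivial_fibration_over_def by blast
  moreover have "open U" "c \<in> U" using d1(1) d2(1) by (auto simp: U_def)
  ultimately show ?thesis by blast
qed

section \<open>Commuting symplectic matrices\<close>

lemma vector_4:
  "(vector [w, x, y, z] :: 'a::zero ^ 4) $ 1 = w"
  "(vector [w, x, y, z] :: 'a::zero ^ 4) $ 2 = x"
  "(vector [w, x, y, z] :: 'a::zero ^ 4) $ 3 = y"
  "(vector [w, x, y, z] :: 'a::zero ^ 4) $ 4 = z"
  unfolding vector_def by simp_all

text \<open>An element of \<open>sp(4)\<close>: blocks \<open>a\<close>, symmetric \<open>b\<close>, symmetric \<open>c\<close>, and minus the transpose of \<open>a\<close>.\<close>

definition sp_matrix where
  "sp_matrix a11 a12 a21 a22 b11 b12 b22 c11 c12 c22 =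
    (vector [vector [a11, a12, b11, b12], vector [a21, a22, b12, b22],
      vector [c11, c12, - a11, - a21], vector [c12, c22, - a12, - a22]] :: complex^4^4)"

text \<open>The five-dimensional space of traceless matrices that are self-adjoint for the symplectic form.
  They satisfy Clifford relations: the anticommutator of two of them is twice the scalar \<open>form5\<close>.\<close>

definition clifford where
  "clifford t0 t1 t2 k k' =
    (vector [vector [t0, t1, 0, k], vector [t2, - t0, - k, 0],
      vector [0, k', t0, t2], vector [- k', 0, t1, - t0]] :: complex^4^4)"

lemmas matrix4_simps = vec_eq_iff forall_4 matrix_matrix_mult_def sum_4 sp_matrix_def clifford_def
  mat_def vector_4

definition form5 :: "complex \<Rightarrow> complex \<Rightarrow> complex \<Rightarrow> complex \<Rightarrow> complex \<Rightarrow>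
    complex \<Rightarrow> complex \<Rightarrow> complex \<Rightarrow> complex \<Rightarrow> complex \<Rightarrow> complex" where
  "form5 t0 t1 t2 k k' u0 u1 u2 m m' = t0 * u0 + (t1 * u2 + t2 * u1) / 2 - (k * m' + k' * m) / 2"

text \<open>The anticommutator is scalar, so for commuting factors the product itself is scalar.\<close>

lemma clifford_mult:
  assumes "clifford t0 t1 t2 k k' ** clifford u0 u1 u2 m m' = clifford u0 u1 u2 m m' ** clifford t0 t1 t2 k k'"
  shows "clifford t0 t1 t2 k k' ** clifford u0 u1 u2 m m' = mat (form5 t0 t1 t2 k k' u0 u1 u2 m m')"
proof -
  have "clifford t0 t1 t2 k k' ** clifford u0 u1 u2 m m' + clifford u0 u1 u2 m m' ** clifford t0 t1 t2 k k'
      = mat (2 * form5 t0 t1 t2 k k' u0 u1 u2 m m')"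
    by (simp add: matrix4_simps form5_def field_simps)
  then have double: "2 * (clifford t0 t1 t2 k k' ** clifford u0 u1 u2 m m') $ i $ j
      = mat (2 * form5 t0 t1 t2 k k' u0 u1 u2 m m') $ i $ j" for i j
    unfolding assms[symmetric] by (metis mult_2 vector_add_component)
  then have "(clifford t0 t1 t2 k k' ** clifford u0 u1 u2 m m') $ i $ j
      = mat (form5 t0 t1 t2 k k' u0 u1 u2 m m') $ i $ j" for i j
  proof -
    have "2 * (clifford t0 t1 t2 k k' ** clifford u0 u1 u2 m m') $ i $ j
        = 2 * (mat (form5 t0 t1 t2 k k' u0 u1 u2 m m') :: complex^4^4) $ i $ j"
      unfolding double by (simp add: mat_def)
    then show ?thesis by simp
  qed
  then show ?thesis by (simp add: vec_eq_iff)
qed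

text \<open>For commuting \<open>P\<close> and \<open>L\<close> in \<open>sp(4)\<close> the product \<open>P L\<close> is self-adjoint for the symplectic form,
  hence a scalar plus a Clifford element. The case \<open>P = L\<close> describes \<open>L\<^sup>2\<close>.\<close>

lemma sp_matrix_mult:
  fixes a11 a12 a21 a22 b11 b12 b22 c11 c12 c22 d11 d12 d21 d22 e11 e12 e22 f11 f12 f22 :: complex
  defines "P \<equiv> sp_matrix a11 a12 a21 a22 b11 b12 b22 c11 c12 c22"
    and "L \<equiv> sp_matrix d11 d12 d21 d22 e11 e12 e22 f11 f12 f22"
    and "u \<equiv> a11 * d11 + a12 * d21 + b11 * f11 + b12 * f12"
    and "v \<equiv> a21 * d12 + a22 * d22 + b12 * f12 + b22 * f22"
  assumes "P ** L = L ** P"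
  shows "P ** L = mat ((u + v) / 2) + clifford ((u - v) / 2)
      (a11 * d12 + a12 * d22 + b11 * f12 + b12 * f22) (a21 * d11 + a22 * d21 + b12 * f11 + b22 * f12)
      (a11 * e12 + a12 * e22 - b11 * d21 - b12 * d22) (c11 * d12 + c12 * d22 - a11 * f12 - a21 * f22)"
proof -
  have PL: "P $ i $ 1 * L $ 1 $ j + P $ i $ 2 * L $ 2 $ j + P $ i $ 3 * L $ 3 $ j + P $ i $ 4 * L $ 4 $ j
    = L $ i $ 1 * P $ 1 $ j + L $ i $ 2 * P $ 2 $ j + L $ i $ 3 * P $ 3 $ j + L $ i $ 4 * P $ 4 $ j" for i j
    using assms(5) by (simp add: vec_eq_iff matrix_matrix_mult_def sum_4)
  note * = PL[unfolded P_def L_def sp_matrix_def]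
  have half: "(u + v) / 2 + (u - v) / 2 = u" "(u + v) / 2 - (u - v) / 2 = v"
    by (simp_all add: field_simps)
  show ?thesis
    unfolding P_def L_def
    using *[of 1 1] *[of 1 2] *[of 1 3] *[of 1 4] *[of 2 1] *[of 2 2] *[of 2 3] *[of 2 4]
      *[of 3 1] *[of 3 2] *[of 3 3] *[of 3 4] *[of 4 1] *[of 4 2] *[of 4 3] *[of 4 4]
    apply (simp add: matrix4_simps half)
    apply (simp add: u_def v_def)
    apply (intro conjI)
    by algebra+
qed

lemma mat_mult_commute: "mat c ** (X :: complex^4^4) = X ** mat c"
  by (simp add: matrix4_simps mult.commute)

lemma matrix_add_rdistrib: "(A + B) ** (C :: complex^4^4) = A ** C + B ** C"
  by (simp add: vec_eq_iff matrix_matrix_mult_def sum.distrib distrib_right)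

lemma mat_vector: "mat c *v (x :: complex^4) = c *s x"
  by (simp add: matrix_vector_mult_def mat_def vec_eq_iff forall_4 sum_4)

text \<open>Here \<open>R\<close>, \<open>Q\<close> commute, so \<open>R Q = B\<close> is scalar, and so are \<open>Q\<^sup>2 = \<delta>\<close> and \<open>R\<^sup>2\<close>. If \<open>\<delta> = 0\<close> then
  \<open>B\<^sup>2 = R\<^sup>2 Q\<^sup>2 = 0\<close>. If \<open>\<delta> = f\<^sup>2\<close> then \<open>L\<close> is singular, because \<open>L\<^sup>2 (Q - f) = 0\<close>; a kernel vector \<open>v\<close>
  of \<open>L\<close> satisfies \<open>R v = - A v\<close> and \<open>Q v = - f v\<close>, and \<open>R Q v = B v\<close> gives \<open>B = f A\<close>. If also
  \<open>f = 0\<close>, then \<open>L\<^sup>4 = 0\<close>, so \<open>P L\<close> is nilpotent; as \<open>(P L)\<^sup>2 = 2 A P L\<close>, this leaves \<open>A = 0\<close>.\<close>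

lemma commuting_invariants:
  fixes t0 t1 t2 k k' u0 u1 u2 m m' :: complex
  defines "R \<equiv> clifford t0 t1 t2 k k'" and "Q \<equiv> clifford u0 u1 u2 m m'"
    and "B \<equiv> form5 t0 t1 t2 k k' u0 u1 u2 m m'" and "\<delta> \<equiv> form5 u0 u1 u2 m m' u0 u1 u2 m m'"
  assumes comm: "P ** L = L ** P" and PL: "P ** L = mat A + R" and L2: "L ** L = mat f + Q"
  shows "\<delta> = 0 \<Longrightarrow> B = 0" and "\<delta> = f\<^sup>2 \<Longrightarrow> B = f * A" and "f = 0 \<Longrightarrow> \<delta> = 0 \<Longrightarrow> A = 0"
proof -
  define \<rho> where "\<rho> = form5 t0 t1 t2 k k' t0 t1 t2 k k'"
  have RR: "R ** R = mat \<rho>" unfolding R_def \<rho>_def by (rule clifford_mult) simp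
  have QQ: "Q ** Q = mat \<delta>" unfolding Q_def \<delta>_def by (rule clifford_mult) simp
  have "(P ** L) ** (L ** L) = (L ** L) ** (P ** L)"
  proof -
    have "P ** (L ** L) = (L ** P) ** L" by (simp only: comm matrix_mul_assoc)
    also have "\<dots> = (L ** L) ** P" by (simp only: comm matrix_mul_assoc[symmetric])
    finally have "(P ** (L ** L)) ** L = ((L ** L) ** P) ** L" by simp
    then show ?thesis by (simp only: matrix_mul_assoc)
  qed
  then have comm_RQ: "R ** Q = Q ** R"
    unfolding PL L2
    by (simp add: matrix_add_ldistrib matrix_add_rdistrib mat_mult_commute[of A Q] mat_mult_commute[of f R]
        mat_mult_commute[of A "mat f"])
  then have RQ: "R ** Q = mat B" unfolding R_def Q_def B_def by (rule clifford_mult)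
  have vec: "R *v (R *v x) = \<rho> *s x" "R *v (Q *v x) = B *s x" "Q *v (R *v x) = B *s x" "Q *v (Q *v x) = \<delta> *s x"
      "P *v (L *v x) = A *s x + R *v x" "L *v (L *v x) = f *s x + Q *v x" "P *v (L *v x) = L *v (P *v x)" for x
    by (simp_all add: matrix_vector_mul_assoc RR RQ comm_RQ[symmetric] QQ PL comm[symmetric] L2 mat_vector matrix_vector_mult_add_rdistrib)
  have scale: "X *v (c *s x) = c *s (X *v x)" for X :: "complex^4^4" and c x
    by (simp add: vector_scalar_commute)
  have neg: "X *v (- x) = - (X *v x)" for X :: "complex^4^4" and x
    using scale[of X "-1" x] by simp
  have traceless: "g = 0" if "\<And>x. clifford a b c d e *v x = g *s x" for a b c d e g
  proof -
    have "clifford a b c d e = mat g" by (rule matrix_eq[THEN iffD2]) (simp add: that mat_vector)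
    then have "clifford a b c d e $ 1 $ 1 = g" "clifford a b c d e $ 2 $ 2 = g" by (simp_all add: mat_def)
    then show ?thesis by (simp add: clifford_def vector_4)
  qed
  define one :: "complex^4" where "one = vec 1"
  have one: "one \<noteq> 0" by (simp add: one_def vec_eq_iff)
  show B0: "B = 0" if "\<delta> = 0"
  proof -
    have "B *s (B *s one) = R *v (Q *v (R *v (Q *v one)))" by (simp only: vec)
    also have "Q *v (R *v (Q *v one)) = R *v (Q *v (Q *v one))"
      using vec(2)[of "Q *v one"] vec(3)[of "Q *v one"] by simp
    also have "\<dots> = 0" using that by (simp add: vec(4))
    finally show ?thesis using one by (simp add: vector_mul_eq_0)
  qed
  have kernel: "\<exists>v. v \<noteq> 0 \<and> L *v v = 0" if "\<delta> = f\<^sup>2"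
  proof (rule ccontr)
    assume "\<not> ?thesis"
    then have inj: "v = 0" if "L *v v = 0" for v using that by blast
    have Qf: "Q *v x = f *s x" for x
    proof -
      have "L *v (L *v (Q *v x - f *s x)) = 0"
        using that by (simp add: vec(6) matrix_vector_mult_diff_distrib scale vec(4) vector_ssub_ldistrib power2_eq_square)
      then have "Q *v x - f *s x = 0" using inj by blast
      then show ?thesis by simp
    qed
    then have "f = 0" using traceless unfolding Q_def by blast
    then have "L *v (L *v one) = 0" using Qf by (simp add: vec(6))
    then show False using inj one by blast
  qed
  show "B = f * A" if eq: "\<delta> = f\<^sup>2"
  proof -
    obtain v where v: "v \<noteq> 0" "L *v v = 0" using kernel[OF eq] by blast
    have "R *v v = - A *s v" using vec(5)[of v] v(2) by (simp add: add_eq_0_iff)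
    moreover have "Q *v v = - f *s v" using vec(6)[of v] v(2) by (simp add: add_eq_0_iff)
    ultimately have "B *s v = (f * A) *s v" using vec(2)[of v] by (auto simp: scale neg vector_smult_assoc)
    then show ?thesis using v(1) by simp
  qed
  show "A = 0" if f: "f = 0" and \<delta>: "\<delta> = 0"
  proof (rule ccontr)
    assume "A \<noteq> 0"
    obtain v where v: "v \<noteq> 0" "L *v v = 0" using kernel f \<delta> by auto
    have Rv: "R *v v = - A *s v" using vec(5)[of v] v(2) by (simp add: add_eq_0_iff)
    then have "\<rho> *s v = (A * A) *s v" using vec(1)[of v] by (auto simp: scale neg vector_smult_assoc)
    then have \<rho>: "\<rho> = A * A" using v(1) by simp
    define M where "M x = P *v (L *v x)" for x
    have MM: "M (M x) = (2 * A) *s M x" for x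
      by (simp add: M_def vec(5) vec(1) \<rho> scale matrix_vector_right_distrib vector_smult_assoc vector_add_ldistrib)
        (simp add: vec_eq_iff algebra_simps)
    have "M (M (M (M x))) = 0" for x
      by (simp add: M_def vec(7)[symmetric] vec(6) f) (simp add: vec(4) \<delta>)
    moreover have "M (c *s x) = c *s M x" for c x by (simp add: M_def scale)
    ultimately have "(2 * A * (2 * A * (2 * A))) *s M x = 0" for x
      by (metis MM vector_smult_assoc)
    then have "M x = 0" for x using \<open>A \<noteq> 0\<close> by (metis vector_mul_eq_0 mult_eq_0_iff zero_neq_numeral)
    then have "A *s x + R *v x = 0" for x unfolding M_def vec(5) .
    then have "R *v x = (- A) *s x" for x by (simp add: add_eq_0_iff)
    then have "- A = 0" using traceless unfolding R_def by blast
    with \<open>A \<noteq> 0\<close> show False by simp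
  qed
qed

section \<open>The Lax matrix of the gyrostat\<close>

lemma clifford_cong:
  "t0 = u0 \<Longrightarrow> t1 = u1 \<Longrightarrow> t2 = u2 \<Longrightarrow> k = m \<Longrightarrow> k' = m' \<Longrightarrow> clifford t0 t1 t2 k k' = clifford u0 u1 u2 m m'"
  by simp

text \<open>Complex coordinates of a phase point: \<open>w1 = \<omega>\<^sub>1 + i \<omega>\<^sub>2\<close>, \<open>w3 = \<omega>\<^sub>3\<close>,
  \<open>x1 = (\<alpha>\<^sub>1 - \<beta>\<^sub>2) + i (\<alpha>\<^sub>2 + \<beta>\<^sub>1)\<close>, \<open>y1 = (\<alpha>\<^sub>1 + \<beta>\<^sub>2) + i (\<alpha>\<^sub>2 - \<beta>\<^sub>1)\<close>, \<open>z1 = \<alpha>\<^sub>3 + i \<beta>\<^sub>3\<close>, the index 2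
  marking the conjugates, which are treated as independent variables. The constraints are not
  imposed: \<open>pp\<close> and \<open>rr\<close> are the polynomials that take the values \<open>p\<^sup>2\<close> and \<open>r\<^sup>4\<close> on the phase space,
  and \<open>Hc\<close>, \<open>Kc\<close>, \<open>Gc\<close> those that take the values of the integrals.\<close>

locale lax =
  fixes w1 w2 w3 x1 x2 y1 y2 z1 z2 l :: complex
begin

definition "pp = (x1 * x2 + y1 * y2) / 2 + z1 * z2"
definition "rr = (z1^2 + x1 * y2) * (z2^2 + x2 * y1)"
definition "Hc = w1 * w2 + w3^2 / 2 - (y1 + y2) / 2"
definition "Kc = (w1^2 + x1) * (w2^2 + x2) + 2 * l * ((w3 - l) * (w1 * w2) + w1 * z2 + w2 * z1)"
definition "Gc = (w1 * y2 + w2 * x1 + (w3 + l) * z1) * (w2 * y1 + w1 * x2 + (w3 + l) * z2) / 4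
  + (w3 - l) * (w1 * (z1 * x2 - z2 * y2) + w2 * (z2 * x1 - z1 * y1) + (w3 + l) * (y1 * y2 - x1 * x2) / 2) / 4
  - pp * (y1 + y2) / 4 + ((z2^2 + x2 * y1) * x1 + (z1^2 + x1 * y2) * x2) / 4"
definition "ht = Hc - l^2 / 2"

text \<open>In terms of \<open>L\<^sup>2 = f + Q\<close> and \<open>Q\<^sup>2 = \<delta>\<close> these are \<open>s\<^sup>2 (\<delta> - f\<^sup>2)\<close>, which is minus \<open>s\<^sup>2\<close> times the determinant of
  \<open>L s\<close>, and \<open>s\<^sup>2 \<delta>\<close>.\<close>

definition chi1 :: "complex poly" where
  "chi1 = [:- (rr / 4), pp * (Hc + l^2 / 2) - 2 * Gc, - (2 * l^2 * Hc + Kc), 2 * l^2:]"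
definition chi2 :: "complex poly" where
  "chi2 = [:(pp^2 - rr) / 4, - 2 * Gc, pp + ht^2 - Kc, - 2 * ht, 1:]"

definition L :: "complex \<Rightarrow> complex^4^4" where
  "L s = sp_matrix l (- w2) (- w1) (- w3) x2 z2 (- y1 - 2 * s)
    (- x1 / (2 * s)) (- z1 / (2 * s)) (1 + y2 / (2 * s))"

definition "f s = ht + l^2 - s - pp / (2 * s)"
definition "q0 s = s + (y1 + y2 + l^2 - w3^2) / 2 + (y1 * y2 - x1 * x2) / (4 * s)"
definition "q1 s = w2 * (w3 - l) + z2 + (y2 * z2 - x2 * z1) / (2 * s)"
definition "q2 s = w1 * (w3 - l) + z1 + (y1 * z1 - x1 * z2) / (2 * s)"
definition "qk s = w1 * x2 + w2 * y1 + (w3 + l) * z2 + 2 * w2 * s"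
definition "qk' s = w1 + (w1 * y2 + w2 * x1 + (w3 + l) * z1) / (2 * s)"

definition "qform s = form5 (q0 s) (q1 s) (q2 s) (qk s) (qk' s) (q0 s) (q1 s) (q2 s) (qk s) (qk' s)"

lemma L_square:
  assumes "s \<noteq> 0"
  shows "L s ** L s = mat (f s) + clifford (q0 s) (q1 s) (q2 s) (qk s) (qk' s)"
  unfolding L_def sp_matrix_mult[OF refl] using assms
  by (intro arg_cong2[where f = "(+)"] arg_cong[where f = mat] clifford_cong)
    (simp_all add: f_def q0_def q1_def q2_def qk_def qk'_def ht_def Hc_def pp_def field_simps power2_eq_square)

lemma qform_eq:
  assumes "s \<noteq> 0"
  shows "s^2 * qform s = poly chi2 s"
  using assms unfolding qform_def form5_def chi2_def q0_def q1_def q2_def qk_def qk'_def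
  by (simp add: ht_def Hc_def pp_def rr_def Gc_def Kc_def field_simps power2_eq_square)

lemma f_square:
  assumes "s \<noteq> 0"
  shows "s^2 * ((f s)^2) = poly chi2 s - poly chi1 s"
  using assms unfolding chi1_def chi2_def f_def ht_def
  by (simp add: field_simps power2_eq_square)

end

text \<open>The coefficients of the matrix \<open>L Q\<close> in the grading in which \<open>s\<close> has degree 2, the diagonal
  blocks have even and the off-diagonal blocks odd degree: suffix \<open>z\<close> marks degree 0 (diagonal
  blocks) or -1 (off-diagonal blocks), suffix \<open>m\<close> the degree lower by 2.
  The part of degree at most 0 of \<open>(\<phi>0 + \<phi>1 s) L Q + \<psi> L\<close> is built from them.\<close>

locale lax_critical = lax +
  fixes \<phi>0 \<phi>1 \<psi> :: complex
begin

definition "A11z = - (w1 * w2 * w3) + w1 * w2 * l - w1 * z2 - w2 * z1 - w3^2 * l / 2 + y1 * l / 2 + y2 * l / 2 + l^3 / 2"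
definition "A11m = - (w1 * y2 * z2 / 2) - w2 * y1 * z1 / 2 - w3 * z1 * z2 / 2 - x1 * x2 * l / 4 + y1 * y2 * l / 4 - z1 * z2 * l / 2"
definition "A12z = w1 * x2 - w2 * w3^2 / 2 + w2 * w3 * l + w2 * y1 / 2 + w2 * y2 / 2 - w2 * l^2 / 2 + z2 * l"
definition "A12m = w1 * x2 * y2 / 2 + w2 * x1 * x2 / 4 + w2 * y1 * y2 / 4 + w3 * x2 * z1 / 2 + y2 * z2 * l / 2"
definition "A21z = - (w1 * w3^2 / 2) + w1 * w3 * l + w1 * y1 / 2 + w1 * y2 / 2 - w1 * l^2 / 2 + w2 * x1 + z1 * l"
definition "A21m = w1 * x1 * x2 / 4 + w1 * y1 * y2 / 4 + w2 * x1 * y1 / 2 + w3 * x1 * z2 / 2 + y1 * z1 * l / 2"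
definition "A22z = - (w1 * w2 * w3) + w1 * w2 * l - w3^3 / 2 + w3 * y1 / 2 + w3 * y2 / 2 + w3 * l^2 / 2"
definition "A22m = w1 * x2 * z1 / 2 + w2 * x1 * z2 / 2 - w3 * x1 * x2 / 4 + w3 * y1 * y2 / 4 + w3 * z1 * z2 / 2 + z1 * z2 * l / 2"
definition "B11z = w1 * w2 * x2 + w2^2 * y1 + 2 * w2 * w3 * z2 - w3^2 * x2 / 2 + x2 * y1 / 2 + x2 * y2 / 2 + x2 * l^2 / 2 + z2^2"
definition "B11m = - (x1 * x2^2 / 4) + x2 * y1 * y2 / 4 - x2 * z1 * z2 / 2 + y2 * z2^2 / 2"
definition "B12z = w1 * w3 * x2 + w2 * y1 * l + w3^2 * z2 / 2 + w3 * z2 * l + x2 * z1 - y1 * z2 / 2 - y2 * z2 / 2 + z2 * l^2 / 2"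
definition "B12m = - (x1 * x2 * z2 / 4) + x2 * y1 * z1 / 2 - y1 * y2 * z2 / 4"
definition "B22z = - (w1^2 * x2) - w1 * w2 * y1 - 2 * w1 * z2 * l - w3^2 * y1 / 2 - x1 * x2 / 2 + y1^2 / 2 + y1 * y2 + y1 * l^2 / 2 + z1 * z2"
definition "B22m = - (x1 * x2 * y1 / 4) - x1 * z2^2 / 2 + y1^2 * y2 / 4 + y1 * z1 * z2 / 2"
definition "C11z = - (w1^2 * y2 / 2) - w1 * w2 * x1 / 2 - w1 * w3 * z1 + w3^2 * x1 / 4 - x1 * y1 / 4 - x1 * y2 / 4 - x1 * l^2 / 4 - z1^2 / 2"
definition "C11m = x1^2 * x2 / 8 - x1 * y1 * y2 / 8 + x1 * z1 * z2 / 4 - y1 * z1^2 / 4"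
definition "C12z = - (w1 * y2 * l / 2) - w2 * w3 * x1 / 2 - w3^2 * z1 / 4 - w3 * z1 * l / 2 - x1 * z2 / 2 + y1 * z1 / 4 + y2 * z1 / 4 - z1 * l^2 / 4"
definition "C12m = x1 * x2 * z1 / 8 - x1 * y2 * z2 / 4 + y1 * y2 * z1 / 8"
definition "C22z = w1 * w2 * y2 / 2 + w2^2 * x1 / 2 + w2 * z1 * l + w3^2 * y2 / 4 + x1 * x2 / 4 - y1 * y2 / 2 - y2^2 / 4 - y2 * l^2 / 4 - z1 * z2 / 2"
definition "C22m = x1 * x2 * y2 / 8 + x2 * z1^2 / 4 - y1 * y2^2 / 8 - y2 * z1 * z2 / 4"

text \<open>\<open>W1\<close>, \<open>W2\<close>, \<open>W3\<close> are the entries of degree 0 other than the one called \<open>nu\<close>; they turn out to be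
  the derivatives of \<open>\<phi>1 G + (\<phi>0 / 2) K - (\<psi> + \<phi>0 (H - \<lambda>\<^sup>2 / 2)) H\<close> in \<open>w1\<close>, \<open>w2\<close>, \<open>w3\<close>, the factor of the last \<open>H\<close> being held constant.\<close>

definition "nu = \<phi>0 * A11z + \<phi>1 * A11m + \<psi> * l"
definition "W1 = \<phi>0 * A12z + \<phi>1 * A12m - \<psi> * w2"
definition "W2 = \<phi>0 * A21z + \<phi>1 * A21m - \<psi> * w1"
definition "W3 = \<phi>0 * A22z + \<phi>1 * A22m - \<psi> * w3"
definition "b11 = \<phi>0 * B11z + \<phi>1 * B11m + \<psi> * x2"
definition "b12 = \<phi>0 * B12z + \<phi>1 * B12m + \<psi> * z2"
definition "b22 = \<phi>0 * B22z + \<phi>1 * B22m - \<psi> * y1"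
definition "c11 = \<phi>0 * C11z + \<phi>1 * C11m - \<psi> * x1 / 2"
definition "c12 = \<phi>0 * C12z + \<phi>1 * C12m - \<psi> * z1 / 2"
definition "c22 = \<phi>0 * C22z + \<phi>1 * C22m + \<psi> * y2 / 2"

lemmas coeff_defs = A11z_def A11m_def A12z_def A12m_def A21z_def A21m_def A22z_def A22m_def
  B11z_def B11m_def B12z_def B12m_def B22z_def B22m_def C11z_def C11m_def C12z_def C12m_def C22z_def C22m_def
lemmas atom_defs = nu_def W1_def W2_def W3_def b11_def b12_def b22_def c11_def c12_def c22_def

text \<open>The truncation, written down as it looks once \<open>W1\<close>, \<open>W2\<close>, \<open>W3\<close> and \<open>U1\<close>, \<open>U2\<close>, \<open>U3\<close> below vanish.\<close>

definition M :: "complex \<Rightarrow> complex^4^4" where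
  "M s = sp_matrix (nu + \<phi>0 * A11m / s) (\<phi>0 * A12m / s) (\<phi>0 * A21m / s) (\<phi>0 * A22m / s)
    (b11 + \<phi>0 * B11m / s) (w2 * nu + \<phi>0 * B12m / s) (b22 + \<phi>0 * B22m / s)
    ((c11 + \<phi>0 * C11m / s) / s) ((\<phi>0 * C12m / s - w1 * nu / 2) / s) ((\<phi>0 * C22m / s - b22 / 2) / s)"

text \<open>These are the derivatives in the directions of simultaneous rotations of \<open>\<alpha>\<close> and \<open>\<beta>\<close>, up to
  multiples of \<open>W1\<close>, \<open>W2\<close>, \<open>W3\<close>.\<close>

definition "U1 = b12 - w2 * nu"
definition "U2 = c12 + w1 * nu / 2"
definition "U3 = b22 + 2 * c22"

text \<open>The untruncated matrix commutes with \<open>L\<close>, so the commutator of the truncation lives in the few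
  degrees that the truncation boundary can reach. Each of its coefficients in powers of
  \<open>1 / s\<close> is a combination of the six critical expressions; the right hand sides below give
  these combinations, zero meaning a polynomial identity.\<close>

lemma M_commute:
  assumes "W1 = 0" "W2 = 0" "W3 = 0" "U1 = 0" "U2 = 0" "U3 = 0" and s: "s \<noteq> 0"
  shows "M s ** L s = L s ** M s"
proof -
  note zero = assms(1-6)
  have "w1 * z2 * nu / 2 - w1 * \<phi>0 * A12m - w2 * z1 * nu / 2 + w2 * \<phi>0 * A21m - x1 * b11 / 2 - x2 * c11 = z1 * U1 / 2 + z2 * U2"
    by (simp add: U1_def U2_def U3_def atom_defs coeff_defs field_simps power2_eq_square power3_eq_cube)
  then have r1: "w1 * z2 * nu / 2 - w1 * \<phi>0 * A12m - w2 * z1 * nu / 2 + w2 * \<phi>0 * A21m - x1 * b11 / 2 - x2 * c11 = 0" by (simp add: zero)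
  have "- (x1 * \<phi>0 * B11m / 2) - x2 * \<phi>0 * C11m - z1 * \<phi>0 * B12m / 2 - z2 * \<phi>0 * C12m = 0"
    by (simp add: U1_def U2_def U3_def atom_defs coeff_defs field_simps power2_eq_square power3_eq_cube)
  then have r2: "- (x1 * \<phi>0 * B11m / 2) - x2 * \<phi>0 * C11m - z1 * \<phi>0 * B12m / 2 - z2 * \<phi>0 * C12m = 0" by (simp add: zero)
  have "w1 * x2 * nu / 2 + w2 * y2 * nu / 2 - w2 * \<phi>0 * A11m + w2 * \<phi>0 * A22m - w3 * \<phi>0 * A12m - z1 * b11 / 2 + z2 * b22 / 2 - l * \<phi>0 * A12m + \<phi>0 * B12m = - (y2 * U1 / 2) + x2 * U2 + z2 * U3 / 2"
    by (simp add: U1_def U2_def U3_def atom_defs coeff_defs field_simps power2_eq_square power3_eq_cube)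
  then have r3: "w1 * x2 * nu / 2 + w2 * y2 * nu / 2 - w2 * \<phi>0 * A11m + w2 * \<phi>0 * A22m - w3 * \<phi>0 * A12m - z1 * b11 / 2 + z2 * b22 / 2 - l * \<phi>0 * A12m + \<phi>0 * B12m = 0" by (simp add: zero)
  have "- (x2 * \<phi>0 * C12m) + y2 * \<phi>0 * B12m / 2 - z1 * \<phi>0 * B11m / 2 - z2 * \<phi>0 * C22m = 0"
    by (simp add: U1_def U2_def U3_def atom_defs coeff_defs field_simps power2_eq_square power3_eq_cube)
  then have r4: "- (x2 * \<phi>0 * C12m) + y2 * \<phi>0 * B12m / 2 - z1 * \<phi>0 * B11m / 2 - z2 * \<phi>0 * C22m = 0" by (simp add: zero)
  have "2 * w2^2 * nu + 2 * x2 * nu - 2 * l * b11 = - (2 * z2 * W1) - 2 * w2 * U1"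
    by (simp add: U1_def U2_def U3_def atom_defs coeff_defs field_simps power2_eq_square power3_eq_cube)
  then have r5: "2 * w2^2 * nu + 2 * x2 * nu - 2 * l * b11 = 0" by (simp add: zero)
  have "2 * w2 * \<phi>0 * B12m + 2 * x2 * \<phi>0 * A11m + 2 * z2 * \<phi>0 * A12m - 2 * l * \<phi>0 * B11m = 0"
    by (simp add: U1_def U2_def U3_def atom_defs coeff_defs field_simps power2_eq_square power3_eq_cube)
  then have r6: "2 * w2 * \<phi>0 * B12m + 2 * x2 * \<phi>0 * A11m + 2 * z2 * \<phi>0 * A12m - 2 * l * \<phi>0 * B11m = 0" by (simp add: zero)
  have "w1 * b11 + w2 * w3 * nu - w2 * l * nu + w2 * b22 + z2 * nu - 2 * \<phi>0 * A12m = y1 * W1 - x2 * W2 - z2 * W3 - w3 * U1 + l * U1"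
    by (simp add: U1_def U2_def U3_def atom_defs coeff_defs field_simps power2_eq_square power3_eq_cube)
  then have r7: "w1 * b11 + w2 * w3 * nu - w2 * l * nu + w2 * b22 + z2 * nu - 2 * \<phi>0 * A12m = 0" by (simp add: zero)
  have "w1 * \<phi>0 * B11m + w2 * \<phi>0 * B22m + w3 * \<phi>0 * B12m + x2 * \<phi>0 * A21m - y1 * \<phi>0 * A12m + z2 * \<phi>0 * A11m + z2 * \<phi>0 * A22m - l * \<phi>0 * B12m = 0"
    by (simp add: U1_def U2_def U3_def atom_defs coeff_defs field_simps power2_eq_square power3_eq_cube)
  then have r8: "w1 * \<phi>0 * B11m + w2 * \<phi>0 * B22m + w3 * \<phi>0 * B12m + x2 * \<phi>0 * A21m - y1 * \<phi>0 * A12m + z2 * \<phi>0 * A11m + z2 * \<phi>0 * A22m - l * \<phi>0 * B12m = 0" by (simp add: zero)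
  have "- (w1 * y1 * nu / 2) + w1 * \<phi>0 * A11m - w1 * \<phi>0 * A22m - w2 * x1 * nu / 2 + w3 * \<phi>0 * A21m - z1 * b22 / 2 - z2 * c11 + l * \<phi>0 * A21m + 2 * \<phi>0 * C12m = x1 * U1 / 2 - y1 * U2"
    by (simp add: U1_def U2_def U3_def atom_defs coeff_defs field_simps power2_eq_square power3_eq_cube)
  then have r9: "- (w1 * y1 * nu / 2) + w1 * \<phi>0 * A11m - w1 * \<phi>0 * A22m - w2 * x1 * nu / 2 + w3 * \<phi>0 * A21m - z1 * b22 / 2 - z2 * c11 + l * \<phi>0 * A21m + 2 * \<phi>0 * C12m = 0" by (simp add: zero)
  have "- (x1 * \<phi>0 * B12m / 2) + y1 * \<phi>0 * C12m - z1 * \<phi>0 * B22m / 2 - z2 * \<phi>0 * C11m = 0"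
    by (simp add: U1_def U2_def U3_def atom_defs coeff_defs field_simps power2_eq_square power3_eq_cube)
  then have r10: "- (x1 * \<phi>0 * B12m / 2) + y1 * \<phi>0 * C12m - z1 * \<phi>0 * B22m / 2 - z2 * \<phi>0 * C11m = 0" by (simp add: zero)
  have "w1 * z2 * nu / 2 + w1 * \<phi>0 * A12m - w2 * z1 * nu / 2 - w2 * \<phi>0 * A21m - y1 * b22 / 2 + y2 * b22 / 2 + \<phi>0 * B22m + 2 * \<phi>0 * C22m = z1 * U1 / 2 + z2 * U2 - y1 * U3 / 2"
    by (simp add: U1_def U2_def U3_def atom_defs coeff_defs field_simps power2_eq_square power3_eq_cube)
  then have r11: "w1 * z2 * nu / 2 + w1 * \<phi>0 * A12m - w2 * z1 * nu / 2 - w2 * \<phi>0 * A21m - y1 * b22 / 2 + y2 * b22 / 2 + \<phi>0 * B22m + 2 * \<phi>0 * C22m = 0" by (simp add: zero)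
  have "y1 * \<phi>0 * C22m + y2 * \<phi>0 * B22m / 2 - z1 * \<phi>0 * B12m / 2 - z2 * \<phi>0 * C12m = 0"
    by (simp add: U1_def U2_def U3_def atom_defs coeff_defs field_simps power2_eq_square power3_eq_cube)
  then have r12: "y1 * \<phi>0 * C22m + y2 * \<phi>0 * B22m / 2 - z1 * \<phi>0 * B12m / 2 - z2 * \<phi>0 * C12m = 0" by (simp add: zero)
  have "2 * w1 * w2 * nu + 2 * w3 * b22 - 4 * \<phi>0 * A22m = - (2 * z2 * W2) + 2 * y1 * W3 - 2 * w1 * U1"
    by (simp add: U1_def U2_def U3_def atom_defs coeff_defs field_simps power2_eq_square power3_eq_cube)
  then have r13: "2 * w1 * w2 * nu + 2 * w3 * b22 - 4 * \<phi>0 * A22m = 0" by (simp add: zero)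
  have "2 * w1 * \<phi>0 * B12m + 2 * w3 * \<phi>0 * B22m - 2 * y1 * \<phi>0 * A22m + 2 * z2 * \<phi>0 * A21m = 0"
    by (simp add: U1_def U2_def U3_def atom_defs coeff_defs field_simps power2_eq_square power3_eq_cube)
  then have r14: "2 * w1 * \<phi>0 * B12m + 2 * w3 * \<phi>0 * B22m - 2 * y1 * \<phi>0 * A22m + 2 * z2 * \<phi>0 * A21m = 0" by (simp add: zero)
  have "w1^2 * nu + x1 * nu + 2 * l * c11 = - (z1 * W2) + 2 * w1 * U2"
    by (simp add: U1_def U2_def U3_def atom_defs coeff_defs field_simps power2_eq_square power3_eq_cube)
  then have r15: "w1^2 * nu + x1 * nu + 2 * l * c11 = 0" by (simp add: zero)
  have "- (2 * w1 * \<phi>0 * C12m) + x1 * \<phi>0 * A11m + z1 * \<phi>0 * A21m + 2 * l * \<phi>0 * C11m = 0"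
    by (simp add: U1_def U2_def U3_def atom_defs coeff_defs field_simps power2_eq_square power3_eq_cube)
  then have r16: "- (2 * w1 * \<phi>0 * C12m) + x1 * \<phi>0 * A11m + z1 * \<phi>0 * A21m + 2 * l * \<phi>0 * C11m = 0" by (simp add: zero)
  have "w1 * w3 * nu / 2 - w1 * l * nu / 2 + w1 * b22 / 2 - w2 * c11 + z1 * nu / 2 - \<phi>0 * A21m = - (x1 * W1 / 2) + y2 * W2 / 2 - z1 * W3 / 2 + w3 * U2 - l * U2 + w1 * U3 / 2"
    by (simp add: U1_def U2_def U3_def atom_defs coeff_defs field_simps power2_eq_square power3_eq_cube)
  then have r17: "w1 * w3 * nu / 2 - w1 * l * nu / 2 + w1 * b22 / 2 - w2 * c11 + z1 * nu / 2 - \<phi>0 * A21m = 0" by (simp add: zero)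
  have "- (w1 * \<phi>0 * C22m) - w2 * \<phi>0 * C11m - w3 * \<phi>0 * C12m + x1 * \<phi>0 * A12m / 2 - y2 * \<phi>0 * A21m / 2 + z1 * \<phi>0 * A11m / 2 + z1 * \<phi>0 * A22m / 2 + l * \<phi>0 * C12m = 0"
    by (simp add: U1_def U2_def U3_def atom_defs coeff_defs field_simps power2_eq_square power3_eq_cube)
  then have r18: "- (w1 * \<phi>0 * C22m) - w2 * \<phi>0 * C11m - w3 * \<phi>0 * C12m + x1 * \<phi>0 * A12m / 2 - y2 * \<phi>0 * A21m / 2 + z1 * \<phi>0 * A11m / 2 + z1 * \<phi>0 * A22m / 2 + l * \<phi>0 * C12m = 0" by (simp add: zero)
  have "- (w1 * z2 * nu / 2) + w1 * \<phi>0 * A12m + w2 * z1 * nu / 2 - w2 * \<phi>0 * A21m + x1 * b11 / 2 + x2 * c11 = - (z1 * U1 / 2) - z2 * U2"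
    by (simp add: U1_def U2_def U3_def atom_defs coeff_defs field_simps power2_eq_square power3_eq_cube)
  then have r19: "- (w1 * z2 * nu / 2) + w1 * \<phi>0 * A12m + w2 * z1 * nu / 2 - w2 * \<phi>0 * A21m + x1 * b11 / 2 + x2 * c11 = 0" by (simp add: zero)
  have "x1 * \<phi>0 * B11m / 2 + x2 * \<phi>0 * C11m + z1 * \<phi>0 * B12m / 2 + z2 * \<phi>0 * C12m = 0"
    by (simp add: U1_def U2_def U3_def atom_defs coeff_defs field_simps power2_eq_square power3_eq_cube)
  then have r20: "x1 * \<phi>0 * B11m / 2 + x2 * \<phi>0 * C11m + z1 * \<phi>0 * B12m / 2 + z2 * \<phi>0 * C12m = 0" by (simp add: zero)
  have "w1 * y1 * nu / 2 - w1 * \<phi>0 * A11m + w1 * \<phi>0 * A22m + w2 * x1 * nu / 2 - w3 * \<phi>0 * A21m + z1 * b22 / 2 + z2 * c11 - l * \<phi>0 * A21m - 2 * \<phi>0 * C12m = - (x1 * U1 / 2) + y1 * U2"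
    by (simp add: U1_def U2_def U3_def atom_defs coeff_defs field_simps power2_eq_square power3_eq_cube)
  then have r21: "w1 * y1 * nu / 2 - w1 * \<phi>0 * A11m + w1 * \<phi>0 * A22m + w2 * x1 * nu / 2 - w3 * \<phi>0 * A21m + z1 * b22 / 2 + z2 * c11 - l * \<phi>0 * A21m - 2 * \<phi>0 * C12m = 0" by (simp add: zero)
  have "x1 * \<phi>0 * B12m / 2 - y1 * \<phi>0 * C12m + z1 * \<phi>0 * B22m / 2 + z2 * \<phi>0 * C11m = 0"
    by (simp add: U1_def U2_def U3_def atom_defs coeff_defs field_simps power2_eq_square power3_eq_cube)
  then have r22: "x1 * \<phi>0 * B12m / 2 - y1 * \<phi>0 * C12m + z1 * \<phi>0 * B22m / 2 + z2 * \<phi>0 * C11m = 0" by (simp add: zero)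
  have "w1 * w2 * nu + w3 * b22 - 2 * \<phi>0 * A22m = - (z2 * W2) + y1 * W3 - w1 * U1"
    by (simp add: U1_def U2_def U3_def atom_defs coeff_defs field_simps power2_eq_square power3_eq_cube)
  then have r23: "w1 * w2 * nu + w3 * b22 - 2 * \<phi>0 * A22m = 0" by (simp add: zero)
  have "- (2 * w2 * \<phi>0 * C12m) - 2 * w3 * \<phi>0 * C22m - y2 * \<phi>0 * A22m + z1 * \<phi>0 * A12m = 0"
    by (simp add: U1_def U2_def U3_def atom_defs coeff_defs field_simps power2_eq_square power3_eq_cube)
  then have r24: "- (2 * w2 * \<phi>0 * C12m) - 2 * w3 * \<phi>0 * C22m - y2 * \<phi>0 * A22m + z1 * \<phi>0 * A12m = 0" by (simp add: zero)
  have "- (w1 * x2 * nu / 2) - w2 * y2 * nu / 2 + w2 * \<phi>0 * A11m - w2 * \<phi>0 * A22m + w3 * \<phi>0 * A12m + z1 * b11 / 2 - z2 * b22 / 2 + l * \<phi>0 * A12m - \<phi>0 * B12m = y2 * U1 / 2 - x2 * U2 - z2 * U3 / 2"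
    by (simp add: U1_def U2_def U3_def atom_defs coeff_defs field_simps power2_eq_square power3_eq_cube)
  then have r25: "- (w1 * x2 * nu / 2) - w2 * y2 * nu / 2 + w2 * \<phi>0 * A11m - w2 * \<phi>0 * A22m + w3 * \<phi>0 * A12m + z1 * b11 / 2 - z2 * b22 / 2 + l * \<phi>0 * A12m - \<phi>0 * B12m = 0" by (simp add: zero)
  have "x2 * \<phi>0 * C12m - y2 * \<phi>0 * B12m / 2 + z1 * \<phi>0 * B11m / 2 + z2 * \<phi>0 * C22m = 0"
    by (simp add: U1_def U2_def U3_def atom_defs coeff_defs field_simps power2_eq_square power3_eq_cube)
  then have r26: "x2 * \<phi>0 * C12m - y2 * \<phi>0 * B12m / 2 + z1 * \<phi>0 * B11m / 2 + z2 * \<phi>0 * C22m = 0" by (simp add: zero)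
  have "- (w1 * z2 * nu / 2) - w1 * \<phi>0 * A12m + w2 * z1 * nu / 2 + w2 * \<phi>0 * A21m + y1 * b22 / 2 - y2 * b22 / 2 - \<phi>0 * B22m - 2 * \<phi>0 * C22m = - (z1 * U1 / 2) - z2 * U2 + y1 * U3 / 2"
    by (simp add: U1_def U2_def U3_def atom_defs coeff_defs field_simps power2_eq_square power3_eq_cube)
  then have r27: "- (w1 * z2 * nu / 2) - w1 * \<phi>0 * A12m + w2 * z1 * nu / 2 + w2 * \<phi>0 * A21m + y1 * b22 / 2 - y2 * b22 / 2 - \<phi>0 * B22m - 2 * \<phi>0 * C22m = 0" by (simp add: zero)
  have "- (y1 * \<phi>0 * C22m) - y2 * \<phi>0 * B22m / 2 + z1 * \<phi>0 * B12m / 2 + z2 * \<phi>0 * C12m = 0"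
    by (simp add: U1_def U2_def U3_def atom_defs coeff_defs field_simps power2_eq_square power3_eq_cube)
  then have r28: "- (y1 * \<phi>0 * C22m) - y2 * \<phi>0 * B22m / 2 + z1 * \<phi>0 * B12m / 2 + z2 * \<phi>0 * C12m = 0" by (simp add: zero)
  have "(M s ** L s) $ 1 $ 1 - (L s ** M s) $ 1 $ 1 = (w1 * z2 * nu / 2 - w1 * \<phi>0 * A12m - w2 * z1 * nu / 2 + w2 * \<phi>0 * A21m - x1 * b11 / 2 - x2 * c11) / s + (- (x1 * \<phi>0 * B11m / 2) - x2 * \<phi>0 * C11m - z1 * \<phi>0 * B12m / 2 - z2 * \<phi>0 * C12m) / s^2"
    using s by (simp add: matrix4_simps M_def L_def field_simps power2_eq_square)
  then have e11: "(M s ** L s) $ 1 $ 1 = (L s ** M s) $ 1 $ 1"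
    by (simp only: r1 r2 div_0 add_0_left right_minus_eq)
  have "(M s ** L s) $ 1 $ 2 - (L s ** M s) $ 1 $ 2 = (w1 * x2 * nu / 2 + w2 * y2 * nu / 2 - w2 * \<phi>0 * A11m + w2 * \<phi>0 * A22m - w3 * \<phi>0 * A12m - z1 * b11 / 2 + z2 * b22 / 2 - l * \<phi>0 * A12m + \<phi>0 * B12m) / s + (- (x2 * \<phi>0 * C12m) + y2 * \<phi>0 * B12m / 2 - z1 * \<phi>0 * B11m / 2 - z2 * \<phi>0 * C22m) / s^2"
    using s by (simp add: matrix4_simps M_def L_def field_simps power2_eq_square)
  then have e12: "(M s ** L s) $ 1 $ 2 = (L s ** M s) $ 1 $ 2"
    by (simp only: r3 r4 div_0 add_0_left right_minus_eq)
  have "(M s ** L s) $ 1 $ 3 - (L s ** M s) $ 1 $ 3 = (2 * w2^2 * nu + 2 * x2 * nu - 2 * l * b11) + (2 * w2 * \<phi>0 * B12m + 2 * x2 * \<phi>0 * A11m + 2 * z2 * \<phi>0 * A12m - 2 * l * \<phi>0 * B11m) / s"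
    using s by (simp add: matrix4_simps M_def L_def field_simps power2_eq_square)
  then have e13: "(M s ** L s) $ 1 $ 3 = (L s ** M s) $ 1 $ 3"
    by (simp only: r5 r6 div_0 add_0_left right_minus_eq)
  have "(M s ** L s) $ 1 $ 4 - (L s ** M s) $ 1 $ 4 = (w1 * b11 + w2 * w3 * nu - w2 * l * nu + w2 * b22 + z2 * nu - 2 * \<phi>0 * A12m) + (w1 * \<phi>0 * B11m + w2 * \<phi>0 * B22m + w3 * \<phi>0 * B12m + x2 * \<phi>0 * A21m - y1 * \<phi>0 * A12m + z2 * \<phi>0 * A11m + z2 * \<phi>0 * A22m - l * \<phi>0 * B12m) / s"
    using s by (simp add: matrix4_simps M_def L_def field_simps power2_eq_square)
  then have e14: "(M s ** L s) $ 1 $ 4 = (L s ** M s) $ 1 $ 4"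
    by (simp only: r7 r8 div_0 add_0_left right_minus_eq)
  have "(M s ** L s) $ 2 $ 1 - (L s ** M s) $ 2 $ 1 = (- (w1 * y1 * nu / 2) + w1 * \<phi>0 * A11m - w1 * \<phi>0 * A22m - w2 * x1 * nu / 2 + w3 * \<phi>0 * A21m - z1 * b22 / 2 - z2 * c11 + l * \<phi>0 * A21m + 2 * \<phi>0 * C12m) / s + (- (x1 * \<phi>0 * B12m / 2) + y1 * \<phi>0 * C12m - z1 * \<phi>0 * B22m / 2 - z2 * \<phi>0 * C11m) / s^2"
    using s by (simp add: matrix4_simps M_def L_def field_simps power2_eq_square)
  then have e21: "(M s ** L s) $ 2 $ 1 = (L s ** M s) $ 2 $ 1"
    by (simp only: r9 r10 div_0 add_0_left right_minus_eq)
  have "(M s ** L s) $ 2 $ 2 - (L s ** M s) $ 2 $ 2 = (w1 * z2 * nu / 2 + w1 * \<phi>0 * A12m - w2 * z1 * nu / 2 - w2 * \<phi>0 * A21m - y1 * b22 / 2 + y2 * b22 / 2 + \<phi>0 * B22m + 2 * \<phi>0 * C22m) / s + (y1 * \<phi>0 * C22m + y2 * \<phi>0 * B22m / 2 - z1 * \<phi>0 * B12m / 2 - z2 * \<phi>0 * C12m) / s^2"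
    using s by (simp add: matrix4_simps M_def L_def field_simps power2_eq_square)
  then have e22: "(M s ** L s) $ 2 $ 2 = (L s ** M s) $ 2 $ 2"
    by (simp only: r11 r12 div_0 add_0_left right_minus_eq)
  have "(M s ** L s) $ 2 $ 3 - (L s ** M s) $ 2 $ 3 = (w1 * b11 + w2 * w3 * nu - w2 * l * nu + w2 * b22 + z2 * nu - 2 * \<phi>0 * A12m) + (w1 * \<phi>0 * B11m + w2 * \<phi>0 * B22m + w3 * \<phi>0 * B12m + x2 * \<phi>0 * A21m - y1 * \<phi>0 * A12m + z2 * \<phi>0 * A11m + z2 * \<phi>0 * A22m - l * \<phi>0 * B12m) / s"
    using s by (simp add: matrix4_simps M_def L_def field_simps power2_eq_square)
  then have e23: "(M s ** L s) $ 2 $ 3 = (L s ** M s) $ 2 $ 3"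
    by (simp only: r7 r8 div_0 add_0_left right_minus_eq)
  have "(M s ** L s) $ 2 $ 4 - (L s ** M s) $ 2 $ 4 = (2 * w1 * w2 * nu + 2 * w3 * b22 - 4 * \<phi>0 * A22m) + (2 * w1 * \<phi>0 * B12m + 2 * w3 * \<phi>0 * B22m - 2 * y1 * \<phi>0 * A22m + 2 * z2 * \<phi>0 * A21m) / s"
    using s by (simp add: matrix4_simps M_def L_def field_simps power2_eq_square)
  then have e24: "(M s ** L s) $ 2 $ 4 = (L s ** M s) $ 2 $ 4"
    by (simp only: r13 r14 div_0 add_0_left right_minus_eq)
  have "(M s ** L s) $ 3 $ 1 - (L s ** M s) $ 3 $ 1 = (w1^2 * nu + x1 * nu + 2 * l * c11) / s + (- (2 * w1 * \<phi>0 * C12m) + x1 * \<phi>0 * A11m + z1 * \<phi>0 * A21m + 2 * l * \<phi>0 * C11m) / s^2"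
    using s by (simp add: matrix4_simps M_def L_def field_simps power2_eq_square)
  then have e31: "(M s ** L s) $ 3 $ 1 = (L s ** M s) $ 3 $ 1"
    by (simp only: r15 r16 div_0 add_0_left right_minus_eq)
  have "(M s ** L s) $ 3 $ 2 - (L s ** M s) $ 3 $ 2 = (w1 * w3 * nu / 2 - w1 * l * nu / 2 + w1 * b22 / 2 - w2 * c11 + z1 * nu / 2 - \<phi>0 * A21m) / s + (- (w1 * \<phi>0 * C22m) - w2 * \<phi>0 * C11m - w3 * \<phi>0 * C12m + x1 * \<phi>0 * A12m / 2 - y2 * \<phi>0 * A21m / 2 + z1 * \<phi>0 * A11m / 2 + z1 * \<phi>0 * A22m / 2 + l * \<phi>0 * C12m) / s^2"
    using s by (simp add: matrix4_simps M_def L_def field_simps power2_eq_square)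
  then have e32: "(M s ** L s) $ 3 $ 2 = (L s ** M s) $ 3 $ 2"
    by (simp only: r17 r18 div_0 add_0_left right_minus_eq)
  have "(M s ** L s) $ 3 $ 3 - (L s ** M s) $ 3 $ 3 = (- (w1 * z2 * nu / 2) + w1 * \<phi>0 * A12m + w2 * z1 * nu / 2 - w2 * \<phi>0 * A21m + x1 * b11 / 2 + x2 * c11) / s + (x1 * \<phi>0 * B11m / 2 + x2 * \<phi>0 * C11m + z1 * \<phi>0 * B12m / 2 + z2 * \<phi>0 * C12m) / s^2"
    using s by (simp add: matrix4_simps M_def L_def field_simps power2_eq_square)
  then have e33: "(M s ** L s) $ 3 $ 3 = (L s ** M s) $ 3 $ 3"
    by (simp only: r19 r20 div_0 add_0_left right_minus_eq)
  have "(M s ** L s) $ 3 $ 4 - (L s ** M s) $ 3 $ 4 = (w1 * y1 * nu / 2 - w1 * \<phi>0 * A11m + w1 * \<phi>0 * A22m + w2 * x1 * nu / 2 - w3 * \<phi>0 * A21m + z1 * b22 / 2 + z2 * c11 - l * \<phi>0 * A21m - 2 * \<phi>0 * C12m) / s + (x1 * \<phi>0 * B12m / 2 - y1 * \<phi>0 * C12m + z1 * \<phi>0 * B22m / 2 + z2 * \<phi>0 * C11m) / s^2"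
    using s by (simp add: matrix4_simps M_def L_def field_simps power2_eq_square)
  then have e34: "(M s ** L s) $ 3 $ 4 = (L s ** M s) $ 3 $ 4"
    by (simp only: r21 r22 div_0 add_0_left right_minus_eq)
  have "(M s ** L s) $ 4 $ 1 - (L s ** M s) $ 4 $ 1 = (w1 * w3 * nu / 2 - w1 * l * nu / 2 + w1 * b22 / 2 - w2 * c11 + z1 * nu / 2 - \<phi>0 * A21m) / s + (- (w1 * \<phi>0 * C22m) - w2 * \<phi>0 * C11m - w3 * \<phi>0 * C12m + x1 * \<phi>0 * A12m / 2 - y2 * \<phi>0 * A21m / 2 + z1 * \<phi>0 * A11m / 2 + z1 * \<phi>0 * A22m / 2 + l * \<phi>0 * C12m) / s^2"
    using s by (simp add: matrix4_simps M_def L_def field_simps power2_eq_square)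
  then have e41: "(M s ** L s) $ 4 $ 1 = (L s ** M s) $ 4 $ 1"
    by (simp only: r17 r18 div_0 add_0_left right_minus_eq)
  have "(M s ** L s) $ 4 $ 2 - (L s ** M s) $ 4 $ 2 = (w1 * w2 * nu + w3 * b22 - 2 * \<phi>0 * A22m) / s + (- (2 * w2 * \<phi>0 * C12m) - 2 * w3 * \<phi>0 * C22m - y2 * \<phi>0 * A22m + z1 * \<phi>0 * A12m) / s^2"
    using s by (simp add: matrix4_simps M_def L_def field_simps power2_eq_square)
  then have e42: "(M s ** L s) $ 4 $ 2 = (L s ** M s) $ 4 $ 2"
    by (simp only: r23 r24 div_0 add_0_left right_minus_eq)
  have "(M s ** L s) $ 4 $ 3 - (L s ** M s) $ 4 $ 3 = (- (w1 * x2 * nu / 2) - w2 * y2 * nu / 2 + w2 * \<phi>0 * A11m - w2 * \<phi>0 * A22m + w3 * \<phi>0 * A12m + z1 * b11 / 2 - z2 * b22 / 2 + l * \<phi>0 * A12m - \<phi>0 * B12m) / s + (x2 * \<phi>0 * C12m - y2 * \<phi>0 * B12m / 2 + z1 * \<phi>0 * B11m / 2 + z2 * \<phi>0 * C22m) / s^2"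
    using s by (simp add: matrix4_simps M_def L_def field_simps power2_eq_square)
  then have e43: "(M s ** L s) $ 4 $ 3 = (L s ** M s) $ 4 $ 3"
    by (simp only: r25 r26 div_0 add_0_left right_minus_eq)
  have "(M s ** L s) $ 4 $ 4 - (L s ** M s) $ 4 $ 4 = (- (w1 * z2 * nu / 2) - w1 * \<phi>0 * A12m + w2 * z1 * nu / 2 + w2 * \<phi>0 * A21m + y1 * b22 / 2 - y2 * b22 / 2 - \<phi>0 * B22m - 2 * \<phi>0 * C22m) / s + (- (y1 * \<phi>0 * C22m) - y2 * \<phi>0 * B22m / 2 + z1 * \<phi>0 * B12m / 2 + z2 * \<phi>0 * C12m) / s^2"
    using s by (simp add: matrix4_simps M_def L_def field_simps power2_eq_square)
  then have e44: "(M s ** L s) $ 4 $ 4 = (L s ** M s) $ 4 $ 4"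
    by (simp only: r27 r28 div_0 add_0_left right_minus_eq)
  show ?thesis
    by (simp only: vec_eq_iff forall_4 e11 e12 e13 e14 e21 e22 e23 e24 e31 e32 e33 e34 e41 e42 e43 e44 simp_thms)
qed

end

section \<open>Critical points have double roots\<close>

lemma rsquarefree_degree:
  fixes p :: "complex poly"
  assumes "rsquarefree p"
  shows "card {x. poly p x = 0} = degree p"
proof -
  have p: "p \<noteq> 0" using assms by (simp add: rsquarefree_def)
  then have "degree p = degree (\<Prod>z | poly p z = 0. [:- z, 1:])"
    by (subst complex_poly_decompose_rsquarefree[OF assms, symmetric]) simp
  also have "\<dots> = (\<Sum>z | poly p z = 0. degree [:- z, 1:])"
    by (rule degree_prod_eq_sum_degree) simp
  finally show ?thesis by simp
qed

lemma eq_0_if_vanishes_on_roots: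
  fixes p q :: "complex poly"
  assumes "rsquarefree p" "\<And>x. poly p x = 0 \<Longrightarrow> poly q x = 0" "degree q < degree p"
  shows "q = 0"
proof (rule ccontr)
  assume "q \<noteq> 0"
  then have "card {x. poly p x = 0} \<le> card {x. poly q x = 0}"
    using assms(2) by (intro card_mono poly_roots_finite) auto
  also have "\<dots> \<le> degree q" by (rule card_poly_roots_bound[OF \<open>q \<noteq> 0\<close>])
  finally show False using rsquarefree_degree[OF assms(1)] assms(3) by simp
qed

context lax_critical
begin

text \<open>By \<open>sp_matrix_mult\<close> the product \<open>M L\<close> is a scalar \<open>A\<close> plus a Clifford element \<open>R\<close>. The polynomials
  below are the numerators: of \<open>A\<close> (\<open>Ap\<close>), of the components of \<open>R\<close> (\<open>R0\<close> to \<open>R4\<close>) and of \<open>Q\<close> (\<open>Q0\<close> to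
  \<open>Q4\<close>), and of the scalar \<open>R Q\<close> (\<open>Bp\<close>). What matters is the degrees of \<open>Ap\<close> and \<open>Bp\<close> and
  their lowest coefficients.\<close>

definition "Up = [:- \<phi>0 * (B11m * x1 + B12m * z1) / 2,
  \<phi>0 * (A11m * l - A12m * w1) - (b11 * x1 + w2 * nu * z1) / 2, nu * l:]"
definition "Vp = [:\<phi>0 * (B22m * y2 - B12m * z1) / 2,
  \<phi>0 * (B22m - A21m * w2 - A22m * w3) - w2 * nu * z1 / 2 + b22 * y2 / 2, b22:]"
definition "Ap = smult (1/2) (Up + Vp)"
definition "R0 = smult (1/2) (Up - Vp)"
definition "R1 = [:\<phi>0 * (B12m * y2 - B11m * z1) / 2,
  \<phi>0 * (B12m - A11m * w2 - A12m * w3) - b11 * z1 / 2 + w2 * nu * y2 / 2:]"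
definition "R2 = [:- \<phi>0 * (B12m * x1 + B22m * z1) / 2,
  \<phi>0 * (A21m * l - A22m * w1) - (w2 * nu * x1 + b22 * z1) / 2:]"
definition "R3 = [:\<phi>0 * (A11m * z2 - A12m * y1 + B11m * w1 + B12m * w3),
  nu * z2 - 2 * \<phi>0 * A12m + b11 * w1 + w2 * nu * w3:]"
definition "R4 = [:\<phi>0 * (A11m * z1 / 2 - A21m * y2 / 2 - C11m * w2 - C12m * w3),
  w1 * nu * w3 / 2 - c11 * w2 + nu * z1 / 2 - \<phi>0 * A21m:]"
definition "Q0 = [:(y1 * y2 - x1 * x2) / 4, (y1 + y2 + l^2 - w3^2) / 2, 1:]"
definition "Q1 = [:(y2 * z2 - x2 * z1) / 2, w2 * (w3 - l) + z2:]"
definition "Q2 = [:(y1 * z1 - x1 * z2) / 2, w1 * (w3 - l) + z1:]"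
definition "Q3 = [:w1 * x2 + w2 * y1 + (w3 + l) * z2, 2 * w2:]"
definition "Q4 = [:(w1 * y2 + w2 * x1 + (w3 + l) * z1) / 2, w1:]"
definition "Bp = R0 * Q0 + smult (1/2) (R1 * Q2 + R2 * Q1) - smult (1/2) (pCons 0 (R3 * Q4 + R4 * Q3))"

lemmas R_defs = Ap_def R0_def R1_def R2_def R3_def R4_def Up_def Vp_def
lemmas Q_defs = Q0_def Q1_def Q2_def Q3_def Q4_def

lemma degree_Ap: "degree Ap \<le> 2"
  unfolding Ap_def Up_def Vp_def by (simp add: degree_pCons_le le_less_trans)

lemma degree_Bp: "degree Bp \<le> 4"
proof -
  have "coeff Bp n = 0" if "n > 4" for n
  proof -
    have "5 \<le> n" using that by simp
    then obtain m where "n = 5 + m" using le_Suc_ex by blast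
    then have "n = Suc (Suc (Suc (Suc (Suc m))))" by simp
    then show ?thesis unfolding Bp_def R_defs Q_defs by (simp)
  qed
  then show ?thesis by (intro degree_le) auto
qed

lemma M_L_product:
  assumes "M s ** L s = L s ** M s" and s: "s \<noteq> 0"
  shows "M s ** L s = mat (poly Ap s / s^2) +
    clifford (poly R0 s / s^2) (poly R1 s / s^2) (poly R2 s / s^2) (poly R3 s / s) (poly R4 s / s^2)"
  unfolding M_def L_def sp_matrix_mult[OF assms(1)[unfolded M_def L_def]] using s
  by (intro arg_cong2[where f = "(+)"] arg_cong[where f = mat] clifford_cong)
    (simp_all add: R_defs field_simps power2_eq_square)

lemma Bp_eq:
  assumes "s \<noteq> 0"
  shows "s^3 * form5 (poly R0 s / s^2) (poly R1 s / s^2) (poly R2 s / s^2) (poly R3 s / s) (poly R4 s / s^2)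
    (q0 s) (q1 s) (q2 s) (qk s) (qk' s) = poly Bp s"
proof -
  have q: "q0 s = poly Q0 s / s" "q1 s = poly Q1 s / s" "q2 s = poly Q2 s / s" "qk s = poly Q3 s" "qk' s = poly Q4 s / s"
    using assms by (simp_all add: q0_def q1_def q2_def qk_def qk'_def Q_defs field_simps power2_eq_square)
  show ?thesis
    unfolding q form5_def Bp_def using assms
    by (simp add: field_simps power2_eq_square power3_eq_cube)
qed

text \<open>The lowest coefficients are those of the untruncated matrix, for which \<open>A\<close> is
  \<open>(\<phi>0 + \<phi>1 s) \<delta> + \<psi> f\<close> and \<open>B\<close> is \<open>((\<phi>0 + \<phi>1 s) f + \<psi>) \<delta>\<close>. The two coefficients of
  first order serve only after \<open>\<phi>0 = 0\<close> has been established.\<close>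

lemma Ap_coeff_0: "coeff Ap 0 = \<phi>0 * (pp^2 - rr) / 4"
proof -
  have "coeff Ap 0 = \<phi>0 * (B22m * y2 - 2 * B12m * z1 - B11m * x1) / 4"
    by (simp add: R_defs field_simps)
  also have "B22m * y2 - 2 * B12m * z1 - B11m * x1 = pp^2 - rr"
    unfolding coeff_defs pp_def rr_def by (simp add: field_simps power2_eq_square)
  finally show ?thesis .
qed

lemma Bp_coeff_0: "coeff Bp 0 = - (\<phi>0 * pp * (pp^2 - rr) / 8)"
proof -
  have "coeff Bp 0 = coeff R0 0 * coeff Q0 0 + (coeff R1 0 * coeff Q2 0 + coeff R2 0 * coeff Q1 0) / 2"
    by (simp add: Bp_def coeff_mult_0)
  also have "coeff R0 0 = - (\<phi>0 * (B11m * x1 + B22m * y2) / 4)"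
    by (simp add: R_defs field_simps)
  also have "coeff R1 0 = \<phi>0 * (B12m * y2 - B11m * z1) / 2" by (simp add: R1_def)
  also have "coeff R2 0 = - (\<phi>0 * (B12m * x1 + B22m * z1) / 2)" by (simp add: R2_def)
  finally have "coeff Bp 0 = \<phi>0 * (- (B11m * x1 + B22m * y2) * coeff Q0 0
      + (B12m * y2 - B11m * z1) * coeff Q2 0 - (B12m * x1 + B22m * z1) * coeff Q1 0) / 4"
    by (simp add: add_divide_distrib diff_divide_distrib algebra_simps)
  also have "- (B11m * x1 + B22m * y2) * coeff Q0 0
      + (B12m * y2 - B11m * z1) * coeff Q2 0 - (B12m * x1 + B22m * z1) * coeff Q1 0 = - (pp * (pp^2 - rr) / 2)"
    unfolding coeff_defs pp_def rr_def Q_defs by (simp add: field_simps power2_eq_square)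
  finally show ?thesis by (simp add: field_simps)
qed

lemma atoms_\<phi>0:
  assumes "\<phi>0 = 0" "U1 = 0"
  shows "b11 = \<phi>1 * B11m + \<psi> * x2" "w2 * nu = \<phi>1 * B12m + \<psi> * z2" "b22 = \<phi>1 * B22m - \<psi> * y1"
  using assms(2) unfolding U1_def b11_def b12_def b22_def by (simp_all add: assms(1))

lemma Ap_coeff_1:
  assumes "\<phi>0 = 0" "U1 = 0"
  shows "coeff Ap 1 = \<phi>1 * (pp^2 - rr) / 4 - \<psi> * pp / 2"
proof -
  have "coeff Ap 1 = (b22 * y2 - 2 * (w2 * nu) * z1 - b11 * x1) / 4"
    unfolding R_defs by (simp add: assms(1) field_simps)
  also have "b22 * y2 - 2 * (w2 * nu) * z1 - b11 * x1 = \<phi>1 * (pp^2 - rr) - \<psi> * (2 * pp)"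
    unfolding atoms_\<phi>0[OF assms] coeff_defs pp_def rr_def by (simp add: field_simps power2_eq_square)
  finally show ?thesis by (simp add: diff_divide_distrib)
qed

lemma Bp_coeff_1:
  assumes "\<phi>0 = 0" "U1 = 0"
  shows "coeff Bp 1 = (pp^2 - rr) / 4 * (\<psi> - \<phi>1 * pp / 2)"
proof -
  have 1: "coeff (p * q) 1 = coeff p 0 * coeff q 1 + coeff p 1 * coeff q 0" for p q :: "complex poly"
    by (simp add: coeff_mult)
  have 0: "coeff R0 0 = 0" "coeff R1 0 = 0" "coeff R2 0 = 0" "coeff R3 0 = 0" "coeff R4 0 = 0"
    unfolding R_defs by (simp_all add: assms(1))
  have "coeff Bp 1 = coeff R0 1 * coeff Q0 0 + (coeff R1 1 * coeff Q2 0 + coeff R2 1 * coeff Q1 0) / 2"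
    by (simp add: Bp_def 1[unfolded One_nat_def] coeff_mult_0 0)
  also have "coeff R0 1 = - ((b11 * x1 + b22 * y2) / 4)"
    unfolding R_defs by (simp add: assms(1) field_simps)
  also have "coeff R1 1 = (w2 * nu * y2 - b11 * z1) / 2"
    unfolding R1_def by (simp add: assms(1) field_simps)
  also have "coeff R2 1 = - ((w2 * nu * x1 + b22 * z1) / 2)"
    unfolding R2_def by (simp add: assms(1) field_simps)
  finally have "coeff Bp 1 = (- (b11 * x1 + b22 * y2) * coeff Q0 0
      + (w2 * nu * y2 - b11 * z1) * coeff Q2 0 - (w2 * nu * x1 + b22 * z1) * coeff Q1 0) / 4"
    by (simp add: add_divide_distrib diff_divide_distrib algebra_simps)
  also have "- (b11 * x1 + b22 * y2) * coeff Q0 0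
      + (w2 * nu * y2 - b11 * z1) * coeff Q2 0 - (w2 * nu * x1 + b22 * z1) * coeff Q1 0
      = (pp^2 - rr) * (\<psi> - \<phi>1 * pp / 2)"
    unfolding atoms_\<phi>0[OF assms] coeff_defs pp_def rr_def Q_defs by (simp add: field_simps power2_eq_square)
  finally show ?thesis by (simp add: field_simps)
qed

text \<open>Suppose all roots are simple. The polynomial \<open>Bp\<close> of degree at most 4 vanishes at the four roots of \<open>chi2\<close>, so it is
  a constant multiple \<open>c chi2\<close>. Then \<open>A = c f / s\<close> at the three roots of \<open>chi1\<close>, so the
  quadratic \<open>Ap\<close> equals \<open>c\<close> times the quadratic \<open>Fp = s f\<close>. Comparing the lowest coefficients gives
  \<open>\<phi>0 = 0\<close>, then \<open>c = 0\<close>, and finally \<open>\<phi>1 = 0\<close>.\<close>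

theorem critical_double_root:
  assumes crit: "W1 = 0" "W2 = 0" "W3 = 0" "U1 = 0" "U2 = 0" "U3 = 0"
    and nz: "l \<noteq> 0" "rr \<noteq> 0" "pp^2 \<noteq> rr" and \<phi>: "\<phi>0 \<noteq> 0 \<or> \<phi>1 \<noteq> 0"
  shows "\<not> rsquarefree chi1 \<or> \<not> rsquarefree chi2"
proof (rule ccontr)
  assume "\<not> ?thesis"
  then have sf: "rsquarefree chi1" "rsquarefree chi2" by auto
  define \<delta>0 where "\<delta>0 = (pp^2 - rr) / 4"
  have \<delta>0: "\<delta>0 \<noteq> 0" using nz by (simp add: \<delta>0_def)
  have inv: "poly chi2 s = 0 \<Longrightarrow> poly Bp s = 0"
      "poly chi1 s = 0 \<Longrightarrow> f s \<noteq> 0 \<Longrightarrow> s^3 * (f s * (poly Ap s / s^2)) = poly Bp s"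
      "poly chi1 s = 0 \<Longrightarrow> f s = 0 \<Longrightarrow> poly Ap s = 0" if s: "s \<noteq> 0" for s
  proof -
    note comm = M_commute[OF crit s]
    note I = commuting_invariants[OF comm M_L_product[OF comm s] L_square[OF s], folded qform_def]
    have q: "qform s = poly chi2 s / s^2" using qform_eq[OF s] s by (simp add: field_simps)
    have f2: "(f s)^2 = (poly chi2 s - poly chi1 s) / s^2" using f_square[OF s] s by (simp add: field_simps)
    show "poly Bp s = 0" if "poly chi2 s = 0"
      using I(1) Bp_eq[OF s] that by (simp add: q)
    show "s^3 * (f s * (poly Ap s / s^2)) = poly Bp s" if "poly chi1 s = 0" "f s \<noteq> 0"
      using I(2) Bp_eq[OF s] that by (simp add: q f2)
    show "poly Ap s = 0" if "poly chi1 s = 0" "f s = 0"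
      using I(3) f2 that s by (simp add: q)
  qed
  have nz2: "s \<noteq> 0" if "poly chi2 s = 0" for s
    using that nz(3) by (auto simp: chi2_def)
  have nz1: "s \<noteq> 0" if "poly chi1 s = 0" for s
    using that nz(2) by (auto simp: chi1_def)
  define c where "c = coeff Bp 4"
  have deg2: "degree chi2 = 4" by (simp add: chi2_def)
  have deg1: "degree chi1 = 3" using nz(1) by (simp add: chi1_def)
  have "Bp - smult c chi2 = 0"
  proof (rule eq_0_if_vanishes_on_roots[OF sf(2)])
    show "poly (Bp - smult c chi2) x = 0" if "poly chi2 x = 0" for x
      using inv(1)[OF nz2[OF that] that] that by simp
    have "coeff (Bp - smult c chi2) n = 0" if "n > 3" for n
    proof (cases "n = 4")
      case True
      then show ?thesis by (simp add: c_def chi2_def numeral_eq_Suc)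
    next
      case False
      with that degree_Bp deg2 show ?thesis by (simp add: coeff_eq_0)
    qed
    then have "degree (Bp - smult c chi2) \<le> 3" by (intro degree_le) auto
    then show "degree (Bp - smult c chi2) < degree chi2" by (simp add: deg2)
  qed
  then have Bp: "Bp = smult c chi2" by simp
  define Fp where "Fp = [:- pp / 2, ht + l^2, - 1:]"
  have Fp: "poly Fp s = s * f s" if "s \<noteq> 0" for s
    using that by (simp add: Fp_def f_def field_simps power2_eq_square)
  have "Ap - smult c Fp = 0"
  proof (rule eq_0_if_vanishes_on_roots[OF sf(1)])
    fix s assume s: "poly chi1 s = 0"
    note s0 = nz1[OF s]
    show "poly (Ap - smult c Fp) s = 0"
    proof (cases "f s = 0")
      case True
      then show ?thesis using inv(3)[OF s0 s] Fp[OF s0] by simp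
    next
      case False
      have "s^3 * (f s * (poly Ap s / s^2)) = c * poly chi2 s"
        using inv(2)[OF s0 s False] by (simp add: Bp)
      also have "poly chi2 s = s^2 * (f s)^2" using f_square[OF s0] s by simp
      finally have "(s * f s) * poly Ap s = (s * f s) * (c * (s * f s))"
        using s0 by (simp add: field_simps power2_eq_square power3_eq_cube)
      then show ?thesis using False s0 Fp[OF s0] by simp
    qed
  next
    have "degree Fp \<le> 2" by (simp add: Fp_def)
    then have "degree (Ap - smult c Fp) \<le> 2"
      using degree_Ap by (intro degree_diff_le) (auto intro: order_trans[OF degree_smult_le])
    then show "degree (Ap - smult c Fp) < degree chi1" by (simp add: deg1)
  qed
  then have Ap: "Ap = smult c Fp" by simp
  have B0: "- (\<phi>0 * pp / 2 * \<delta>0) = c * \<delta>0"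
    using arg_cong[OF Bp, of "\<lambda>p. coeff p 0"] Bp_coeff_0 by (simp add: chi2_def \<delta>0_def)
  then have "c * \<delta>0 = (- (\<phi>0 * pp / 2)) * \<delta>0" by simp
  then have c: "c = - (\<phi>0 * pp / 2)" using \<delta>0 by (simp only: mult_cancel_right) simp
  have A0: "\<phi>0 * \<delta>0 = - (c * pp / 2)"
    using arg_cong[OF Ap, of "\<lambda>p. coeff p 0"] Ap_coeff_0 by (simp add: Fp_def \<delta>0_def)
  have "\<phi>0 * rr = 0" using A0 unfolding c \<delta>0_def by (simp add: field_simps power2_eq_square)
  then have \<phi>0: "\<phi>0 = 0" using nz(2) by simp
  then have "c = 0" using c by simp
  have "\<delta>0 * (\<psi> - \<phi>1 * pp / 2) = 0"
    using Bp_coeff_1[OF \<phi>0 crit(4)] Bp \<open>c = 0\<close> by (simp add: \<delta>0_def)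
  then have \<psi>: "\<psi> = \<phi>1 * pp / 2" using \<delta>0 by simp
  have "\<phi>1 * \<delta>0 - \<psi> * pp / 2 = 0"
    using Ap_coeff_1[OF \<phi>0 crit(4)] Ap \<open>c = 0\<close> by (simp add: \<delta>0_def)
  then have "\<phi>1 * rr = 0" unfolding \<psi> \<delta>0_def by (simp add: field_simps power2_eq_square)
  with nz(2) \<phi> \<phi>0 show False by simp
qed

end

context lax_critical
begin

section \<open>The differentials of the integrals\<close>

text \<open>The differentials in complex coordinates, as linear forms in the increments. In \<open>dGc\<close> the
  expressions for \<open>p\<^sup>2\<close> and \<open>r\<^sup>2\<close> count as constants, as they are on the phase space.\<close>

definition "dGc dw1 dw2 dw3 dx1 dx2 dy1 dy2 dz1 dz2 =
  ((dw1 * y2 + w1 * dy2 + dw2 * x1 + w2 * dx1 + dw3 * z1 + (w3 + l) * dz1) * (w2 * y1 + w1 * x2 + (w3 + l) * z2)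
    + (w1 * y2 + w2 * x1 + (w3 + l) * z1) * (dw2 * y1 + w2 * dy1 + dw1 * x2 + w1 * dx2 + dw3 * z2 + (w3 + l) * dz2)) / 4
  + dw3 * (w1 * (z1 * x2 - z2 * y2) + w2 * (z2 * x1 - z1 * y1) + (w3 + l) * (y1 * y2 - x1 * x2) / 2) / 4
  + (w3 - l) * (dw1 * (z1 * x2 - z2 * y2) + w1 * (dz1 * x2 + z1 * dx2 - dz2 * y2 - z2 * dy2)
      + dw2 * (z2 * x1 - z1 * y1) + w2 * (dz2 * x1 + z2 * dx1 - dz1 * y1 - z1 * dy1)
      + dw3 * (y1 * y2 - x1 * x2) / 2 + (w3 + l) * (dy1 * y2 + y1 * dy2 - dx1 * x2 - x1 * dx2) / 2) / 4
  - pp * (dy1 + dy2) / 4 + ((z2^2 + x2 * y1) * dx1 + (z1^2 + x1 * y2) * dx2) / 4"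

definition "dKc dw1 dw2 dw3 dx1 dx2 dy1 dy2 dz1 dz2 =
  (2 * w1 * dw1 + dx1) * (w2^2 + x2) + (w1^2 + x1) * (2 * w2 * dw2 + dx2)
  + 2 * l * (dw3 * w1 * w2 + (w3 - l) * (dw1 * w2 + w1 * dw2) + dw1 * z2 + w1 * dz2 + dw2 * z1 + w2 * dz1)"

definition "dHc dw1 dw2 dw3 dx1 dx2 dy1 dy2 dz1 dz2 = dw1 * w2 + w1 * dw2 + w3 * dw3 - (dy1 + dy2) / 2"

definition "dFc dw1 dw2 dw3 dx1 dx2 dy1 dy2 dz1 dz2 =
  \<phi>1 * dGc dw1 dw2 dw3 dx1 dx2 dy1 dy2 dz1 dz2 + \<phi>0 / 2 * dKc dw1 dw2 dw3 dx1 dx2 dy1 dy2 dz1 dz2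
  - (\<psi> + \<phi>0 * ht) * dHc dw1 dw2 dw3 dx1 dx2 dy1 dy2 dz1 dz2"

lemmas differential_defs = dFc_def dGc_def dKc_def dHc_def

lemma dGc_sum: "dGc u1 u2 u3 u4 u5 u6 u7 u8 u9 = u1 * dGc 1 0 0 0 0 0 0 0 0 + u2 * dGc 0 1 0 0 0 0 0 0 0 + u3 * dGc 0 0 1 0 0 0 0 0 0 + u4 * dGc 0 0 0 1 0 0 0 0 0 + u5 * dGc 0 0 0 0 1 0 0 0 0 + u6 * dGc 0 0 0 0 0 1 0 0 0 + u7 * dGc 0 0 0 0 0 0 1 0 0 + u8 * dGc 0 0 0 0 0 0 0 1 0 + u9 * dGc 0 0 0 0 0 0 0 0 1"
  unfolding dGc_def by (simp add: add_divide_distrib diff_divide_distrib algebra_simps)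

lemma dGc_lincomb:
  "dGc (c * u1 + d * v1) (c * u2 + d * v2) (c * u3 + d * v3) (c * u4 + d * v4) (c * u5 + d * v5) (c * u6 + d * v6) (c * u7 + d * v7) (c * u8 + d * v8) (c * u9 + d * v9)
    = c * dGc u1 u2 u3 u4 u5 u6 u7 u8 u9 + d * dGc v1 v2 v3 v4 v5 v6 v7 v8 v9"
  unfolding dGc_sum[of "c * u1 + d * v1"] dGc_sum[of u1] dGc_sum[of v1] by (simp add: algebra_simps)

lemma dKc_lincomb:
  "dKc (c * u1 + d * v1) (c * u2 + d * v2) (c * u3 + d * v3) (c * u4 + d * v4) (c * u5 + d * v5) (c * u6 + d * v6) (c * u7 + d * v7) (c * u8 + d * v8) (c * u9 + d * v9)
    = c * dKc u1 u2 u3 u4 u5 u6 u7 u8 u9 + d * dKc v1 v2 v3 v4 v5 v6 v7 v8 v9"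
  unfolding dKc_def by (simp add: add_divide_distrib diff_divide_distrib algebra_simps)

lemma dHc_lincomb:
  "dHc (c * u1 + d * v1) (c * u2 + d * v2) (c * u3 + d * v3) (c * u4 + d * v4) (c * u5 + d * v5) (c * u6 + d * v6) (c * u7 + d * v7) (c * u8 + d * v8) (c * u9 + d * v9)
    = c * dHc u1 u2 u3 u4 u5 u6 u7 u8 u9 + d * dHc v1 v2 v3 v4 v5 v6 v7 v8 v9"
  unfolding dHc_def by (simp add: add_divide_distrib diff_divide_distrib algebra_simps)

lemma dFc_lincomb:
  "dFc (c * u1 + d * v1) (c * u2 + d * v2) (c * u3 + d * v3) (c * u4 + d * v4) (c * u5 + d * v5) (c * u6 + d * v6) (c * u7 + d * v7) (c * u8 + d * v8) (c * u9 + d * v9)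
    = c * dFc u1 u2 u3 u4 u5 u6 u7 u8 u9 + d * dFc v1 v2 v3 v4 v5 v6 v7 v8 v9"
  unfolding dFc_def dGc_lincomb dKc_lincomb dHc_lincomb by (simp add: algebra_simps)

lemma W_eq: "W1 = dFc 1 0 0 0 0 0 0 0 0" "W2 = dFc 0 1 0 0 0 0 0 0 0" "W3 = dFc 0 0 1 0 0 0 0 0 0"
  unfolding differential_defs
  by (simp_all add: atom_defs coeff_defs pp_def ht_def Hc_def field_simps power2_eq_square power3_eq_cube)

text \<open>The increments in \<open>U1_eq\<close>, \<open>U2_eq\<close> and \<open>U3_eq\<close> are complex combinations of infinitesimal rotations of the pair
  \<open>(\<alpha>, \<beta>)\<close>.\<close>

lemma U1_eq: "U1 = 2 * dFc 0 0 0 z1 0 z2 0 (- y2 / 2) (- x2 / 2) + w3 * W1 - w2 * W3 + l * W1"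
  unfolding differential_defs U1_def
  by (simp add: atom_defs coeff_defs pp_def ht_def Hc_def field_simps power2_eq_square power3_eq_cube)

lemma U2_eq: "U2 = dFc 0 0 0 0 (- z2) 0 (- z1) (x1 / 2) (y1 / 2) - w3 * W2 / 2 + w1 * W3 / 2 - l * W2 / 2"
  unfolding differential_defs U2_def
  by (simp add: atom_defs coeff_defs pp_def ht_def Hc_def field_simps power2_eq_square power3_eq_cube)

lemma U3_eq: "U3 = 2 * dFc 0 0 0 (- x1) x2 (- y1) y2 0 0 - 2 * w1 * W1 + 2 * w2 * W2"
  unfolding differential_defs U3_def
  by (simp add: atom_defs coeff_defs pp_def ht_def Hc_def field_simps power2_eq_square power3_eq_cube)

end

section \<open>Regularity and properness of the momentum map\<close>

abbreviation crd1 :: "state \<Rightarrow> 3 \<Rightarrow> real" where "crd1 x i \<equiv> fst x $ i"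
abbreviation crd2 :: "state \<Rightarrow> 3 \<Rightarrow> real" where "crd2 x i \<equiv> fst (snd x) $ i"
abbreviation crd3 :: "state \<Rightarrow> 3 \<Rightarrow> real" where "crd3 x i \<equiv> snd (snd x) $ i"

lemma bounded_linear_coordinates:
  "bounded_linear (\<lambda>x. crd1 x i)" "bounded_linear (\<lambda>x. crd2 x i)" "bounded_linear (\<lambda>x. crd3 x i)"
  by (intro bounded_linear_compose[OF bounded_linear_vec_nth] bounded_linear_compose[OF bounded_linear_fst]
      bounded_linear_compose[OF bounded_linear_snd] bounded_linear_fst bounded_linear_snd)+

lemmas has_derivative_coordinates =
  bounded_linear_coordinates[THEN bounded_linear.has_derivative, OF has_derivative_ident]

lemmas has_derivative_polynomial = has_derivative_coordinates has_derivative_const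
  has_derivative_add has_derivative_diff has_derivative_mult has_derivative_power
  bounded_linear.has_derivative[OF bounded_linear_divide]

lemmas coordinate_simps = inner_vec_def sum_3 cross3_def vector_3 ang_mom_def

lemma H_int_coords:
  "H_int x = (crd1 x 1)^2 + (crd1 x 2)^2 + (crd1 x 3)^2 / 2 - crd2 x 1 - crd3 x 2"
  by (simp add: H_int_def case_prod_unfold)

lemma K_int_coords:
  "K_int l x = ((crd1 x 1)^2 - (crd1 x 2)^2 + crd2 x 1 - crd3 x 2)^2 + (2 * crd1 x 1 * crd1 x 2 + crd2 x 2 + crd3 x 1)^2
   + 2 * l * ((crd1 x 3 - l) * ((crd1 x 1)^2 + (crd1 x 2)^2) + 2 * crd1 x 1 * crd2 x 3 + 2 * crd1 x 2 * crd3 x 3)"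
  by (simp add: K_int_def case_prod_unfold)

lemma G_int_coords:
  "G_int a b l x =
    ((2 * crd1 x 1 * crd2 x 1 + 2 * crd1 x 2 * crd2 x 2 + (crd1 x 3 + l) * crd2 x 3)^2
    + (2 * crd1 x 1 * crd3 x 1 + 2 * crd1 x 2 * crd3 x 2 + (crd1 x 3 + l) * crd3 x 3)^2) / 4
    + (crd1 x 3 - l) * (2 * crd1 x 1 * (crd2 x 2 * crd3 x 3 - crd2 x 3 * crd3 x 2)
      + 2 * crd1 x 2 * (crd2 x 3 * crd3 x 1 - crd2 x 1 * crd3 x 3)
      + (crd1 x 3 + l) * (crd2 x 1 * crd3 x 2 - crd2 x 2 * crd3 x 1)) / 2
    - b^2 * crd2 x 1 - a^2 * crd3 x 2"
  by (simp add: G_int_def case_prod_unfold coordinate_simps Let_def)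

definition dH_int :: "state \<Rightarrow> state \<Rightarrow> real" where
  "dH_int = (\<lambda>(w, \<alpha>, \<beta>) (dw, d\<alpha>, d\<beta>).
    2 * w$1 * dw$1 + 2 * w$2 * dw$2 + w$3 * dw$3 - d\<alpha>$1 - d\<beta>$2)"

definition dK_int :: "real \<Rightarrow> state \<Rightarrow> state \<Rightarrow> real" where
  "dK_int l = (\<lambda>(w, \<alpha>, \<beta>) (dw, d\<alpha>, d\<beta>).
    2 * ((w$1)^2 - (w$2)^2 + \<alpha>$1 - \<beta>$2) * (2 * w$1 * dw$1 - 2 * w$2 * dw$2 + d\<alpha>$1 - d\<beta>$2)
    + 2 * (2 * w$1 * w$2 + \<alpha>$2 + \<beta>$1) * (2 * w$1 * dw$2 + 2 * w$2 * dw$1 + d\<alpha>$2 + d\<beta>$1)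
    + 2 * l * (dw$3 * ((w$1)^2 + (w$2)^2) + (w$3 - l) * (2 * w$1 * dw$1 + 2 * w$2 * dw$2)
      + 2 * w$1 * d\<alpha>$3 + 2 * \<alpha>$3 * dw$1 + 2 * w$2 * d\<beta>$3 + 2 * \<beta>$3 * dw$2))"

definition dG_int :: "real \<Rightarrow> real \<Rightarrow> real \<Rightarrow> state \<Rightarrow> state \<Rightarrow> real" where
  "dG_int a b l = (\<lambda>(w, \<alpha>, \<beta>) (dw, d\<alpha>, d\<beta>).
    (2 * w$1 * \<alpha>$1 + 2 * w$2 * \<alpha>$2 + (w$3 + l) * \<alpha>$3) *
      (2 * w$1 * d\<alpha>$1 + 2 * w$2 * d\<alpha>$2 + (w$3 + l) * d\<alpha>$3 + 2 * dw$1 * \<alpha>$1 + 2 * dw$2 * \<alpha>$2 + dw$3 * \<alpha>$3) / 2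
    + (2 * w$1 * \<beta>$1 + 2 * w$2 * \<beta>$2 + (w$3 + l) * \<beta>$3) *
      (2 * w$1 * d\<beta>$1 + 2 * w$2 * d\<beta>$2 + (w$3 + l) * d\<beta>$3 + 2 * dw$1 * \<beta>$1 + 2 * dw$2 * \<beta>$2 + dw$3 * \<beta>$3) / 2
    + dw$3 * (2 * w$1 * (\<alpha>$2 * \<beta>$3 - \<alpha>$3 * \<beta>$2) + 2 * w$2 * (\<alpha>$3 * \<beta>$1 - \<alpha>$1 * \<beta>$3)
        + (w$3 + l) * (\<alpha>$1 * \<beta>$2 - \<alpha>$2 * \<beta>$1)) / 2
    + (w$3 - l) * (2 * dw$1 * (\<alpha>$2 * \<beta>$3 - \<alpha>$3 * \<beta>$2) + 2 * dw$2 * (\<alpha>$3 * \<beta>$1 - \<alpha>$1 * \<beta>$3)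
        + dw$3 * (\<alpha>$1 * \<beta>$2 - \<alpha>$2 * \<beta>$1)
        + 2 * w$1 * (d\<alpha>$2 * \<beta>$3 - d\<alpha>$3 * \<beta>$2 + \<alpha>$2 * d\<beta>$3 - \<alpha>$3 * d\<beta>$2)
        + 2 * w$2 * (d\<alpha>$3 * \<beta>$1 - d\<alpha>$1 * \<beta>$3 + \<alpha>$3 * d\<beta>$1 - \<alpha>$1 * d\<beta>$3)
        + (w$3 + l) * (d\<alpha>$1 * \<beta>$2 - d\<alpha>$2 * \<beta>$1 + \<alpha>$1 * d\<beta>$2 - \<alpha>$2 * d\<beta>$1)) / 2
    - b^2 * d\<alpha>$1 - a^2 * d\<beta>$2)"

lemma has_derivative_H_int: "(H_int has_derivative dH_int x) (at x)"
proof -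
  have "((\<lambda>x. H_int x) has_derivative dH_int x) (at x)"
    unfolding H_int_coords dH_int_def case_prod_unfold
    by (rule has_derivative_eq_rhs, (rule has_derivative_polynomial)+)
      (simp add: fun_eq_iff field_simps)
  then show ?thesis .
qed

lemma has_derivative_K_int: "(K_int l has_derivative dK_int l x) (at x)"
proof -
  have "((\<lambda>x. K_int l x) has_derivative dK_int l x) (at x)"
    unfolding K_int_coords dK_int_def case_prod_unfold
    by (rule has_derivative_eq_rhs, (rule has_derivative_polynomial)+)
      (simp add: fun_eq_iff field_simps)
  then show ?thesis .
qed

lemma has_derivative_G_int: "(G_int a b l has_derivative dG_int a b l x) (at x)"
proof -
  define A where "A x = 2 * crd1 x 1 * crd2 x 1 + 2 * crd1 x 2 * crd2 x 2 + (crd1 x 3 + l) * crd2 x 3" for x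
  define B where "B x = 2 * crd1 x 1 * crd3 x 1 + 2 * crd1 x 2 * crd3 x 2 + (crd1 x 3 + l) * crd3 x 3" for x
  define C where "C x = 2 * crd1 x 1 * (crd2 x 2 * crd3 x 3 - crd2 x 3 * crd3 x 2)
      + 2 * crd1 x 2 * (crd2 x 3 * crd3 x 1 - crd2 x 1 * crd3 x 3)
      + (crd1 x 3 + l) * (crd2 x 1 * crd3 x 2 - crd2 x 2 * crd3 x 1)" for x
  define A' where "A' v = 2 * crd1 x 1 * crd2 v 1 + 2 * crd1 x 2 * crd2 v 2 + (crd1 x 3 + l) * crd2 v 3
      + 2 * crd1 v 1 * crd2 x 1 + 2 * crd1 v 2 * crd2 x 2 + crd1 v 3 * crd2 x 3" for v
  define B' where "B' v = 2 * crd1 x 1 * crd3 v 1 + 2 * crd1 x 2 * crd3 v 2 + (crd1 x 3 + l) * crd3 v 3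
      + 2 * crd1 v 1 * crd3 x 1 + 2 * crd1 v 2 * crd3 x 2 + crd1 v 3 * crd3 x 3" for v
  define C' where "C' v = 2 * crd1 v 1 * (crd2 x 2 * crd3 x 3 - crd2 x 3 * crd3 x 2)
      + 2 * crd1 v 2 * (crd2 x 3 * crd3 x 1 - crd2 x 1 * crd3 x 3)
      + crd1 v 3 * (crd2 x 1 * crd3 x 2 - crd2 x 2 * crd3 x 1)
      + 2 * crd1 x 1 * (crd2 v 2 * crd3 x 3 - crd2 v 3 * crd3 x 2 + crd2 x 2 * crd3 v 3 - crd2 x 3 * crd3 v 2)
      + 2 * crd1 x 2 * (crd2 v 3 * crd3 x 1 - crd2 v 1 * crd3 x 3 + crd2 x 3 * crd3 v 1 - crd2 x 1 * crd3 v 3)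
      + (crd1 x 3 + l) * (crd2 v 1 * crd3 x 2 - crd2 v 2 * crd3 x 1 + crd2 x 1 * crd3 v 2 - crd2 x 2 * crd3 v 1)" for v
  have A: "(A has_derivative A') (at x)"
    unfolding A_def[abs_def] A'_def[abs_def]
    by (rule has_derivative_eq_rhs, (rule has_derivative_polynomial)+) (simp add: fun_eq_iff algebra_simps)
  have B: "(B has_derivative B') (at x)"
    unfolding B_def[abs_def] B'_def[abs_def]
    by (rule has_derivative_eq_rhs, (rule has_derivative_polynomial)+) (simp add: fun_eq_iff algebra_simps)
  have C: "(C has_derivative C') (at x)"
    unfolding C_def[abs_def] C'_def[abs_def]
    by (rule has_derivative_eq_rhs, (rule has_derivative_polynomial)+) (simp add: fun_eq_iff algebra_simps)
  have "((\<lambda>x. ((A x)^2 + (B x)^2) / 4 + (crd1 x 3 - l) * C x / 2 - b^2 * crd2 x 1 - a^2 * crd3 x 2)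
    has_derivative (\<lambda>v. A x * A' v / 2 + B x * B' v / 2 + crd1 v 3 * C x / 2 + (crd1 x 3 - l) * C' v / 2
      - b^2 * crd2 v 1 - a^2 * crd3 v 2)) (at x)"
    by (rule has_derivative_eq_rhs, (rule A B C has_derivative_polynomial)+) (simp add: fun_eq_iff field_simps)
  moreover have "G_int a b l = (\<lambda>x. ((A x)^2 + (B x)^2) / 4 + (crd1 x 3 - l) * C x / 2 - b^2 * crd2 x 1 - a^2 * crd3 x 2)"
    by (rule ext) (simp only: G_int_coords A_def B_def C_def)
  moreover have "dG_int a b l x = (\<lambda>v. A x * A' v / 2 + B x * B' v / 2 + crd1 v 3 * C x / 2 + (crd1 x 3 - l) * C' v / 2
      - b^2 * crd2 v 1 - a^2 * crd3 v 2)"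
    by (rule ext) (simp only: dG_int_def case_prod_unfold A_def B_def C_def A'_def B'_def C'_def)
  ultimately show ?thesis by simp
qed

lemma Ck_on_integrals:
  "Ck_on n H_int UNIV" "Ck_on n (K_int l) UNIV" "Ck_on n (G_int a b l) UNIV"
proof -
  note intros = Ck_on_add[OF open_UNIV] Ck_on_diff[OF open_UNIV] Ck_on_mult[OF open_UNIV] Ck_on_power[OF open_UNIV]
    Ck_on_const Ck_on_linear[OF bounded_linear_coordinates(1)] Ck_on_linear[OF bounded_linear_coordinates(2)]
    Ck_on_linear[OF bounded_linear_coordinates(3)]
  show "Ck_on n H_int UNIV" "Ck_on n (K_int l) UNIV" "Ck_on n (G_int a b l) UNIV"
    unfolding H_int_coords[abs_def] K_int_coords[abs_def] G_int_coords[abs_def] divide_inverse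
    by (intro intros)+
qed

definition constraint :: "real \<Rightarrow> real \<Rightarrow> state \<Rightarrow> real \<times> real \<times> real" where
  "constraint a b = (\<lambda>(w, \<alpha>, \<beta>). (\<alpha> \<bullet> \<alpha> - a^2, \<beta> \<bullet> \<beta> - b^2, \<alpha> \<bullet> \<beta>))"

lemma phase_space_eq: "phase_space a b = {x. constraint a b x = 0}"
  by (auto simp: phase_space_def constraint_def zero_prod_def)

lemma bounded_linear_blocks:
  "bounded_linear (\<lambda>x :: state. fst (snd x))" "bounded_linear (\<lambda>x :: state. snd (snd x))"
  by (intro bounded_linear_compose[OF bounded_linear_fst] bounded_linear_compose[OF bounded_linear_snd]
      bounded_linear_snd)+

lemma Ck_on_constraint: "Ck_on n (constraint a b) UNIV"
  unfolding constraint_def case_prod_unfold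
  by (intro Ck_on_Pair Ck_on_diff Ck_on_inner Ck_on_const Ck_on_linear[OF bounded_linear_blocks(1)]
      Ck_on_linear[OF bounded_linear_blocks(2)] open_UNIV)

lemma has_derivative_constraint:
  "(constraint a b has_derivative (\<lambda>(dw, d\<alpha>, d\<beta>).
    (2 * (fst (snd x) \<bullet> d\<alpha>), 2 * (snd (snd x) \<bullet> d\<beta>), fst (snd x) \<bullet> d\<beta> + d\<alpha> \<bullet> snd (snd x)))) (at x)"
  unfolding constraint_def case_prod_unfold
  by (rule has_derivative_eq_rhs, (rule derivative_intros bounded_linear_blocks[THEN bounded_linear.has_derivative, OF has_derivative_ident])+)
    (simp add: fun_eq_iff inner_commute)

lemma Ck_on_momentum_map: "Ck_on n (momentum_map a b l) UNIV"
  unfolding momentum_map_def[abs_def] by (intro Ck_on_Pair Ck_on_integrals open_UNIV)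

text \<open>The constraints fix the norms of \<open>\<alpha>\<close> and \<open>\<beta>\<close>, and then the energy bounds \<open>\<omega>\<close>.\<close>

lemma momentum_map_proper:
  "compact {x. constraint a b x = 0 \<and> momentum_map a b l x \<in> cball c 1}" (is "compact ?C")
proof -
  have "closed ?C"
  proof -
    have "closed {x. constraint a b x = 0}"
      by (intro closed_Collect_eq continuous_on_const Ck_on_continuous[OF Ck_on_constraint])
    moreover have "closed (momentum_map a b l -` cball c 1)"
      by (intro closed_vimage closed_cball Ck_on_continuous[OF Ck_on_momentum_map])
    ultimately have "closed ({x. constraint a b x = 0} \<inter> momentum_map a b l -` cball c 1)" by (rule closed_Int)
    then show ?thesis by (simp add: Collect_conj_eq vimage_def)
  qed
  moreover have "bounded ?C"
  proof -
    define h where "h = \<bar>snd (snd c)\<bar> + 1 + \<bar>a\<bar> + \<bar>b\<bar>"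
    have "norm x \<le> (1 + 2 * h) + (\<bar>a\<bar> + \<bar>b\<bar>)" if "x \<in> ?C" for x
    proof -
      obtain w \<alpha> \<beta> where x: "x = (w, \<alpha>, \<beta>)" by (rule prod_cases3)
      have "\<alpha> \<bullet> \<alpha> = a^2" "\<beta> \<bullet> \<beta> = b^2"
        using that by (auto simp: x constraint_def zero_prod_def)
      then have n: "norm \<alpha> = \<bar>a\<bar>" "norm \<beta> = \<bar>b\<bar>"
        by (simp_all add: norm_eq_sqrt_inner)
      have "dist (snd (snd c)) (snd (snd (momentum_map a b l x))) \<le> dist c (momentum_map a b l x)"
        by (rule order_trans[OF dist_snd_le dist_snd_le])
      also have "\<dots> \<le> 1" using that by simp
      finally have "H_int x \<le> \<bar>snd (snd c)\<bar> + 1" by (simp add: dist_real_def momentum_map_def)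
      moreover have "\<alpha>$1 \<le> \<bar>a\<bar>" "\<beta>$2 \<le> \<bar>b\<bar>"
        using component_le_norm_cart[of \<alpha> 1] component_le_norm_cart[of \<beta> 2] n by auto
      ultimately have "(w$1)^2 + (w$2)^2 + (w$3)^2 / 2 \<le> h"
        by (simp add: x H_int_def h_def)
      moreover have "(norm w)^2 = (w$1)^2 + (w$2)^2 + (w$3)^2"
        unfolding power2_norm_eq_inner by (simp add: inner_vec_def sum_3 power2_eq_square)
      moreover have "norm w \<le> 1 + (norm w)^2"
        using zero_le_power2[of "norm w - 1 / 2"] by (simp add: power2_diff power2_eq_square[of "1 / 2 :: real"])
      ultimately have "norm w \<le> 1 + 2 * h"
        using zero_le_power2[of "w$1"] zero_le_power2[of "w$2"] by linarith
      moreover have "norm x \<le> norm w + (norm \<alpha> + norm \<beta>)"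
        unfolding x by (rule order_trans[OF norm_Pair_le]) (intro add_left_mono norm_Pair_le)
      ultimately show ?thesis using n by simp
    qed
    then show ?thesis unfolding bounded_iff by blast
  qed
  ultimately show ?thesis by (simp add: compact_eq_bounded_closed)
qed

lemma not_surj_annihilator:
  fixes A :: "'a::euclidean_space \<Rightarrow> 'n::euclidean_space"
  assumes "linear A" "\<not> surj A"
  obtains \<nu> where "\<nu> \<noteq> 0" "\<And>v. \<nu> \<bullet> A v = 0"
proof -
  have s: "subspace (range A)" by (rule linear_subspace_image[OF assms(1) subspace_UNIV])
  then have "span (range A) = range A" by (simp only: span_eq_iff)
  then have "span (range A) \<noteq> UNIV" using assms(2) by metis
  then have "dim (range A) \<noteq> DIM('n)" by (simp add: dim_eq_full)
  with dim_subset_UNIV[of "range A"] have "dim (range A) < DIM('n)" by linarith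
  then obtain \<nu> where \<nu>: "\<nu> \<noteq> 0" "\<And>y. y \<in> span (range A) \<Longrightarrow> orthogonal \<nu> y"
    using orthogonal_to_subspace_exists by blast
  have "\<nu> \<bullet> A v = 0" for v
    using \<nu>(2)[OF span_base[OF rangeI]] by (simp add: orthogonal_def)
  with \<nu>(1) show ?thesis by (rule that)
qed

text \<open>Failure of local triviality yields a point where \<open>(J, q)\<close> is no submersion, hence Lagrange
  multipliers. Evaluating along \<open>\<alpha>\<close> and \<open>\<beta>\<close> themselves shows that the gradients of the constraints
  are independent, so some multiplier of an integral is nonzero.\<close>

theorem bifurcation_diagram_critical:
  assumes "a > 0" "b > 0" and c: "c \<in> bifurcation_diagram (phase_space a b) (momentum_map a b l)"
  obtains w \<alpha> \<beta> cG cK cH where "(w, \<alpha>, \<beta>) \<in> phase_space a b" "momentum_map a b l (w, \<alpha>, \<beta>) = c"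
    "(cG, cK, cH) \<noteq> 0"
    "\<And>dw d\<alpha> d\<beta>. \<alpha> \<bullet> d\<alpha> = 0 \<Longrightarrow> \<beta> \<bullet> d\<beta> = 0 \<Longrightarrow> \<alpha> \<bullet> d\<beta> + d\<alpha> \<bullet> \<beta> = 0 \<Longrightarrow>
      cG * dG_int a b l (w, \<alpha>, \<beta>) (dw, d\<alpha>, d\<beta>) + cK * dK_int l (w, \<alpha>, \<beta>) (dw, d\<alpha>, d\<beta>)
      + cH * dH_int (w, \<alpha>, \<beta>) (dw, d\<alpha>, d\<beta>) = 0"
proof -
  let ?q = "constraint a b" and ?J = "momentum_map a b l"
  have "\<exists>x. ?q x = 0 \<and> ?J x = c \<and> \<not> surj (frechet_derivative (\<lambda>x. (?J x, ?q x)) (at x))"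
  proof (rule ccontr)
    assume none: "\<not> ?thesis"
    have "\<exists>U. open U \<and> c \<in> U \<and> trivial_fibration_over {x. ?q x = 0} ?J U"
    proof (rule submersion_trivial_near_compact_fibre[OF Ck_on_momentum_map Ck_on_constraint momentum_map_proper])
      fix x assume "?q x = 0" "?J x = c"
      with none show "surj (frechet_derivative (\<lambda>x. (?J x, ?q x)) (at x))" by blast
    qed
    with c show False unfolding bifurcation_diagram_def phase_space_eq by blast
  qed
  then obtain x where x: "?q x = 0" "?J x = c" "\<not> surj (frechet_derivative (\<lambda>x. (?J x, ?q x)) (at x))"
    by (elim exE conjE)
  obtain w \<alpha> \<beta> where w: "x = (w, \<alpha>, \<beta>)" by (rule prod_cases3)
  define D where "D = (\<lambda>v. ((dG_int a b l x v, dK_int l x v, dH_int x v),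
     (\<lambda>(dw, d\<alpha>, d\<beta>). (2 * (fst (snd x) \<bullet> d\<alpha>), 2 * (snd (snd x) \<bullet> d\<beta>), fst (snd x) \<bullet> d\<beta> + d\<alpha> \<bullet> snd (snd x))) v))"
  have D: "((\<lambda>x. (?J x, ?q x)) has_derivative D) (at x)"
    unfolding D_def momentum_map_def
    by (intro has_derivative_Pair has_derivative_G_int has_derivative_K_int has_derivative_H_int has_derivative_constraint)
  obtain \<nu> where \<nu>: "\<nu> \<noteq> 0" "\<And>v. \<nu> \<bullet> D v = 0"
    using not_surj_annihilator[OF has_derivative_linear[OF D]] x(3)
    unfolding frechet_derivative_eqI[OF D] by blast
  obtain u m where "\<nu> = (u, m)" by (rule prod.exhaust)
  moreover obtain cG cK cH where "u = (cG, cK, cH)" by (rule prod_cases3)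
  moreover obtain m1 m2 m3 where "m = (m1, m2, m3)" by (rule prod_cases3)
  ultimately have c: "\<nu> = ((cG, cK, cH), (m1, m2, m3))" by simp
  have eq: "cG * dG_int a b l (w, \<alpha>, \<beta>) (dw, d\<alpha>, d\<beta>) + cK * dK_int l (w, \<alpha>, \<beta>) (dw, d\<alpha>, d\<beta>)
      + cH * dH_int (w, \<alpha>, \<beta>) (dw, d\<alpha>, d\<beta>)
      + (m1 * (2 * (\<alpha> \<bullet> d\<alpha>)) + m2 * (2 * (\<beta> \<bullet> d\<beta>)) + m3 * (\<alpha> \<bullet> d\<beta> + d\<alpha> \<bullet> \<beta>)) = 0" for dw d\<alpha> d\<beta>
    using \<nu>(2)[of "(dw, d\<alpha>, d\<beta>)"] by (simp add: D_def c w)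
  have ps: "\<alpha> \<bullet> \<alpha> = a^2" "\<beta> \<bullet> \<beta> = b^2" "\<alpha> \<bullet> \<beta> = 0"
    using x(1) by (auto simp: w constraint_def zero_prod_def)
  have "(cG, cK, cH) \<noteq> 0"
  proof
    assume "(cG, cK, cH) = 0"
    then have 0: "cG = 0" "cK = 0" "cH = 0" by (simp_all add: zero_prod_def)
    have "m1 = 0" using eq[of 0 \<alpha> 0] assms(1) by (simp add: 0 ps)
    moreover have "m2 = 0" using eq[of 0 0 \<beta>] assms(2) by (simp add: 0 ps)
    moreover have "m3 = 0" using eq[of 0 \<beta> 0] assms(2) calculation by (simp add: 0 ps)
    ultimately show False using \<nu>(1) by (simp add: c 0 zero_prod_def)
  qed
  moreover have "cG * dG_int a b l (w, \<alpha>, \<beta>) (dw, d\<alpha>, d\<beta>) + cK * dK_int l (w, \<alpha>, \<beta>) (dw, d\<alpha>, d\<beta>)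
      + cH * dH_int (w, \<alpha>, \<beta>) (dw, d\<alpha>, d\<beta>) = 0"
    if "\<alpha> \<bullet> d\<alpha> = 0" "\<beta> \<bullet> d\<beta> = 0" "\<alpha> \<bullet> d\<beta> + d\<alpha> \<bullet> \<beta> = 0" for dw d\<alpha> d\<beta>
    using eq[of dw d\<alpha> d\<beta>] that by simp
  moreover have "(w, \<alpha>, \<beta>) \<in> phase_space a b" "?J (w, \<alpha>, \<beta>) = c"
    using x(1,2) by (simp_all add: w phase_space_eq)
  ultimately show ?thesis by (intro that)
qed

section \<open>Critical points in complex coordinates\<close>

lemma (in lax_critical) dFc_combine_zero:
  assumes "dFc u1 u2 u3 u4 u5 u6 u7 u8 u9 = 0" "dFc v1 v2 v3 v4 v5 v6 v7 v8 v9 = 0"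
    and "r1 = c * u1 + d * v1" "r2 = c * u2 + d * v2" "r3 = c * u3 + d * v3" "r4 = c * u4 + d * v4"
      "r5 = c * u5 + d * v5" "r6 = c * u6 + d * v6" "r7 = c * u7 + d * v7" "r8 = c * u8 + d * v8" "r9 = c * u9 + d * v9"
  shows "dFc r1 r2 r3 r4 r5 r6 r7 r8 r9 = 0"
  unfolding assms(3-11) dFc_lincomb using assms(1,2) by simp

locale gyrostat_point =
  fixes w \<alpha> \<beta> :: "real^3" and a b l \<phi>0 \<phi>1 \<psi> :: real
  assumes on_phase_space: "(w, \<alpha>, \<beta>) \<in> phase_space a b"
begin

sublocale lax_critical "Complex (w$1) (w$2)" "Complex (w$1) (- (w$2))" "of_real (w$3)"
  "Complex (\<alpha>$1 - \<beta>$2) (\<alpha>$2 + \<beta>$1)" "Complex (\<alpha>$1 - \<beta>$2) (- (\<alpha>$2 + \<beta>$1))"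
  "Complex (\<alpha>$1 + \<beta>$2) (\<alpha>$2 - \<beta>$1)" "Complex (\<alpha>$1 + \<beta>$2) (- (\<alpha>$2 - \<beta>$1))"
  "Complex (\<alpha>$3) (\<beta>$3)" "Complex (\<alpha>$3) (- (\<beta>$3))" "of_real l" "of_real \<phi>0" "of_real \<phi>1" "of_real \<psi>" .

lemma constraints:
  "a^2 = (\<alpha>$1)^2 + (\<alpha>$2)^2 + (\<alpha>$3)^2" "b^2 = (\<beta>$1)^2 + (\<beta>$2)^2 + (\<beta>$3)^2"
  "\<alpha>$1 * \<beta>$1 + \<alpha>$2 * \<beta>$2 + \<alpha>$3 * \<beta>$3 = 0"
  using on_phase_space by (simp_all add: phase_space_def inner_vec_def sum_3 power2_eq_square)

lemma rho_eq:
  "(Complex (\<alpha>$3) (\<beta>$3))^2 + Complex (\<alpha>$1 - \<beta>$2) (\<alpha>$2 + \<beta>$1) * Complex (\<alpha>$1 + \<beta>$2) (- (\<alpha>$2 - \<beta>$1)) = of_real (a^2 - b^2)"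
  "(Complex (\<alpha>$3) (- (\<beta>$3)))^2 + Complex (\<alpha>$1 - \<beta>$2) (- (\<alpha>$2 + \<beta>$1)) * Complex (\<alpha>$1 + \<beta>$2) (\<alpha>$2 - \<beta>$1) = of_real (a^2 - b^2)"
  using constraints(3) unfolding constraints(1,2)
  by (simp_all add: complex_eq_iff power2_eq_square algebra_simps)

lemma pp_eq: "pp = of_real (a^2 + b^2)"
  unfolding pp_def constraints(1,2) by (simp add: complex_eq_iff power2_eq_square field_simps)

lemma rr_eq: "rr = of_real ((a^2 - b^2)^2)"
  unfolding rr_def rho_eq by (simp add: power2_eq_square)

lemma Hc_eq: "Hc = of_real (H_int (w, \<alpha>, \<beta>))"
  unfolding Hc_def H_int_def by (simp add: complex_eq_iff power2_eq_square field_simps)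

lemma ht_eq: "ht = of_real (H_int (w, \<alpha>, \<beta>) - l^2 / 2)"
  unfolding ht_def Hc_eq by simp

lemma Kc_eq: "Kc = of_real (K_int l (w, \<alpha>, \<beta>))"
  unfolding Kc_def K_int_def by (simp add: complex_eq_iff power2_eq_square algebra_simps)

lemma Gc_eq: "Gc = of_real (G_int a b l (w, \<alpha>, \<beta>))"
  unfolding Gc_def pp_eq rho_eq G_int_coords
  by (simp add: complex_eq_iff power2_eq_square field_simps)

lemma dGc_eq:
  "of_real (dG_int a b l (w, \<alpha>, \<beta>) (dw, d\<alpha>, d\<beta>)) =
    dGc (Complex (dw$1) (dw$2)) (Complex (dw$1) (- (dw$2))) (of_real (dw$3))
      (Complex (d\<alpha>$1 - d\<beta>$2) (d\<alpha>$2 + d\<beta>$1)) (Complex (d\<alpha>$1 - d\<beta>$2) (- (d\<alpha>$2 + d\<beta>$1)))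
      (Complex (d\<alpha>$1 + d\<beta>$2) (d\<alpha>$2 - d\<beta>$1)) (Complex (d\<alpha>$1 + d\<beta>$2) (- (d\<alpha>$2 - d\<beta>$1)))
      (Complex (d\<alpha>$3) (d\<beta>$3)) (Complex (d\<alpha>$3) (- (d\<beta>$3)))"
  unfolding dGc_def pp_eq rho_eq dG_int_def case_prod_conv
  by (simp add: complex_eq_iff power2_eq_square field_simps)

lemma dKc_eq:
  "of_real (dK_int l (w, \<alpha>, \<beta>) (dw, d\<alpha>, d\<beta>)) =
    dKc (Complex (dw$1) (dw$2)) (Complex (dw$1) (- (dw$2))) (of_real (dw$3))
      (Complex (d\<alpha>$1 - d\<beta>$2) (d\<alpha>$2 + d\<beta>$1)) (Complex (d\<alpha>$1 - d\<beta>$2) (- (d\<alpha>$2 + d\<beta>$1)))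
      (Complex (d\<alpha>$1 + d\<beta>$2) (d\<alpha>$2 - d\<beta>$1)) (Complex (d\<alpha>$1 + d\<beta>$2) (- (d\<alpha>$2 - d\<beta>$1)))
      (Complex (d\<alpha>$3) (d\<beta>$3)) (Complex (d\<alpha>$3) (- (d\<beta>$3)))"
  unfolding dKc_def dK_int_def case_prod_conv
  by (simp add: complex_eq_iff power2_eq_square algebra_simps)

lemma dHc_eq:
  "of_real (dH_int (w, \<alpha>, \<beta>) (dw, d\<alpha>, d\<beta>)) =
    dHc (Complex (dw$1) (dw$2)) (Complex (dw$1) (- (dw$2))) (of_real (dw$3))
      (Complex (d\<alpha>$1 - d\<beta>$2) (d\<alpha>$2 + d\<beta>$1)) (Complex (d\<alpha>$1 - d\<beta>$2) (- (d\<alpha>$2 + d\<beta>$1)))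
      (Complex (d\<alpha>$1 + d\<beta>$2) (d\<alpha>$2 - d\<beta>$1)) (Complex (d\<alpha>$1 + d\<beta>$2) (- (d\<alpha>$2 - d\<beta>$1)))
      (Complex (d\<alpha>$3) (d\<beta>$3)) (Complex (d\<alpha>$3) (- (d\<beta>$3)))"
  unfolding dHc_def dH_int_def case_prod_conv
  by (simp add: complex_eq_iff algebra_simps)

text \<open>The six tangent directions used are the three coordinate directions of \<open>\<omega>\<close> and the three
  infinitesimal rotations \<open>(\<alpha> \<times> e, \<beta> \<times> e)\<close>. By linearity their complex combinations are also annihilated.\<close>

lemma critical_equations:
  assumes crit: "\<And>dw d\<alpha> d\<beta>. \<alpha> \<bullet> d\<alpha> = 0 \<Longrightarrow> \<beta> \<bullet> d\<beta> = 0 \<Longrightarrow> \<alpha> \<bullet> d\<beta> + d\<alpha> \<bullet> \<beta> = 0 \<Longrightarrow>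
      \<phi>1 * dG_int a b l (w, \<alpha>, \<beta>) (dw, d\<alpha>, d\<beta>) + \<phi>0 / 2 * dK_int l (w, \<alpha>, \<beta>) (dw, d\<alpha>, d\<beta>)
      - (\<psi> + \<phi>0 * (H_int (w, \<alpha>, \<beta>) - l^2 / 2)) * dH_int (w, \<alpha>, \<beta>) (dw, d\<alpha>, d\<beta>) = 0"
  shows "W1 = 0" "W2 = 0" "W3 = 0" "U1 = 0" "U2 = 0" "U3 = 0"
proof -
  have dF: "dFc (Complex (dw$1) (dw$2)) (Complex (dw$1) (- (dw$2))) (of_real (dw$3))
      (Complex (d\<alpha>$1 - d\<beta>$2) (d\<alpha>$2 + d\<beta>$1)) (Complex (d\<alpha>$1 - d\<beta>$2) (- (d\<alpha>$2 + d\<beta>$1)))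
      (Complex (d\<alpha>$1 + d\<beta>$2) (d\<alpha>$2 - d\<beta>$1)) (Complex (d\<alpha>$1 + d\<beta>$2) (- (d\<alpha>$2 - d\<beta>$1)))
      (Complex (d\<alpha>$3) (d\<beta>$3)) (Complex (d\<alpha>$3) (- (d\<beta>$3))) = 0"
    if "\<alpha> \<bullet> d\<alpha> = 0" "\<beta> \<bullet> d\<beta> = 0" "\<alpha> \<bullet> d\<beta> + d\<alpha> \<bullet> \<beta> = 0" for dw d\<alpha> d\<beta> :: "real^3"
    unfolding dFc_def dGc_eq[symmetric] dKc_eq[symmetric] dHc_eq[symmetric] ht_eq
    using arg_cong[OF crit[OF that, of dw], of complex_of_real] by simp
  have w1: "dFc 1 1 0 0 0 0 0 0 0 = 0"
    using dF[of 0 0 "vector [1, 0, 0]"] by (simp add: Complex_eq)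
  have w2: "dFc \<i> (- \<i>) 0 0 0 0 0 0 0 = 0"
    using dF[of 0 0 "vector [0, 1, 0]"] by (simp add: Complex_eq)
  have w3: "dFc 0 0 1 0 0 0 0 0 0 = 0"
    using dF[of 0 0 "vector [0, 0, 1]"] by (simp add: Complex_eq)
  have tangent: "\<alpha> \<bullet> cross3 \<alpha> e = 0" "\<beta> \<bullet> cross3 \<beta> e = 0" "\<alpha> \<bullet> cross3 \<beta> e + cross3 \<alpha> e \<bullet> \<beta> = 0" for e
    by (simp_all add: cross3_def inner_vec_def sum_3 vector_3 algebra_simps)
  note rot = dF[OF tangent, of 0]
  let ?x1 = "Complex (\<alpha>$1 - \<beta>$2) (\<alpha>$2 + \<beta>$1)" and ?x2 = "Complex (\<alpha>$1 - \<beta>$2) (- (\<alpha>$2 + \<beta>$1))"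
  let ?y1 = "Complex (\<alpha>$1 + \<beta>$2) (\<alpha>$2 - \<beta>$1)" and ?y2 = "Complex (\<alpha>$1 + \<beta>$2) (- (\<alpha>$2 - \<beta>$1))"
  let ?z1 = "Complex (\<alpha>$3) (\<beta>$3)" and ?z2 = "Complex (\<alpha>$3) (- (\<beta>$3))"
  have cross: "cross3 u (vector [1, 0, 0]) = vector [0, u$3, - (u$2)]" "cross3 u (vector [0, 1, 0]) = vector [- (u$3), 0, u$1]"
    "cross3 u (vector [0, 0, 1]) = vector [u$2, - (u$1), 0]" for u :: "real^3"
    by (simp_all add: cross3_def vector_3)
  have r1: "dFc 0 0 0 (\<i> * ?z1) (- \<i> * ?z2) (\<i> * ?z2) (- \<i> * ?z1) (\<i> * (?x1 - ?y2) / 2) (\<i> * (?y1 - ?x2) / 2) = 0"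
    by (rule dFc_combine_zero[OF rot[of "vector [1, 0, 0]", unfolded cross vector_3]
          rot[of "vector [1, 0, 0]", unfolded cross vector_3], of _ 1 0]; simp add: complex_eq_iff field_simps)
  have r2: "dFc 0 0 0 (- ?z1) (- ?z2) (- ?z2) (- ?z1) ((?x1 + ?y2) / 2) ((?x2 + ?y1) / 2) = 0"
    by (rule dFc_combine_zero[OF rot[of "vector [0, 1, 0]", unfolded cross vector_3]
          rot[of "vector [0, 1, 0]", unfolded cross vector_3], of _ 1 0]; simp add: complex_eq_iff field_simps)
  have r3: "dFc 0 0 0 (- \<i> * ?x1) (\<i> * ?x2) (- \<i> * ?y1) (\<i> * ?y2) 0 0 = 0"
    by (rule dFc_combine_zero[OF rot[of "vector [0, 0, 1]", unfolded cross vector_3]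
          rot[of "vector [0, 0, 1]", unfolded cross vector_3], of _ 1 0]; simp add: complex_eq_iff field_simps)
  have "dFc 1 0 0 0 0 0 0 0 0 = 0" "dFc 0 1 0 0 0 0 0 0 0 = 0"
    by (rule dFc_combine_zero[OF w1 w2, of _ "1 / 2" "- \<i> / 2"]; simp)
      (rule dFc_combine_zero[OF w1 w2, of _ "1 / 2" "\<i> / 2"]; simp)
  then show W: "W1 = 0" "W2 = 0" "W3 = 0" using w3 by (simp_all only: W_eq)
  have "dFc 0 0 0 ?z1 0 ?z2 0 (- ?y2 / 2) (- ?x2 / 2) = 0"
    by (rule dFc_combine_zero[OF r1 r2, of _ "- \<i> / 2" "- 1 / 2"]; simp add: complex_eq_iff field_simps)
  then show "U1 = 0" unfolding U1_eq W by simp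
  have "dFc 0 0 0 0 (- ?z2) 0 (- ?z1) (?x1 / 2) (?y1 / 2) = 0"
    by (rule dFc_combine_zero[OF r1 r2, of _ "- \<i> / 2" "1 / 2"]; simp add: complex_eq_iff field_simps)
  then show "U2 = 0" unfolding U2_eq W by simp
  have "dFc 0 0 0 (- ?x1) ?x2 (- ?y1) ?y2 0 0 = 0"
    by (rule dFc_combine_zero[OF r3 r3, of _ "- \<i>" 0]; simp add: complex_eq_iff field_simps)
  then show "U3 = 0" unfolding U3_eq W by simp
qed

end

section \<open>From double roots to the bifurcation surfaces\<close>

lemma double_root_dvd:
  fixes p :: "complex poly"
  assumes "poly p s = 0" "poly (pderiv p) s = 0"
  shows "[:- s, 1:]^2 dvd p"
proof -
  obtain q where q: "p = [:- s, 1:] * q" using assms(1) by (auto simp: poly_eq_0_iff_dvd)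
  have "poly (pderiv p) s = poly q s"
    unfolding q pderiv_mult poly_add poly_mult by (simp add: pderiv_pCons)
  with assms(2) have "poly q s = 0" by simp
  then obtain t where t: "q = [:- s, 1:] * t" by (auto simp: poly_eq_0_iff_dvd)
  have "p = [:- s, 1:]^2 * t" by (simp only: q t power2_eq_square mult.assoc)
  then show ?thesis by (rule dvdI)
qed

lemma nonreal_double_root:
  fixes p :: "complex poly"
  assumes cnj: "\<And>x. poly p (cnj x) = cnj (poly p x)" "\<And>x. poly (pderiv p) (cnj x) = cnj (poly (pderiv p) x)"
    and s: "poly p s = 0" "poly (pderiv p) s = 0" "Im s \<noteq> 0"
  shows "[:of_real ((cmod s)^2), - 2 * of_real (Re s), 1:]^2 dvd p"
proof -
  have "[:- s, 1:]^2 dvd p" by (rule double_root_dvd[OF s(1,2)])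
  then obtain t where t: "p = [:- s, 1:]^2 * t" by (rule dvdE)
  have ne: "cnj s - s \<noteq> 0" using s(3) by (simp add: complex_eq_iff)
  have "poly p (cnj s) = (cnj s - s)^2 * poly t (cnj s)" unfolding t poly_mult poly_power by simp
  then have t0: "poly t (cnj s) = 0" using ne cnj(1)[of s] s(1) by simp
  have "poly (pderiv p) (cnj s) = (cnj s - s)^2 * poly (pderiv t) (cnj s)"
    unfolding t pderiv_mult poly_add poly_mult poly_power t0 by simp
  then have "poly (pderiv t) (cnj s) = 0" using ne cnj(2)[of s] s(2) by simp
  then have "[:- cnj s, 1:]^2 dvd t" by (rule double_root_dvd[OF t0])
  then have "[:- s, 1:]^2 * [:- cnj s, 1:]^2 dvd p" unfolding t by (rule mult_dvd_mono[OF dvd_refl])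
  moreover have "[:- s, 1:] * [:- cnj s, 1:] = [:of_real ((cmod s)^2), - 2 * of_real (Re s), 1:]"
    using complex_norm_square[of s] complex_add_cnj[of s] by (simp add: algebra_simps minus_add_distrib[symmetric] del: minus_add_distrib)
  ultimately show ?thesis by (simp add: power_mult_distrib[symmetric] del: mult_pCons_left)
qed

lemma Gamma_1_double_root:
  fixes g k h l p r :: real
  defines "q \<equiv> [:complex_of_real (- (r^4 / 4)), of_real (p^2 * (h + l^2 / 2) - 2 * g), of_real (- (2 * l^2 * h + k)), of_real (2 * l^2):]"
  assumes "l \<noteq> 0" "r \<noteq> 0" "poly q s = 0" "poly (pderiv q) s = 0"
  shows "(g, k, h) \<in> Gamma_1 p r l"
proof -
  have "Im s = 0"
  proof (rule ccontr)
    assume "Im s \<noteq> 0"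
    then have "[:of_real ((cmod s)^2), - 2 * of_real (Re s), 1:]^2 dvd q"
      using assms(4,5) by (intro nonreal_double_root) (simp_all add: q_def pderiv_pCons)
    moreover have "q \<noteq> 0" using assms(2) by (simp add: q_def)
    ultimately have "degree ([:complex_of_real ((cmod s)^2), - 2 * of_real (Re s), 1:]^2) \<le> degree q" by (rule dvd_imp_degree_le)
    moreover have "degree q \<le> 3" by (simp add: q_def)
    ultimately show False by (simp add: degree_power_eq)
  qed
  then obtain t where s: "s = of_real t" by (metis complex_is_Real_iff Reals_cases)
  have A: "poly q s = of_real (- (r^4 / 4) + t * (p^2 * (h + l^2 / 2) - 2 * g + t * (- (2 * l^2 * h + k) + t * (2 * l^2))))"
    by (simp add: q_def s)
  then have 1: "- (r^4 / 4) + t * (p^2 * (h + l^2 / 2) - 2 * g + t * (- (2 * l^2 * h + k) + t * (2 * l^2))) = 0"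
    using trans[OF A[symmetric] assms(4)] by (simp only: of_real_eq_0_iff)
  have B: "poly (pderiv q) s = of_real (p^2 * (h + l^2 / 2) - 2 * g + t * (- 2 * (2 * l^2 * h + k) + t * (6 * l^2)))"
    by (simp add: q_def s pderiv_pCons algebra_simps)
  then have 2: "p^2 * (h + l^2 / 2) - 2 * g + t * (- 2 * (2 * l^2 * h + k) + t * (6 * l^2)) = 0"
    using trans[OF B[symmetric] assms(5)] by (simp only: of_real_eq_0_iff)
  have t: "t \<noteq> 0" using 1 assms(3) by auto
  have "(2 * l^2 * h + k) * t^2 = 4 * l^2 * t^3 + r^4 / 4" using 1 2 by algebra
  then have k: "k = 4 * l^2 * t - 2 * l^2 * h + r^4 / (4 * t^2)"
    using t by (simp add: field_simps power2_eq_square power3_eq_cube)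
  define m where "m = p^2 * (h + l^2 / 2) - 2 * g"
  have "m * t = 2 * l^2 * t^3 + r^4 / 2" using 1 2 unfolding m_def[symmetric] by algebra
  then have "2 * g * t = p^2 * (h + l^2 / 2) * t - 2 * l^2 * t^3 - r^4 / 2" by (simp add: m_def algebra_simps)
  then have "g = - l\<^sup>2 * t^2 + p^2 * (h + l^2 / 2) / 2 - r^4 / (4 * t)"
    using t by (simp add: field_simps power2_eq_square power3_eq_cube)
  with k t show ?thesis unfolding Gamma_1_def by (auto intro!: exI[of _ t])
qed

text \<open>For a nonreal double root the conjugate is a double root too, and the monic quartic is the square
  of \<open>x\<^sup>2 - 2 u x + n\<close>. The constant term gives \<open>n\<^sup>2 = (a b)\<^sup>2\<close>, where \<open>n > 0\<close> selects the line \<open>\<Gamma>\<^sub>-\<close>.\<close>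

lemma Gamma_2_double_root:
  fixes g k h l p r a b :: real
  defines "e \<equiv> h - l^2 / 2"
  defines "q \<equiv> [:complex_of_real ((p^4 - r^4) / 4), of_real (- 2 * g), of_real (p^2 + e^2 - k), of_real (- 2 * e), 1:]"
  assumes ab: "a > 0" "b > 0" "p^2 = a^2 + b^2" "r^2 = a^2 - b^2"
    and root: "poly q s = 0" "poly (pderiv q) s = 0"
  shows "(g, k, h) \<in> Gamma_minus a b l \<union> Gamma_2 p r l"
proof -
  have pr: "(p^4 - r^4) / 4 = (a * b)^2"
  proof -
    have "p^4 - r^4 = (p^2)^2 - (r^2)^2" by simp
    then show ?thesis unfolding ab(3,4) by (simp add: power2_eq_square field_simps)
  qed
  show ?thesis
  proof (cases "Im s = 0")
    case False
    define u where "u = Re s"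
    define n where "n = (cmod s)^2"
    have "n > 0" using False by (auto simp: n_def)
    have "[:of_real n, - 2 * of_real u, 1:]^2 dvd q"
      unfolding n_def u_def using root False
      by (intro nonreal_double_root) (simp_all add: q_def pderiv_pCons)
    then obtain c where c: "q = [:of_real n, - 2 * of_real u, 1:]^2 * c" by (rule dvdE)
    have "q \<noteq> 0" by (simp add: q_def)
    then have "c \<noteq> 0" using c by auto
    have "degree q = 4" by (simp add: q_def)
    then have "degree c = 0"
      using c \<open>c \<noteq> 0\<close> by (simp add: degree_mult_eq degree_power_eq)
    then obtain d where d: "c = [:d:]" by (rule degree_eq_zeroE)
    have eq: "q = smult d [:of_real (n^2), of_real (- 4 * u * n), of_real (4 * u^2 + 2 * n), of_real (- 4 * u), 1:]"
      unfolding c d by (simp add: power2_eq_square algebra_simps)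
    then have "d = 1" by (simp add: q_def)
    with eq have co: "e = 2 * u" "p^2 + e^2 - k = 4 * u^2 + 2 * n" "- 2 * g = - 4 * u * n" "(p^4 - r^4) / 4 = n^2"
      unfolding q_def by (simp_all only: smult_1_left pCons_eq_iff of_real_eq_iff) simp_all
    have "n^2 = (a * b)^2" using co(4) pr by simp
    then have n: "n = a * b" using \<open>n > 0\<close> ab(1,2) by (simp add: power2_eq_iff_nonneg)
    have "k = (a - b)^2" using co(1,2) n ab(3) by (simp add: power2_eq_square algebra_simps)
    moreover have "g = a * b * (h - l^2 / 2)" using co(1,3) n by (simp add: e_def)
    ultimately show ?thesis by (simp add: Gamma_minus_def)
  next
    case True
    then obtain t where s: "s = of_real t" by (metis complex_is_Real_iff Reals_cases)
    define D where "D = (p^4 - r^4) / 4"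
    have A: "poly q s = of_real (D + t * (- 2 * g + t * (p^2 + e^2 - k + t * (- 2 * e + t))))"
      by (simp add: q_def s D_def)
    then have 1: "D + t * (- 2 * g + t * (p^2 + e^2 - k + t * (- 2 * e + t))) = 0"
      using trans[OF A[symmetric] root(1)] by (simp only: of_real_eq_0_iff)
    have B: "poly (pderiv q) s = of_real (- 2 * g + t * (2 * (p^2 + e^2 - k) + t * (- 6 * e + t * 4)))"
      by (simp add: q_def s pderiv_pCons algebra_simps)
    then have 2: "- 2 * g + t * (2 * (p^2 + e^2 - k) + t * (- 6 * e + t * 4)) = 0"
      using trans[OF B[symmetric] root(2)] by (simp only: of_real_eq_0_iff)
    have "D \<noteq> 0" unfolding D_def pr using ab(1,2) by simp
    then have t: "t \<noteq> 0" using 1 by auto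
    have "k * t^2 = 3 * t^4 - 4 * e * t^3 + (p^2 + e^2) * t^2 - D" using 1 2 by algebra
    then have "k = 3 * t^2 - 4 * e * t + p^2 + e^2 - D / t^2"
      using t by (simp add: field_simps power2_eq_square power3_eq_cube power4_eq_xxxx)
    then have k: "k = 3 * t^2 - 4 * (h - l^2 / 2) * t + p^2 + (h - l^2 / 2)^2 - (p^4 - r^4) / (4 * t^2)"
      by (simp add: e_def D_def)
    have "g * t = - (t^4) + e * t^3 + D" using 1 2 by algebra
    then have "g = - (t^3) + e * t^2 + D / t"
      using t by (simp add: field_simps power2_eq_square power3_eq_cube power4_eq_xxxx)
    then have "g = - (t^3) + (h - l^2 / 2) * t^2 + (p^4 - r^4) / (4 * t)" by (simp add: e_def D_def)
    with k t show ?thesis unfolding Gamma_2_def by (auto intro!: exI[of _ t])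
  qed
qed

text \<open>Criticality of \<open>H\<close> forces \<open>\<omega> = 0\<close> and \<open>\<alpha> = (\<plusminus>a, 0, 0)\<close>, \<open>\<beta> = (0, \<plusminus>b, 0)\<close>; the relative sign decides between
  the two lines.\<close>

lemma H_critical_Gamma:
  fixes w \<alpha> \<beta> :: "real^3"
  assumes ab: "a > b" "b > 0" and x: "(w, \<alpha>, \<beta>) \<in> phase_space a b"
    and crit: "\<And>dw d\<alpha> d\<beta>. \<alpha> \<bullet> d\<alpha> = 0 \<Longrightarrow> \<beta> \<bullet> d\<beta> = 0 \<Longrightarrow> \<alpha> \<bullet> d\<beta> + d\<alpha> \<bullet> \<beta> = 0 \<Longrightarrow>
      dH_int (w, \<alpha>, \<beta>) (dw, d\<alpha>, d\<beta>) = 0"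
  shows "momentum_map a b l (w, \<alpha>, \<beta>) \<in> Gamma_plus a b l \<union> Gamma_minus a b l"
proof -
  have c: "\<alpha>$1 * \<alpha>$1 + \<alpha>$2 * \<alpha>$2 + \<alpha>$3 * \<alpha>$3 = a^2" "\<beta>$1 * \<beta>$1 + \<beta>$2 * \<beta>$2 + \<beta>$3 * \<beta>$3 = b^2"
    "\<alpha>$1 * \<beta>$1 + \<alpha>$2 * \<beta>$2 + \<alpha>$3 * \<beta>$3 = 0"
    using x by (simp_all add: phase_space_def inner_vec_def sum_3)
  have w: "w$1 = 0" "w$2 = 0" "w$3 = 0"
    using crit[of 0 0 "vector [1, 0, 0]"] crit[of 0 0 "vector [0, 1, 0]"] crit[of 0 0 "vector [0, 0, 1]"]
    by (simp_all add: dH_int_def)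
  have tangent: "\<alpha> \<bullet> cross3 \<alpha> e = 0" "\<beta> \<bullet> cross3 \<beta> e = 0" "\<alpha> \<bullet> cross3 \<beta> e + cross3 \<alpha> e \<bullet> \<beta> = 0" for e
    by (simp_all add: cross3_def inner_vec_def sum_3 vector_3 algebra_simps)
  note rot = crit[OF tangent, of 0]
  have z: "\<beta>$3 = 0" "\<alpha>$3 = 0" "\<alpha>$2 = \<beta>$1"
    using rot[of "vector [1, 0, 0]"] rot[of "vector [0, 1, 0]"] rot[of "vector [0, 0, 1]"]
    by (simp_all add: dH_int_def cross3_def vector_3)
  have "\<alpha>$2 * (\<alpha>$1 + \<beta>$2) = 0" using c(3) by (simp add: z algebra_simps)
  moreover have "\<alpha>$1 + \<beta>$2 \<noteq> 0"
  proof
    assume "\<alpha>$1 + \<beta>$2 = 0"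
    then have "\<alpha>$1 = - \<beta>$2" by simp
    then have "a^2 = b^2" using c(1,2) by (simp add: z)
    then show False using ab by (simp add: power2_eq_iff_nonneg)
  qed
  ultimately have z2: "\<alpha>$2 = 0" "\<beta>$1 = 0" using z(3) by simp_all
  have "(\<alpha>$1)^2 = a^2" "(\<beta>$2)^2 = b^2" using c(1,2) by (simp_all add: z z2 power2_eq_square)
  then have s: "\<alpha>$1 = a \<or> \<alpha>$1 = - a" "\<beta>$2 = b \<or> \<beta>$2 = - b" by (simp_all add: power2_eq_iff)
  have H: "H_int (w, \<alpha>, \<beta>) = - \<alpha>$1 - \<beta>$2" by (simp add: H_int_coords w)
  have K: "K_int l (w, \<alpha>, \<beta>) = (\<alpha>$1 - \<beta>$2)^2" by (simp add: K_int_coords w z z2)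
  have G: "G_int a b l (w, \<alpha>, \<beta>) = - (l^2 * (\<alpha>$1 * \<beta>$2) / 2) - b^2 * \<alpha>$1 - a^2 * \<beta>$2"
    by (simp add: G_int_coords w z z2 power2_eq_square)
  show ?thesis
    unfolding momentum_map_def H K G Gamma_plus_def Gamma_minus_def
    using s by (auto simp: power2_eq_square algebra_simps)
qed

theorem theorem3:
  fixes a b l p r :: real
  assumes "a > b" and "b > 0" and "l \<noteq> 0"
    and "p = sqrt (a\<^sup>2 + b\<^sup>2)" and "r = sqrt (a\<^sup>2 - b\<^sup>2)"
  shows "bifurcation_diagram (phase_space a b) (momentum_map a b l)
    \<subseteq> Gamma_plus a b l \<union> Gamma_minus a b l \<union> Gamma_1 p r l \<union> Gamma_2 p r l"
proof
  fix c assume c: "c \<in> bifurcation_diagram (phase_space a b) (momentum_map a b l)"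
  have "a > 0" using assms(1,2) by simp
  have "b^2 < a^2" using assms(1,2) by (intro power_strict_mono) auto
  then have p2: "p^2 = a^2 + b^2" and r2: "r^2 = a^2 - b^2" using assms(4,5) by simp_all
  have r4: "r^4 = (a^2 - b^2)^2" and p4: "p^4 = (a^2 + b^2)^2"
    unfolding p2[symmetric] r2[symmetric] by simp_all
  have r0: "r \<noteq> 0" using r2 \<open>b^2 < a^2\<close> by auto
  show "c \<in> Gamma_plus a b l \<union> Gamma_minus a b l \<union> Gamma_1 p r l \<union> Gamma_2 p r l"
  proof (rule bifurcation_diagram_critical[OF \<open>a > 0\<close> \<open>b > 0\<close> c])
    fix w \<alpha> \<beta> cG cK cH
    assume x: "(w, \<alpha>, \<beta>) \<in> phase_space a b" and J: "momentum_map a b l (w, \<alpha>, \<beta>) = c"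
      and nz: "(cG, cK, cH) \<noteq> 0"
      and crit: "\<And>dw d\<alpha> d\<beta>. \<alpha> \<bullet> d\<alpha> = 0 \<Longrightarrow> \<beta> \<bullet> d\<beta> = 0 \<Longrightarrow> \<alpha> \<bullet> d\<beta> + d\<alpha> \<bullet> \<beta> = 0 \<Longrightarrow>
        cG * dG_int a b l (w, \<alpha>, \<beta>) (dw, d\<alpha>, d\<beta>) + cK * dK_int l (w, \<alpha>, \<beta>) (dw, d\<alpha>, d\<beta>)
        + cH * dH_int (w, \<alpha>, \<beta>) (dw, d\<alpha>, d\<beta>) = 0"
    show ?thesis
    proof (cases "cG = 0 \<and> cK = 0")
      case True
      then have "cH \<noteq> 0" using nz by (simp add: zero_prod_def)
      have "dH_int (w, \<alpha>, \<beta>) (dw, d\<alpha>, d\<beta>) = 0"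
        if "\<alpha> \<bullet> d\<alpha> = 0" "\<beta> \<bullet> d\<beta> = 0" "\<alpha> \<bullet> d\<beta> + d\<alpha> \<bullet> \<beta> = 0" for dw d\<alpha> d\<beta>
        using crit[OF that, of dw] True \<open>cH \<noteq> 0\<close> by simp
      then have "momentum_map a b l (w, \<alpha>, \<beta>) \<in> Gamma_plus a b l \<union> Gamma_minus a b l"
        by (rule H_critical_Gamma[OF assms(1,2) x])
      then show ?thesis using J by blast
    next
      case False
      define g where "g = G_int a b l (w, \<alpha>, \<beta>)"
      define k where "k = K_int l (w, \<alpha>, \<beta>)"
      define h where "h = H_int (w, \<alpha>, \<beta>)"
      have c_eq: "c = (g, k, h)" using J by (simp add: momentum_map_def g_def k_def h_def)
      \<comment> \<open>chosen so that the coefficient of \<open>dH\<close> in the critical equations is \<open>cH\<close>\<close>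
      define \<psi> where "\<psi> = - cH - 2 * cK * (h - l^2 / 2)"
      interpret gyrostat_point w \<alpha> \<beta> a b l "2 * cK" cG \<psi> by unfold_locales (rule x)
      have crit': "cG * dG_int a b l (w, \<alpha>, \<beta>) (dw, d\<alpha>, d\<beta>) + 2 * cK / 2 * dK_int l (w, \<alpha>, \<beta>) (dw, d\<alpha>, d\<beta>)
          - (\<psi> + 2 * cK * (H_int (w, \<alpha>, \<beta>) - l^2 / 2)) * dH_int (w, \<alpha>, \<beta>) (dw, d\<alpha>, d\<beta>) = 0"
        if "\<alpha> \<bullet> d\<alpha> = 0" "\<beta> \<bullet> d\<beta> = 0" "\<alpha> \<bullet> d\<beta> + d\<alpha> \<bullet> \<beta> = 0" for dw d\<alpha> d\<beta>
        using crit[OF that, of dw] by (simp add: \<psi>_def h_def)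
      have chi1: "chi1 = [:complex_of_real (- (r^4 / 4)), of_real (p^2 * (h + l^2 / 2) - 2 * g),
          of_real (- (2 * l^2 * h + k)), of_real (2 * l^2):]"
        unfolding chi1_def rr_eq pp_eq Hc_eq Gc_eq Kc_eq g_def k_def h_def r4 p2 by simp
      have chi2: "chi2 = [:complex_of_real ((p^4 - r^4) / 4), of_real (- 2 * g),
          of_real (p^2 + (h - l^2 / 2)^2 - k), of_real (- 2 * (h - l^2 / 2)), 1:]"
        unfolding chi2_def rr_eq pp_eq ht_eq Gc_eq Kc_eq g_def k_def h_def r4 p4 p2 by simp
      have "(a^2 + b^2)^2 - (a^2 - b^2)^2 = 4 * (a * b)^2" by (simp add: power2_eq_square algebra_simps)
      then have "(a^2 + b^2)^2 \<noteq> (a^2 - b^2)^2" using \<open>a > 0\<close> \<open>b > 0\<close> by auto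
      then have "pp^2 \<noteq> rr" unfolding pp_eq rr_eq by (simp only: of_real_power[symmetric] of_real_eq_iff not_False_eq_True)
      moreover have "(a^2 - b^2)^2 \<noteq> 0" using \<open>b^2 < a^2\<close> by simp
      then have "rr \<noteq> 0" unfolding rr_eq by (simp only: of_real_eq_0_iff not_False_eq_True)
      moreover have "complex_of_real l \<noteq> 0" using assms(3) by simp
      moreover have "complex_of_real (2 * cK) \<noteq> 0 \<or> complex_of_real cG \<noteq> 0" using False by auto
      ultimately have "\<not> rsquarefree chi1 \<or> \<not> rsquarefree chi2"
        using critical_double_root[OF critical_equations[OF crit']] by blast
      then show ?thesis
      proof
        assume "\<not> rsquarefree chi1"
        then obtain s where "poly chi1 s = 0" "poly (pderiv chi1) s = 0" by (auto simp: rsquarefree_roots)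
        then have "(g, k, h) \<in> Gamma_1 p r l"
          unfolding chi1 by (rule Gamma_1_double_root[OF assms(3) r0])
        then show ?thesis by (simp add: c_eq)
      next
        assume "\<not> rsquarefree chi2"
        then obtain s where "poly chi2 s = 0" "poly (pderiv chi2) s = 0" by (auto simp: rsquarefree_roots)
        then have "(g, k, h) \<in> Gamma_minus a b l \<union> Gamma_2 p r l"
          unfolding chi2 by (rule Gamma_2_double_root[OF \<open>a > 0\<close> \<open>b > 0\<close> p2 r2])
        then show ?thesis by (auto simp: c_eq)
      qed
    qed
  qed
qed

end
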